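(* Let $\Bbbk$ be a field, $\mathbf{P}$ a finite poset, and $\xi=(\xi_I\colon I^\xi\to\mathbf{P})_{I\in\mathbb{I}}$ a compression system. Fix an interval $I$ of $\mathbf{P}$ and let $\zeta\colon\mathbf{Z}\to\mathbf{P}$ be an order-preserving map that essentially covers $I$ relative to $\xi$. Then for every $M\in\operatorname{mod}\Bbbk[\mathbf{P}]$ we have $$\operatorname{mult}^\xi_IM=\bar d_{R_\zeta(M)}(R_\zeta(V_I)).$$
   Context: Incidence category and modules: for a poset $S$, $\Bbbk[S]$ is the $\Bbbk$-linear category with object set $S$, $\Bbbk[S](x,y)=\Bbbk p_{y,x}$ (one-dimensional) if $x\le y$ and $0$ otherwise, $p_{z,y}p_{y,x}=p_{z,x}$, identities $p_{x,x}$. An order-preserving map $f$ induces a linear functor $\Bbbk[f]$ by $x\mapsto f(x)$, $p_{y,x}\mapsto p_{f(y),f(x)}$. $\operatorname{mod}\Bbbk[S]$ is the category of $\Bbbk$-linear functors $\Bbbk[S]\to\operatorname{mod}\Bbbk$ (finite-dimensional vector spaces). For an order-preserving map $\zeta\colon\mathbf{Z}\to\mathbf{P}$, $R_\zeta\colon\operatorname{mod}\Bbbk[\mathbf{P}]\to\operatorname{mod}\Bbbk[\mathbf{Z}]$ is $M\mapsto M\circ\Bbbk[\zeta]$. Intervals: a nonempty full subposet $I\subseteq\mathbf{P}$ is an interval if it is connected (any two elements are joined by a finite sequence in $I$ whose consecutive elements are comparable) and convex. $\mathbb{I}$ is the set of all intervals; $\operatorname{sc}(I)$, $\operatorname{sk}(I)$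 are the sets of minimal and maximal elements. The interval module $V_I$ has $V_I(x)=\Bbbk$ for $x\in I$, $0$ otherwise, and $V_I(p_{y,x})=\mathrm{id}_\Bbbk$ if $x\le y$ are both in $I$, $0$ otherwise. A compression system is a family of order-preserving maps $\xi_I\colon I^\xi\to\mathbf{P}$ ($I\in\mathbb{I}$) from connected (nonempty) finite posets $I^\xi$ such that for all $I$ the image of $\xi_I$ is contained in $I$ and contains $\operatorname{sc}(I)\cup\operatorname{sk}(I)$. $R_I:=R_{\xi_I}$. The module $R_I(V_I)$ is indecomposable, and $\operatorname{mult}^\xi_IM$ is its multiplicity as a direct summand in the indecomposable decomposition of $R_I(M)$. $\bar d$: if $N\cong L^n\oplus N'$ with $n\ge0$ and $N'$ has no direct summand isomorphic to $L$, then $\bar d_N(L):=n$ ($L$ need not be indecomposable). Formal additive hull: for a linear category $B$, $\bigoplus B$ has as objects finite (possibly empty) sequences $(x_i)_{i\in[l]}$ of objects of $B$; morphisms $(x_i)_{i\in[l]}\to(y_j)_{j\in[m]}$ are matrices $[\alpha_{ji}]$ with $\alpha_{ji}\in B(x_i,y_j)$; composition is matrix multiplication (empty matrices are allowed when $l=0$ or $m=0$). A linear functor $F\colon B\to C$ induces $\bigoplus B\to\bigoplus C$ entrywise. For a $B$-module $W$ and $\mathbf{g}=[g_{ji}]\colon(x_i)\to(y_j)$ in $\bigoplus B$, $W(\mathbf{g})=[W(g_{ji})]\colon\bigoplus_iW(x_i)\to\bigoplus_jW(y_j)$. Covering: an order-preserving map $\eta\colon\mathbf{Z}\to S$ covers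 a morphism $\alpha$ of $\bigoplus\Bbbk[S]$ if there is a morphism $\alpha'$ of $\bigoplus\Bbbk[\mathbf{Z}]$ with $(\bigoplus\Bbbk[\eta])(\alpha')=\alpha$ (including equality of source and target). $I$-multiplicity matrix: a morphism $\mathbf{g}=\begin{bmatrix}\mathbf{g}_1&\mathbf{0}\\ \mathbf{g}_3&\mathbf{g}_2\end{bmatrix}$ (in block form) in $\bigoplus\Bbbk[I^\xi]$ is an $I$-multiplicity matrix under $\xi$ if for every $M\in\operatorname{mod}\Bbbk[\mathbf{P}]$, $$\operatorname{mult}^\xi_IM=\operatorname{rank}\begin{bmatrix}R_I(M)(\mathbf{g}_1)&\mathbf{0}\\R_I(M)(\mathbf{g}_3)&R_I(M)(\mathbf{g}_2)\end{bmatrix}-\operatorname{rank}\begin{bmatrix}R_I(M)(\mathbf{g}_1)&\mathbf{0}\\ \mathbf{0}&R_I(M)(\mathbf{g}_2)\end{bmatrix}.$$ Essential cover: $\zeta\colon\mathbf{Z}\to\mathbf{P}$ essentially covers $I$ relative to $\xi$ if there is an order-preserving map $\zeta_I\colon\mathbf{Z}\to I^\xi$ with $\zeta=\xi_I\circ\zeta_I$ such that $\zeta_I$ covers some $I$-multiplicity matrix under $\xi$. *)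

theory Defs
  imports "Jordan_Normal_Form.DL_Rank"
begin

text \<open>
  A poset is a relation \<open>S\<close> with \<open>Partial_order S\<close>: its elements are \<open>Field S\<close>, and \<open>(x, y) \<in> S\<close>
  means \<open>x \<le> y\<close>.  Since \<open>S\<close> is reflexive, \<open>compat S T f\<close> says that \<open>f\<close> is an order-preserving
  map \<open>S \<rightarrow> T\<close>; in particular it maps \<open>Field S\<close> into \<open>Field T\<close>.  The full subposet on
  \<open>I \<subseteq> Field S\<close> is \<open>Restr S I\<close>.
\<close>

definition connected_poset :: "'a rel \<Rightarrow> bool" where
  "connected_poset S \<longleftrightarrow>
     Field S \<noteq> {} \<and> (\<forall>x\<in>Field S. \<forall>y\<in>Field S. (x, y) \<in> (S \<union> S\<inverse>)\<^sup>*)"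

definition convex_in :: "'a rel \<Rightarrow> 'a set \<Rightarrow> bool" where
  "convex_in S I \<longleftrightarrow>
     (\<forall>x\<in>I. \<forall>z\<in>I. \<forall>y. (x, y) \<in> S \<and> (y, z) \<in> S \<longrightarrow> y \<in> I)"

definition intervals :: "'a rel \<Rightarrow> 'a set set" where
  "intervals S =
     {I. I \<subseteq> Field S \<and> I \<noteq> {} \<and> connected_poset (Restr S I) \<and> convex_in S I}"

definition sc :: "'a rel \<Rightarrow> 'a set \<Rightarrow> 'a set" where
  "sc S I = {x \<in> I. \<forall>y\<in>I. (y, x) \<in> S \<longrightarrow> y = x}"

definition sk :: "'a rel \<Rightarrow> 'a set \<Rightarrow> 'a set" where
  "sk S I = {x \<in> I. \<forall>y\<in>I. (x, y) \<in> S \<longrightarrow> y = x}"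


section \<open>The incidence category and its modules\<close>

text \<open>
  The scalar \<open>c\<close> stands for the morphism \<open>c p\<^sub>y\<^sub>,\<^sub>x\<close>.  Thus composition of
  \<open>c \<in> inc_hom S x y\<close> with \<open>d \<in> inc_hom S y z\<close> is \<open>d * c \<in> inc_hom S x z\<close>, the identity of
  every object is \<open>1\<close>, and the functor induced by an order-preserving map \<open>f\<close> sends
  \<open>c \<in> inc_hom S x y\<close> to the same scalar \<open>c\<close>, regarded as an element of \<open>inc_hom T (f x) (f y)\<close>.
\<close>

definition inc_hom :: "'a rel \<Rightarrow> 'a \<Rightarrow> 'a \<Rightarrow> 'k::field set" where
  "inc_hom S x y = (if (x, y) \<in> S then UNIV else {0})"

text \<open>
  A finite-dimensional vector space is taken to be a coordinate space \<open>k\<^sup>n\<close> and a linear map a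
  matrix.  A module \<open>M\<close> has the value of dimension \<open>vdim M x\<close> at the object \<open>x\<close>, and
  \<open>act M y x c\<close> is the matrix of \<open>M(c p\<^sub>y\<^sub>,\<^sub>x)\<close>.  Values at points outside \<open>Field S\<close> and at scalars
  outside \<open>inc_hom S x y\<close> are irrelevant.
\<close>

record ('a, 'k) inc_module =
  vdim :: "'a \<Rightarrow> nat"
  act :: "'a \<Rightarrow> 'a \<Rightarrow> 'k \<Rightarrow> 'k mat"

definition modules :: "'a rel \<Rightarrow> ('a, 'k::field) inc_module set" where
  "modules S = {M.
     (\<forall>x\<in>Field S. \<forall>y\<in>Field S. \<forall>c\<in>inc_hom S x y.
        act M y x c \<in> carrier_mat (vdim M y) (vdim M x)) \<and>
     (\<forall>x\<in>Field S. \<forall>y\<in>Field S. \<forall>c\<in>inc_hom S x y. \<forall>c'\<in>inc_hom S x y.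
        act M y x (c + c') = act M y x c + act M y x c') \<and>
     (\<forall>x\<in>Field S. \<forall>y\<in>Field S. \<forall>c\<in>inc_hom S x y. \<forall>a.
        act M y x (a * c) = a \<cdot>\<^sub>m act M y x c) \<and>
     (\<forall>x\<in>Field S. act M x x 1 = 1\<^sub>m (vdim M x)) \<and>
     (\<forall>x\<in>Field S. \<forall>y\<in>Field S. \<forall>z\<in>Field S. \<forall>c\<in>inc_hom S x y. \<forall>d\<in>inc_hom S y z.
        act M z x (d * c) = act M z y d * act M y x c)}"

definition module_hom ::
  "'a rel \<Rightarrow> ('a, 'k::field) inc_module \<Rightarrow> ('a, 'k) inc_module \<Rightarrow> ('a \<Rightarrow> 'k mat) set" where
  "module_hom S M N = {f.
     (\<forall>x\<in>Field S. f x \<in> carrier_mat (vdim N x) (vdim M x)) \<and>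
     (\<forall>x\<in>Field S. \<forall>y\<in>Field S. \<forall>c\<in>inc_hom S x y.
        f y * act M y x c = act N y x c * f x)}"

definition module_iso ::
  "'a rel \<Rightarrow> ('a, 'k::field) inc_module \<Rightarrow> ('a, 'k) inc_module \<Rightarrow> bool" where
  "module_iso S M N \<longleftrightarrow>
     (\<exists>f\<in>module_hom S M N. \<exists>g\<in>module_hom S N M. \<forall>x\<in>Field S.
        g x * f x = 1\<^sub>m (vdim M x) \<and> f x * g x = 1\<^sub>m (vdim N x))"

definition zero_module :: "('a, 'k::field) inc_module" where
  "zero_module = \<lparr>vdim = (\<lambda>x. 0), act = (\<lambda>y x c. 0\<^sub>m 0 0)\<rparr>"

definition direct_sum ::
  "('a, 'k::field) inc_module \<Rightarrow> ('a, 'k) inc_module \<Rightarrow> ('a, 'k) inc_module" where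
  "direct_sum M N =
     \<lparr>vdim = (\<lambda>x. vdim M x + vdim N x),
      act = (\<lambda>y x c. four_block_mat
               (act M y x c) (0\<^sub>m (vdim M y) (vdim N x))
               (0\<^sub>m (vdim N y) (vdim M x)) (act N y x c))\<rparr>"

definition direct_sum_list :: "('a, 'k::field) inc_module list \<Rightarrow> ('a, 'k) inc_module" where
  "direct_sum_list Ms = foldr direct_sum Ms zero_module"

definition is_summand ::
  "'a rel \<Rightarrow> ('a, 'k::field) inc_module \<Rightarrow> ('a, 'k) inc_module \<Rightarrow> bool" where
  "is_summand S L N \<longleftrightarrow> (\<exists>N'\<in>modules S. module_iso S N (direct_sum L N'))"

definition is_zero :: "'a rel \<Rightarrow> ('a, 'k::field) inc_module \<Rightarrow> bool" where
  "is_zero S M \<longleftrightarrow> (\<forall>x\<in>Field S. vdim M x = 0)"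

definition indecomposable :: "'a rel \<Rightarrow> ('a, 'k::field) inc_module \<Rightarrow> bool" where
  "indecomposable S M \<longleftrightarrow> M \<in> modules S \<and> \<not> is_zero S M \<and>
     (\<forall>A\<in>modules S. \<forall>B\<in>modules S.
        module_iso S M (direct_sum A B) \<longrightarrow> is_zero S A \<or> is_zero S B)"

text \<open>The multiplicity of an indecomposable module \<open>L\<close> in the indecomposable decomposition of \<open>N\<close>.\<close>

definition multiplicity ::
  "'a rel \<Rightarrow> ('a, 'k::field) inc_module \<Rightarrow> ('a, 'k) inc_module \<Rightarrow> nat" where
  "multiplicity S N L = (THE m. \<exists>Ns. (\<forall>X\<in>set Ns. indecomposable S X) \<and>
     module_iso S N (direct_sum_list Ns) \<and>
     m = length (filter (\<lambda>X. module_iso S X L) Ns))"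

text \<open>Here \<open>L\<close> need not be indecomposable.\<close>

definition dbar ::
  "'a rel \<Rightarrow> ('a, 'k::field) inc_module \<Rightarrow> ('a, 'k) inc_module \<Rightarrow> nat" where
  "dbar S N L = (THE n. \<exists>N'\<in>modules S.
     module_iso S N (direct_sum (direct_sum_list (replicate n L)) N') \<and>
     \<not> is_summand S L N')"

definition restriction ::
  "('z \<Rightarrow> 'a) \<Rightarrow> ('a, 'k::field) inc_module \<Rightarrow> ('z, 'k) inc_module" where
  "restriction f M =
     \<lparr>vdim = (\<lambda>x. vdim M (f x)), act = (\<lambda>y x c. act M (f y) (f x) c)\<rparr>"

definition interval_module :: "'a rel \<Rightarrow> 'a set \<Rightarrow> ('a, 'k::field) inc_module" where
  "interval_module S I =
     \<lparr>vdim = (\<lambda>x. if x \<in> I then 1 else 0),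
      act = (\<lambda>y x c.
        if x \<in> I \<and> y \<in> I \<and> (x, y) \<in> S then c \<cdot>\<^sub>m 1\<^sub>m 1
        else 0\<^sub>m (if y \<in> I then 1 else 0) (if x \<in> I then 1 else 0))\<rparr>"


section \<open>Compression systems\<close>

text \<open>\<open>Q I\<close> is the poset that is the domain of \<open>\<xi> I\<close>.\<close>

definition compression_system ::
  "'p rel \<Rightarrow> ('p set \<Rightarrow> 'q rel) \<Rightarrow> ('p set \<Rightarrow> 'q \<Rightarrow> 'p) \<Rightarrow> bool" where
  "compression_system P Q \<xi> \<longleftrightarrow> (\<forall>I\<in>intervals P.
     Partial_order (Q I) \<and> finite (Field (Q I)) \<and> connected_poset (Q I) \<and>
     compat (Q I) P (\<xi> I) \<and>
     \<xi> I ` Field (Q I) \<subseteq> I \<and> sc P I \<union> sk P I \<subseteq> \<xi> I ` Field (Q I))"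

definition compression_mult ::
  "'p rel \<Rightarrow> ('p set \<Rightarrow> 'q rel) \<Rightarrow> ('p set \<Rightarrow> 'q \<Rightarrow> 'p) \<Rightarrow> 'p set \<Rightarrow>
     ('p, 'k::field) inc_module \<Rightarrow> nat" where
  "compression_mult P Q \<xi> I M =
     multiplicity (Q I) (restriction (\<xi> I) M) (restriction (\<xi> I) (interval_module P I))"


section \<open>The formal additive hull of the incidence category\<close>

text \<open>
  The matrix of scalars \<open>A\<close> stands for the matrix with entries \<open>A\<^sub>j\<^sub>i p\<close>, where \<open>p\<close> is the basis
  morphism from \<open>xs ! i\<close> to \<open>ys ! j\<close>.
\<close>

definition hull_hom :: "'a rel \<Rightarrow> 'a list \<Rightarrow> 'a list \<Rightarrow> 'k::field mat set" where
  "hull_hom S xs ys = {A \<in> carrier_mat (length ys) (length xs).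
     \<forall>i<length xs. \<forall>j<length ys. A $$ (j, i) \<in> inc_hom S (xs ! i) (ys ! j)}"

text \<open>A morphism together with its source and its target.\<close>

type_synonym ('a, 'k) hull_arrow = "'a list \<times> 'a list \<times> 'k mat"

definition hull_arrows :: "'a rel \<Rightarrow> ('a, 'k::field) hull_arrow set" where
  "hull_arrows S = {(xs, ys, A). xs \<in> lists (Field S) \<and> ys \<in> lists (Field S) \<and> A \<in> hull_hom S xs ys}"

definition hull_map :: "('z \<Rightarrow> 'a) \<Rightarrow> ('z, 'k::field) hull_arrow \<Rightarrow> ('a, 'k) hull_arrow" where
  "hull_map f = (\<lambda>(xs, ys, A). (map f xs, map f ys, A))"

definition covers :: "'z rel \<Rightarrow> ('z \<Rightarrow> 'a) \<Rightarrow> ('a, 'k::field) hull_arrow \<Rightarrow> bool" where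
  "covers Z f \<alpha> \<longleftrightarrow> (\<exists>\<alpha>'\<in>hull_arrows Z. hull_map f \<alpha>' = \<alpha>)"

definition append_cols :: "'k::zero mat \<Rightarrow> 'k mat \<Rightarrow> 'k mat" where
  "append_cols A B = four_block_mat A B (0\<^sub>m 0 (dim_col A)) (0\<^sub>m 0 (dim_col B))"

text \<open>
  The value of a module at a morphism of the additive hull: the matrix assembled from the blocks
  \<open>W(A\<^sub>j\<^sub>i p)\<close>, with block row index \<open>j\<close> and block column index \<open>i\<close>.
\<close>

definition block_row ::
  "('a, 'k::field) inc_module \<Rightarrow> 'a list \<Rightarrow> 'a list \<Rightarrow> 'k mat \<Rightarrow> nat \<Rightarrow> 'k mat" where
  "block_row W xs ys A j =
     foldr append_cols (map (\<lambda>i. act W (ys ! j) (xs ! i) (A $$ (j, i))) [0..<length xs])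
       (0\<^sub>m (vdim W (ys ! j)) 0)"

definition hull_eval ::
  "('a, 'k::field) inc_module \<Rightarrow> 'a list \<Rightarrow> 'a list \<Rightarrow> 'k mat \<Rightarrow> 'k mat" where
  "hull_eval W xs ys A =
     foldr append_rows (map (block_row W xs ys A) [0..<length ys])
       (0\<^sub>m 0 (\<Sum>x\<leftarrow>xs. vdim W x))"

definition mat_rank :: "'k::field mat \<Rightarrow> nat" where
  "mat_rank A = vec_space.rank (dim_row A) A"


section \<open>Multiplicity matrices and essential covers\<close>

text \<open>
  The block form consists of \<open>G\<^sub>1\<close> from \<open>xs\<^sub>1\<close> to \<open>ys\<^sub>1\<close>, \<open>G\<^sub>3\<close> from \<open>xs\<^sub>1\<close> to \<open>ys\<^sub>2\<close>, and \<open>G\<^sub>2\<close> from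
  \<open>xs\<^sub>2\<close> to \<open>ys\<^sub>2\<close>; any of the four sequences may be empty.
\<close>

definition multiplicity_matrix ::
  "'p rel \<Rightarrow> ('p set \<Rightarrow> 'q rel) \<Rightarrow> ('p set \<Rightarrow> 'q \<Rightarrow> 'p) \<Rightarrow> 'p set \<Rightarrow>
     ('q, 'k::field) hull_arrow \<Rightarrow> bool" where
  "multiplicity_matrix P Q \<xi> I g \<longleftrightarrow> g \<in> hull_arrows (Q I) \<and>
     (\<exists>xs\<^sub>1 xs\<^sub>2 ys\<^sub>1 ys\<^sub>2. \<exists>G\<^sub>1\<in>hull_hom (Q I) xs\<^sub>1 ys\<^sub>1. \<exists>G\<^sub>2\<in>hull_hom (Q I) xs\<^sub>2 ys\<^sub>2.
      \<exists>G\<^sub>3\<in>hull_hom (Q I) xs\<^sub>1 ys\<^sub>2.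
        g = (xs\<^sub>1 @ xs\<^sub>2, ys\<^sub>1 @ ys\<^sub>2,
             four_block_mat G\<^sub>1 (0\<^sub>m (length ys\<^sub>1) (length xs\<^sub>2)) G\<^sub>3 G\<^sub>2) \<and>
        (\<forall>M\<in>modules P.
           let W = restriction (\<xi> I) M;
               W\<^sub>1 = hull_eval W xs\<^sub>1 ys\<^sub>1 G\<^sub>1;
               W\<^sub>2 = hull_eval W xs\<^sub>2 ys\<^sub>2 G\<^sub>2;
               W\<^sub>3 = hull_eval W xs\<^sub>1 ys\<^sub>2 G\<^sub>3
           in int (compression_mult P Q \<xi> I M) =
              int (mat_rank (four_block_mat W\<^sub>1 (0\<^sub>m (dim_row W\<^sub>1) (dim_col W\<^sub>2)) W\<^sub>3 W\<^sub>2)) -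
              int (mat_rank (four_block_mat W\<^sub>1 (0\<^sub>m (dim_row W\<^sub>1) (dim_col W\<^sub>2))
                                            (0\<^sub>m (dim_row W\<^sub>2) (dim_col W\<^sub>1)) W\<^sub>2))))"

text \<open>The argument of type \<open>'k itself\<close> fixes the base field.\<close>

definition essentially_covers ::
  "'k::field itself \<Rightarrow> 'p rel \<Rightarrow> ('p set \<Rightarrow> 'q rel) \<Rightarrow> ('p set \<Rightarrow> 'q \<Rightarrow> 'p) \<Rightarrow> 'p set \<Rightarrow>
     'z rel \<Rightarrow> ('z \<Rightarrow> 'p) \<Rightarrow> bool" where
  "essentially_covers K P Q \<xi> I Z \<zeta> \<longleftrightarrow>
     (\<exists>\<zeta>'. compat Z (Q I) \<zeta>' \<and> (\<forall>z\<in>Field Z. \<zeta> z = \<xi> I (\<zeta>' z)) \<and>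
       (\<exists>g :: ('q, 'k) hull_arrow. multiplicity_matrix P Q \<xi> I g \<and> covers Z \<zeta>' g))"

end

(*
  R_zeta(V_I) is the constant module k on the whole of Z, because zeta factors through xi_I.  For
  every L that is constant, a shear makes the component L -> L of an isomorphism
  L + A -> L + B invertible, so L can be cancelled from direct sums even when it is decomposable.
  Hence the multiplicity of L is determined by any decomposition N = L^n + N' in which L is
  not a summand of N'; on the connected poset I^xi, where End(L) = k is local, this is the
  Krull-Schmidt multiplicity.  Write R_I(M) = L^m + C in this way and restrict to Z.  The
  difference of ranks that defines a multiplicity matrix is additive and nonnegative on Z-modules,
  takes the value 1 on R_zeta(V_I) (apply the definition to M = V_I), and so is m - m = 0 on the
  restriction of C.  Therefore R_zeta(V_I) is not a summand of the restriction of C.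
*)

theory Submission
  imports Defs
begin


section \<open>Rank factorizations\<close>

text \<open>Both multiplicities are definite descriptions, so an equation about either contains a
  uniqueness statement. Over \<open>Z\<close> the uniqueness cannot rest on locality:
  \<open>Z\<close> may be disconnected, and then the restricted interval module splits along the
  components. What survives is that its endomorphisms are the scalars constant on components, a
  product of copies of the field, in which a unit can be arranged pointwise. Hence cancellation
  carries the uniqueness on both posets, and locality enters only over \<open>Q I\<close>. The
  second obstacle is that the remainder over \<open>Q I\<close> need not come from a module over
  \<open>P\<close>, so the defining equation of a multiplicity matrix does not apply to it. Only
  additivity and nonnegativity of the rank difference reach its restriction. Additivity is not
  visible in coordinates, because evaluation at a list interleaves the blocks of two summands; it
  comes from naturality in inclusions and projections, with ranks handled through factorizations of
  identity matrices.\<close>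

lemma assoc_mult_mat_dim:
  fixes A B C :: "'a::semiring_0 mat"
  assumes "dim_col A = dim_row B" "dim_col B = dim_row C"
  shows "A * B * C = A * (B * C)"
  by (rule assoc_mult_mat[OF carrier_matI[OF refl assms(1)] carrier_matI[OF refl assms(2)]
        carrier_matI[OF refl refl]])

text \<open>The columns of \<open>X\<close> are a maximal independent set of columns of
  \<open>A\<close>, \<open>Y\<close> holds the coordinates of all columns with respect to them,
  \<open>U\<close> is a left inverse of \<open>X\<close>, and \<open>V\<close> selects the chosen
  columns. These two equations are all that is used about ranks afterwards.\<close>

lemma (in vec_space) rank_factorization:
  assumes A: "A \<in> carrier_mat n nc"
  shows "\<exists>X\<in>carrier_mat n (rank A). \<exists>Y\<in>carrier_mat (rank A) nc.
    \<exists>U\<in>carrier_mat (rank A) n. \<exists>V\<in>carrier_mat nc (rank A). A = X * Y \<and> U * A * V = 1\<^sub>m (rank A)"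
proof -
  have colsA: "set (cols A) \<subseteq> carrier_vec n"
    using A cols_dim by blast
  obtain S where S: "maximal S (\<lambda>T. T \<subseteq> set (cols A) \<and> lin_indpt T)"
    using maximal_exists_superset[of "set (cols A)" "\<lambda>T. T \<subseteq> set (cols A) \<and> lin_indpt T" "{}"]
    by (auto simp: finite_lin_indpt2)
  have cS: "card S = rank A"
    using rank_card_indpt[OF A S] by simp
  have SA: "S \<subseteq> set (cols A)" and liS: "lin_indpt S"
    using S by (auto simp: maximal_def)
  have Sc: "S \<subseteq> carrier_vec n"
    using SA colsA by blast
  have finS: "finite S"
    using SA finite_subset by blast
  have span: "a \<in> span S" if a: "a \<in> set (cols A)" for a
  proof (rule ccontr)
    assume na: "a \<notin> span S"
    have "a \<notin> S" using na Sc span_mem by blast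
    moreover have "lin_indpt (S \<union> {a})"
      using lin_dep_iff_in_span[of S a] Sc liS na \<open>a \<notin> S\<close> a colsA by auto
    ultimately show False
      using S a SA unfolding maximal_def by blast
  qed
  \<comment> \<open>A basis containing \<open>S\<close>, listed with \<open>S\<close> first, is the
    column list of an invertible matrix; the first \<open>r\<close> rows of its inverse form a left
    inverse of \<open>X\<close>.\<close>
  obtain B where B: "maximal B (\<lambda>T. S \<subseteq> T \<and> T \<subseteq> carrier_vec n \<and> lin_indpt T)"
  proof -
    have "finite T \<and> card T \<le> n" if "S \<subseteq> T \<and> T \<subseteq> carrier_vec n \<and> lin_indpt T" for T
      using li_le_dim[OF fin_dim, of T] that dim_is_n by simp
    then have "\<exists>B. finite B \<and> maximal B (\<lambda>T. S \<subseteq> T \<and> T \<subseteq> carrier_vec n \<and> lin_indpt T)"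
      using maximal_exists[of "\<lambda>T. S \<subseteq> T \<and> T \<subseteq> carrier_vec n \<and> lin_indpt T" n S] Sc liS by blast
    then show thesis using that by blast
  qed
  have SB: "S \<subseteq> B" and Bc: "B \<subseteq> carrier_vec n" and liB: "lin_indpt B"
    using B by (auto simp: maximal_def)
  have maxB: "maximal B (\<lambda>T. T \<subseteq> carrier_vec n \<and> lin_indpt T)"
    using B SB unfolding maximal_def by (meson subset_trans)
  have basB: "basis B"
    by (rule max_li_is_basis[OF maxB])
  have finB: "finite B"
    using li_le_dim(1)[OF fin_dim, of B] Bc liB by simp
  have cB: "card B = n"
    using dim_basis[OF finB basB] dim_is_n by simp
  obtain ss where ss: "set ss = S" "distinct ss"
    using finite_distinct_list[OF finS] by blast
  obtain bs where bs: "set bs = B - S" "distinct bs"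
    using finite_distinct_list[of "B - S"] finB by blast
  define r where "r = rank A"
  have lss: "length ss = r"
    using distinct_card[OF ss(2)] ss cS r_def by simp
  have lbs: "length (ss @ bs) = n"
  proof -
    have "distinct (ss @ bs)" "set (ss @ bs) = B"
      using ss bs SB by auto
    then show ?thesis using distinct_card cB by metis
  qed
  define Xh where "Xh = mat_of_cols n (ss @ bs)"
  have Xh: "Xh \<in> carrier_mat n n"
    unfolding Xh_def using lbs by auto
  have colsXh: "cols Xh = ss @ bs"
    unfolding Xh_def by (rule cols_mat_of_cols) (use ss bs Sc Bc in auto)
  have "rank Xh = n"
    by (rule lin_indpt_full_rank[OF Xh])
      (use colsXh ss bs SB liB in \<open>auto simp: Un_absorb1\<close>)
  then have "det Xh \<noteq> 0"
    using det_rank_iff[OF Xh] by simp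
  from det_non_zero_imp_unit[OF Xh this, unfolded Units_def, of "()"]
  obtain W where W: "W \<in> carrier_mat n n" "W * Xh = 1\<^sub>m n"
    by (auto simp: ring_mat_def)
  define X where "X = mat_of_cols n ss"
  define U where "U = mat r n (\<lambda>(i, j). W $$ (i, j))"
  have X: "X \<in> carrier_mat n r" unfolding X_def using lss by auto
  have U: "U \<in> carrier_mat r n" unfolding U_def by auto
  have rn: "r \<le> n" using lss lbs by simp
  have UX: "U * X = 1\<^sub>m r"
  proof (rule eq_matI)
    fix i j assume ij: "i < dim_row (1\<^sub>m r)" "j < dim_col (1\<^sub>m r)"
    have "col X j = ss ! j"
      unfolding X_def by (rule col_mat_of_cols) (use ij lss ss Sc in auto)
    moreover have "col Xh j = ss ! j"
      unfolding Xh_def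
      by (subst col_mat_of_cols) (use ij lss lbs rn ss Sc in \<open>auto simp: nth_append intro: Sc[THEN subsetD]\<close>)
    moreover have "row U i = row W i"
      by (rule eq_vecI) (use ij W rn in \<open>auto simp: U_def\<close>)
    moreover have "i < r" "j < r" "i < n" "j < n"
      using ij rn by auto
    ultimately have "(U * X) $$ (i, j) = (W * Xh) $$ (i, j)"
      using U X W(1) Xh by simp
    then show "(U * X) $$ (i, j) = 1\<^sub>m r $$ (i, j)"
      using W ij rn by simp
  qed (use U X in auto)
  have colsX: "cols X = ss"
    unfolding X_def by (rule cols_mat_of_cols) (use ss Sc in auto)
  \<comment> \<open>\<open>X * U\<close> fixes the column span of \<open>X\<close>, and that span
    contains every column of \<open>A\<close>.\<close>
  have XUA: "X * (U * A) = A"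
  proof (rule eq_matI)
    fix i j assume ij: "i < dim_row A" "j < dim_col A"
    have "col A j \<in> set (cols A)"
      using ij by (simp add: cols_def)
    then have "col A j \<in> span (set (cols X))"
      using span colsX ss by simp
    then obtain a where a: "col A j = lincomb a (set (cols X))"
      using finite_in_span[of "set (cols X)"] colsX ss Sc finS by metis
    define y where "y = vec r (\<lambda>i. a (col X i))"
    have y: "y \<in> carrier_vec r" by (simp add: y_def)
    have Xy: "col A j = X *\<^sub>v y"
      unfolding a y_def using mat_mult_eq_lincomb[OF X] colsX ss by simp
    have UA: "U * A \<in> carrier_mat r nc"
      using U A by simp
    have "col (X * (U * A)) j = X *\<^sub>v (U *\<^sub>v col A j)"
      using ij col_mult2[OF X UA] col_mult2[OF U A] A by simp
    also have "\<dots> = X *\<^sub>v (U *\<^sub>v (X *\<^sub>v y))"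
      using Xy by simp
    also have "U *\<^sub>v (X *\<^sub>v y) = y"
      using assoc_mult_mat_vec[OF U X y] UX y by simp
    finally have "col (X * (U * A)) j = col A j"
      using Xy by simp
    then show "(X * (U * A)) $$ (i, j) = A $$ (i, j)"
      using ij X U A by (metis carrier_matD(1) carrier_matD(2) index_col index_mult_mat(2,3))
  qed (use X U A in auto)
  have "\<exists>i<nc. ss ! k = col A i" if "k < r" for k
  proof -
    have "ss ! k \<in> set (cols A)"
      using that lss ss SA by (metis nth_mem subsetD)
    then obtain i where "i < length (cols A)" "cols A ! i = ss ! k"
      by (auto simp: in_set_conv_nth simp del: cols_length)
    then show ?thesis
      using A by (intro exI[of _ i]) auto
  qed
  then obtain idx where idx: "\<And>k. k < r \<Longrightarrow> idx k < nc \<and> ss ! k = col A (idx k)"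
    by metis
  \<comment> \<open>Column \<open>k\<close> of \<open>V\<close> is the unit vector at a position
    where \<open>ss ! k\<close> occurs among the columns of \<open>A\<close>.\<close>
  define V where "V = mat nc r (\<lambda>(i, k). if i = idx k then 1 else 0 :: 'a)"
  have V: "V \<in> carrier_mat nc r" unfolding V_def by auto
  have AV: "A * V = X"
  proof (rule eq_matI)
    fix i k assume "i < dim_row X" "k < dim_col X"
    then have ik: "i < n" "k < r" using X by auto
    have "(A * V) $$ (i, k) = (\<Sum>j = 0..<nc. A $$ (i, j) * (if j = idx k then 1 else 0))"
      using ik A V by (auto simp: scalar_prod_def V_def intro!: sum.cong)
    also have "\<dots> = A $$ (i, idx k)"
      using idx[OF ik(2)] by (simp add: if_distrib[of "(*) _"] sum.delta cong: if_cong)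
    also have "\<dots> = (ss ! k) $ i"
      using idx[OF ik(2)] A ik by simp
    also have "\<dots> = X $$ (i, k)"
      unfolding X_def using ik lss by (simp add: mat_of_cols_index)
    finally show "(A * V) $$ (i, k) = X $$ (i, k)" .
  qed (use A V X in auto)
  have "U * A * V = 1\<^sub>m r"
    using AV UX U A V by simp
  moreover have "U * A \<in> carrier_mat r nc"
    using U A by simp
  ultimately show ?thesis
    using X U V XUA unfolding r_def by metis
qed

text \<open>If \<open>s < r\<close>, zero columns and zero rows pad the factors to square matrices
  with the same product. A one-sided inverse of a square matrix is two-sided, yet row
  \<open>s\<close> of \<open>C' * B'\<close> vanishes.\<close>

lemma mult_eq_one_dim_le:
  fixes B C :: "'a::field mat"
  assumes B: "B \<in> carrier_mat r s" and C: "C \<in> carrier_mat s r" and BC: "B * C = 1\<^sub>m r"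
  shows "r \<le> s"
proof (rule ccontr)
  assume "\<not> r \<le> s"
  then have sr: "s < r" by simp
  define B' where "B' = mat r r (\<lambda>(i, j). if j < s then B $$ (i, j) else 0)"
  define C' where "C' = mat r r (\<lambda>(i, j). if i < s then C $$ (i, j) else 0)"
  have "B' * C' = B * C"
  proof (rule eq_matI)
    fix i j assume "i < dim_row (B * C)" "j < dim_col (B * C)"
    then have ij: "i < r" "j < r" using B C by auto
    have "(B' * C') $$ (i, j) = (\<Sum>k = 0..<r. if k < s then B $$ (i, k) * C $$ (k, j) else 0)"
      using ij by (auto simp: B'_def C'_def scalar_prod_def intro!: sum.cong)
    also have "\<dots> = (\<Sum>k = 0..<s. B $$ (i, k) * C $$ (k, j))"
      by (rule sum.mono_neutral_cong_right) (use sr in auto)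
    also have "\<dots> = (B * C) $$ (i, j)"
      using ij B C by (auto simp: scalar_prod_def intro!: sum.cong)
    finally show "(B' * C') $$ (i, j) = (B * C) $$ (i, j)" .
  qed (use B C in \<open>auto simp: B'_def C'_def\<close>)
  then have "C' * B' = 1\<^sub>m r"
    using BC mat_mult_left_right_inverse[of B' r C'] by (auto simp: B'_def C'_def)
  moreover have "(C' * B') $$ (s, s) = 0"
    using sr by (auto simp: B'_def C'_def scalar_prod_def)
  ultimately show False
    using sr by simp
qed

lemma inverse_mats_dim_eq:
  fixes f g :: "'a::field mat"
  assumes "f \<in> carrier_mat m n" "g \<in> carrier_mat n m" "g * f = 1\<^sub>m n" "f * g = 1\<^sub>m m"
  shows "m = n"
  using assms mult_eq_one_dim_le[of g n m f] mult_eq_one_dim_le[of f m n g] by simp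

lemma mat_rank_factorization:
  fixes A :: "'a::field mat"
  assumes "A \<in> carrier_mat m n" and "r = mat_rank A"
  obtains X Y U V where "X \<in> carrier_mat m r" "Y \<in> carrier_mat r n"
    "U \<in> carrier_mat r m" "V \<in> carrier_mat n r" "A = X * Y" "U * A * V = 1\<^sub>m r"
proof -
  have "r = vec_space.rank m A"
    using assms by (simp add: mat_rank_def)
  then show thesis
    using vec_space.rank_factorization[OF assms(1)] that by metis
qed

text \<open>An identity matrix factored through \<open>A\<close> is factored through dimension
  \<open>mat_rank A\<close> as well, which bounds its size. All lower bounds for ranks are obtained
  in this way.\<close>

lemma mat_rank_geI:
  fixes A :: "'a::field mat"
  assumes A: "A \<in> carrier_mat m n" and U: "U \<in> carrier_mat r m" and V: "V \<in> carrier_mat n r"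
    and eq: "U * A * V = 1\<^sub>m r"
  shows "r \<le> mat_rank A"
proof -
  define s where "s = mat_rank A"
  obtain X Y where X: "X \<in> carrier_mat m s" and Y: "Y \<in> carrier_mat s n" and XY: "A = X * Y"
    by (rule mat_rank_factorization[OF A s_def]) (rule that)
  have "U * X * (Y * V) = 1\<^sub>m r"
    unfolding eq[symmetric] XY using X Y U V by (simp add: assoc_mult_mat_dim)
  then show ?thesis
    unfolding s_def[symmetric]
    by (rule mult_eq_one_dim_le[OF mult_carrier_mat[OF U X] mult_carrier_mat[OF Y V]])
qed

lemma mat_rank_mult_le:
  fixes A :: "'a::field mat"
  assumes A: "A \<in> carrier_mat m n" and L: "L \<in> carrier_mat k m" and R: "R \<in> carrier_mat n l"
  shows "mat_rank (L * A * R) \<le> mat_rank A"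
proof -
  have LAR: "L * A * R \<in> carrier_mat k l"
    by (rule mult_carrier_mat[OF mult_carrier_mat[OF L A] R])
  define r where "r = mat_rank (L * A * R)"
  obtain U V where U: "U \<in> carrier_mat r k" and V: "V \<in> carrier_mat l r"
    and UV: "U * (L * A * R) * V = 1\<^sub>m r"
    by (rule mat_rank_factorization[OF LAR r_def]) (rule that)
  have "U * L * A * (R * V) = 1\<^sub>m r"
    unfolding UV[symmetric] using U V A L R by (simp add: assoc_mult_mat_dim)
  then show ?thesis
    unfolding r_def[symmetric]
    by (rule mat_rank_geI[OF A mult_carrier_mat[OF U L] mult_carrier_mat[OF R V]])
qed

lemma mat_rank_leI:
  fixes X Y :: "'a::field mat"
  assumes X: "X \<in> carrier_mat m r" and Y: "Y \<in> carrier_mat r n"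
  shows "mat_rank (X * Y) \<le> r"
proof -
  have XY: "X * Y \<in> carrier_mat m n"
    by (rule mult_carrier_mat[OF X Y])
  define s where "s = mat_rank (X * Y)"
  obtain U V where U: "U \<in> carrier_mat s m" and V: "V \<in> carrier_mat n s"
    and UV: "U * (X * Y) * V = 1\<^sub>m s"
    by (rule mat_rank_factorization[OF XY s_def]) (rule that)
  have "U * X * (Y * V) = 1\<^sub>m s"
    unfolding UV[symmetric] using U V X Y by (simp add: assoc_mult_mat_dim)
  then show ?thesis
    unfolding s_def[symmetric]
    by (rule mult_eq_one_dim_le[OF mult_carrier_mat[OF U X] mult_carrier_mat[OF Y V]])
qed

text \<open>Compressing both diagonal blocks to identity matrices turns the whole matrix into a
  unitriangular one, which is invertible whatever \<open>C\<close> is.\<close>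

lemma mat_rank_four_block_ge:
  fixes A B C :: "'a::field mat"
  assumes A: "A \<in> carrier_mat m1 n1" and B: "B \<in> carrier_mat m2 n2" and C: "C \<in> carrier_mat m2 n1"
  shows "mat_rank A + mat_rank B \<le> mat_rank (four_block_mat A (0\<^sub>m m1 n2) C B)"
proof -
  let ?a = "mat_rank A" and ?b = "mat_rank B"
  obtain U V where UV: "U \<in> carrier_mat ?a m1" "V \<in> carrier_mat n1 ?a" "U * A * V = 1\<^sub>m ?a"
    by (rule mat_rank_factorization[OF A refl]) (rule that)
  obtain U' V' where UV': "U' \<in> carrier_mat ?b m2" "V' \<in> carrier_mat n2 ?b" "U' * B * V' = 1\<^sub>m ?b"
    by (rule mat_rank_factorization[OF B refl]) (rule that)
  let ?T = "four_block_mat A (0\<^sub>m m1 n2) C B"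
  let ?U = "four_block_mat U (0\<^sub>m ?a m2) (0\<^sub>m ?b m1) U'"
  let ?V = "four_block_mat V (0\<^sub>m n1 ?b) (0\<^sub>m n2 ?a) V'"
  \<comment> \<open>\<open>?D\<close> is the corner left after the compression; \<open>?E\<close> is
    the inverse of the unitriangular matrix with that corner.\<close>
  let ?D = "U' * C * V"
  let ?E = "four_block_mat (1\<^sub>m ?a) (0\<^sub>m ?a ?b) (- ?D) (1\<^sub>m ?b)"
  have D: "?D \<in> carrier_mat ?b ?a" using UV UV' C by simp
  have T: "?T \<in> carrier_mat (m1 + m2) (n1 + n2)" using A B by simp
  have U: "?U \<in> carrier_mat (?a + ?b) (m1 + m2)" using UV UV' by simp
  have V: "?V \<in> carrier_mat (n1 + n2) (?a + ?b)" using UV UV' by simp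
  have E: "?E \<in> carrier_mat (?a + ?b) (?a + ?b)"
    by (rule four_block_carrier_mat[OF one_carrier_mat one_carrier_mat])
  have unitriangular: "four_block_mat (1\<^sub>m p) (0\<^sub>m p q) D (1\<^sub>m q) *
      four_block_mat (1\<^sub>m p) (0\<^sub>m p q) N (1\<^sub>m q) = 1\<^sub>m (p + q)"
    if "D \<in> carrier_mat q p" "N \<in> carrier_mat q p" "D + N = 0\<^sub>m q p" for p q and D N :: "'a mat"
    using that by (subst mult_four_block_mat[where ?nr1.0 = p and ?nr2.0 = q]) auto
  have "?U * ?T = four_block_mat (U * A) (0\<^sub>m ?a n2) (U' * C) (U' * B)"
    by (subst mult_four_block_mat) (use A B C UV UV' in auto)
  also have "\<dots> * ?V = four_block_mat (1\<^sub>m ?a) (0\<^sub>m ?a ?b) ?D (1\<^sub>m ?b)"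
    by (subst mult_four_block_mat[where ?nr1.0 = ?a and ?nr2.0 = ?b])
      (use A B C UV UV' in auto)
  also have "\<dots> * ?E = 1\<^sub>m (?a + ?b)"
    by (rule unitriangular[OF D uminus_carrier_mat[OF D]])
      (simp add: add_uminus_minus_mat[OF D D] minus_r_inv_mat[OF D])
  finally have "?U * ?T * ?V * ?E = 1\<^sub>m (?a + ?b)" .
  then have "?U * ?T * (?V * ?E) = 1\<^sub>m (?a + ?b)"
    unfolding assoc_mult_mat[OF mult_carrier_mat[OF U T] V E] .
  then show ?thesis
    by (rule mat_rank_geI[OF T U mult_carrier_mat[OF V E]])
qed

text \<open>The lower bound is the triangular case with \<open>C = 0\<close>; for the upper bound
  the factorizations of the two blocks are placed diagonally.\<close>

lemma mat_rank_four_block_diag: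
  fixes A B :: "'a::field mat"
  assumes A: "A \<in> carrier_mat m1 n1" and B: "B \<in> carrier_mat m2 n2"
  shows "mat_rank (four_block_mat A (0\<^sub>m m1 n2) (0\<^sub>m m2 n1) B) = mat_rank A + mat_rank B"
proof (rule antisym)
  let ?a = "mat_rank A" and ?b = "mat_rank B"
  obtain X Y where XY: "X \<in> carrier_mat m1 ?a" "Y \<in> carrier_mat ?a n1" "A = X * Y"
    by (rule mat_rank_factorization[OF A refl]) (rule that)
  obtain X' Y' where XY': "X' \<in> carrier_mat m2 ?b" "Y' \<in> carrier_mat ?b n2" "B = X' * Y'"
    by (rule mat_rank_factorization[OF B refl]) (rule that)
  let ?X = "four_block_mat X (0\<^sub>m m1 ?b) (0\<^sub>m m2 ?a) X'"
  let ?Y = "four_block_mat Y (0\<^sub>m ?a n2) (0\<^sub>m ?b n1) Y'"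
  have "?X * ?Y = four_block_mat A (0\<^sub>m m1 n2) (0\<^sub>m m2 n1) B"
    by (subst mult_four_block_mat) (use XY XY' in auto)
  moreover have "mat_rank (?X * ?Y) \<le> ?a + ?b"
    by (rule mat_rank_leI) (use XY XY' in auto)
  ultimately show "mat_rank (four_block_mat A (0\<^sub>m m1 n2) (0\<^sub>m m2 n1) B) \<le> ?a + ?b"
    by simp
qed (rule mat_rank_four_block_ge[OF A B], simp)


section \<open>Module homomorphisms\<close>

text \<open>Like \<open>assoc_mult_mat_dim\<close>, this asks for equations between dimensions
  instead of carriers. The simplifier verifies them from the dimensions of the factors, so long
  products are expanded and reassociated without naming intermediate carriers.\<close>

lemma add_mult_distrib_mat_dim:
  fixes A B C :: "'a::semiring_0 mat"
  assumes "dim_row A = dim_row B" "dim_col A = dim_col B" "dim_col B = dim_row C"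
  shows "(A + B) * C = A * C + B * C"
  by (rule add_mult_distrib_mat[OF carrier_matI[OF assms(1,2)] carrier_matI[OF refl refl]
        carrier_matI[OF assms(3)[symmetric] refl]])

lemma mult_add_distrib_mat_dim:
  fixes A B C :: "'a::semiring_0 mat"
  assumes "dim_col A = dim_row B" "dim_row B = dim_row C" "dim_col B = dim_col C"
  shows "A * (B + C) = A * B + A * C"
  by (rule mult_add_distrib_mat[OF carrier_matI[OF refl assms(1)] carrier_matI[OF refl refl]
        carrier_matI[OF assms(2,3)[symmetric]]])

text \<open>With \<open>s\<close> inverse to \<open>q * i\<close>, the matrix
  \<open>1 - i * s * q\<close> is the projection onto the kernel of \<open>q\<close> along the image
  of \<open>i\<close>. It identifies \<open>A\<close>, the quotient by the image of
  \<open>i\<close>, with \<open>B\<close>, the kernel of \<open>q\<close>.\<close>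

lemma cancel_complement_mats:
  fixes i p j q s iA pA jB qB :: "'a::field mat"
  assumes i: "i \<in> carrier_mat n l" and p: "p \<in> carrier_mat l n"
    and iA: "iA \<in> carrier_mat n a" and pA: "pA \<in> carrier_mat a n"
    and j: "j \<in> carrier_mat n l" and q: "q \<in> carrier_mat l n"
    and jB: "jB \<in> carrier_mat n b" and qB: "qB \<in> carrier_mat b n"
    and s: "s \<in> carrier_mat l l"
    and A: "i * p + iA * pA = 1\<^sub>m n" "pA * i = 0\<^sub>m a l" "pA * iA = 1\<^sub>m a"
    and B: "j * q + jB * qB = 1\<^sub>m n" "q * jB = 0\<^sub>m l b" "qB * jB = 1\<^sub>m b"
    and qis: "q * i * s = 1\<^sub>m l" and sqi: "s * (q * i) = 1\<^sub>m l"
  shows "(pA * jB) * (qB * (1\<^sub>m n - i * s * q) * iA) = 1\<^sub>m a"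
    and "(qB * (1\<^sub>m n - i * s * q) * iA) * (pA * jB) = 1\<^sub>m b"
proof -
  define e where "e = 1\<^sub>m n - i * s * q"
  have isq: "i * s * q \<in> carrier_mat n n"
    using i s q by (meson mult_carrier_mat)
  have e: "e \<in> carrier_mat n n"
    unfolding e_def by (rule minus_carrier_mat[OF isq])
  note d = carrier_matD[OF i] carrier_matD[OF p] carrier_matD[OF iA] carrier_matD[OF pA]
    carrier_matD[OF j] carrier_matD[OF q] carrier_matD[OF jB] carrier_matD[OF qB]
    carrier_matD[OF s] carrier_matD[OF e] index_mult_mat(2,3)
  have left: "X * e = X - X * i * s * q" if X: "X \<in> carrier_mat m n" for X m
  proof -
    have "X * e = X * 1\<^sub>m n - X * (i * s * q)"
      unfolding e_def by (rule mult_minus_distrib_mat[OF X one_carrier_mat isq])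
    then show ?thesis
      using X by (simp add: assoc_mult_mat_dim d del: assoc_mult_mat)
  qed
  have right: "e * X = X - i * s * (q * X)" if X: "X \<in> carrier_mat n m" for X m
  proof -
    have "e * X = 1\<^sub>m n * X - i * s * q * X"
      unfolding e_def by (rule minus_mult_distrib_mat[OF one_carrier_mat isq X])
    then show ?thesis
      using X by (simp add: assoc_mult_mat_dim d del: assoc_mult_mat)
  qed
  have qe: "q * e = 0\<^sub>m l n"
    unfolding left[OF q] qis left_mult_one_mat[OF q] by (rule minus_r_inv_mat[OF q])
  have "e * i = i - i * (s * (q * i))"
    unfolding right[OF i] by (simp add: assoc_mult_mat_dim d del: assoc_mult_mat)
  then have ei: "e * i = 0\<^sub>m n l"
    using i by (simp add: sqi)
  \<comment> \<open>The image of \<open>e\<close> lies in the kernel of \<open>q\<close>, where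
    \<open>jB * qB\<close> acts as the identity.\<close>
  have jBe: "jB * (qB * e) = e"
  proof -
    have "e = (j * q + jB * qB) * e"
      using e B(1) by simp
    also have "\<dots> = j * (q * e) + jB * (qB * e)"
      by (simp add: add_mult_distrib_mat_dim assoc_mult_mat_dim d del: assoc_mult_mat)
    also have "\<dots> = jB * (qB * e)"
      using j jB qB e by (simp add: qe)
    finally show ?thesis by simp
  qed
  \<comment> \<open>Dually, \<open>e\<close> kills the image of \<open>i\<close>, so composing with
    \<open>iA * pA\<close> first changes nothing.\<close>
  have eA: "e * (iA * pA) = e"
  proof -
    have "e = e * (i * p + iA * pA)"
      using e A(1) by simp
    also have "\<dots> = (e * i) * p + e * (iA * pA)"
      by (simp add: mult_add_distrib_mat_dim assoc_mult_mat_dim d del: assoc_mult_mat)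
    also have "\<dots> = e * (iA * pA)"
      using p iA pA e by (simp add: ei)
    finally show ?thesis by simp
  qed
  have pAe: "pA * e = pA"
    unfolding left[OF pA] A(2) using s q pA by (auto intro!: eq_matI)
  have ejB: "e * jB = jB"
    unfolding right[OF jB] B(2) using i s jB by (auto intro!: eq_matI)
  have "(pA * jB) * (qB * e * iA) = pA * (jB * (qB * e)) * iA"
    by (simp add: assoc_mult_mat_dim d del: assoc_mult_mat)
  then show "(pA * jB) * (qB * (1\<^sub>m n - i * s * q) * iA) = 1\<^sub>m a"
    unfolding jBe pAe A(3) by (simp only: e_def)
  have "(qB * e * iA) * (pA * jB) = qB * (e * (iA * pA)) * jB"
    by (simp add: assoc_mult_mat_dim d del: assoc_mult_mat)
  also have "\<dots> = qB * (e * jB)"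
    unfolding eA by (simp add: assoc_mult_mat_dim d del: assoc_mult_mat)
  finally show "(qB * (1\<^sub>m n - i * s * q) * iA) * (pA * jB) = 1\<^sub>m b"
    unfolding ejB B(3) by (simp only: e_def)
qed

section \<open>Functor laws, natural maps and isomorphisms\<close>

lemma moduleD:
  assumes "M \<in> modules S" "x \<in> Field S" "y \<in> Field S" "c \<in> inc_hom S x y"
  shows module_act_carrier: "act M y x c \<in> carrier_mat (vdim M y) (vdim M x)"
    and module_act_add: "c' \<in> inc_hom S x y \<Longrightarrow> act M y x (c + c') = act M y x c + act M y x c'"
    and module_act_smult: "act M y x (a * c) = a \<cdot>\<^sub>m act M y x c"
    and module_act_comp: "z \<in> Field S \<Longrightarrow> d \<in> inc_hom S y z \<Longrightarrow>
      act M z x (d * c) = act M z y d * act M y x c"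
  using assms unfolding modules_def by blast+

lemma module_act_one: "M \<in> modules S \<Longrightarrow> x \<in> Field S \<Longrightarrow> act M x x 1 = 1\<^sub>m (vdim M x)"
  unfolding modules_def by simp

lemma module_homD:
  assumes "f \<in> module_hom S M N" "x \<in> Field S"
  shows module_hom_carrier: "f x \<in> carrier_mat (vdim N x) (vdim M x)"
    and module_hom_natural: "y \<in> Field S \<Longrightarrow> c \<in> inc_hom S x y \<Longrightarrow>
      f y * act M y x c = act N y x c * f x"
  using assms unfolding module_hom_def by blast+

lemma module_homI:
  assumes "\<And>x. x \<in> Field S \<Longrightarrow> f x \<in> carrier_mat (vdim N x) (vdim M x)"
    and "\<And>x y c. x \<in> Field S \<Longrightarrow> y \<in> Field S \<Longrightarrow> c \<in> inc_hom S x y \<Longrightarrow>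
      f y * act M y x c = act N y x c * f x"
  shows "f \<in> module_hom S M N"
  using assms unfolding module_hom_def by blast

lemma module_hom_comp:
  fixes M :: "('a, 'k::field) inc_module"
  assumes M: "M \<in> modules S" and N: "N \<in> modules S" and K: "K \<in> modules S"
    and f: "f \<in> module_hom S M N" and g: "g \<in> module_hom S N K"
  shows "(\<lambda>x. g x * f x) \<in> module_hom S M K"
proof (rule module_homI)
  fix x assume x: "x \<in> Field S"
  show "g x * f x \<in> carrier_mat (vdim K x) (vdim M x)"
    by (rule mult_carrier_mat[OF module_hom_carrier[OF g x] module_hom_carrier[OF f x]])
next
  fix x y and c :: 'k assume x: "x \<in> Field S" and y: "y \<in> Field S" and c: "c \<in> inc_hom S x y"
  note cs = module_hom_carrier[OF f x] module_hom_carrier[OF f y]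
    module_hom_carrier[OF g x] module_hom_carrier[OF g y]
    module_act_carrier[OF M x y c] module_act_carrier[OF N x y c] module_act_carrier[OF K x y c]
  have "g y * f y * act M y x c = g y * (f y * act M y x c)"
    using assoc_mult_mat cs by blast
  also have "\<dots> = (g y * act N y x c) * f x"
    unfolding module_hom_natural[OF f x y c] using assoc_mult_mat cs by metis
  also have "\<dots> = act K y x c * (g x * f x)"
    unfolding module_hom_natural[OF g x y c] using assoc_mult_mat cs by blast
  finally show "g y * f y * act M y x c = act K y x c * (g x * f x)" .
qed

lemma module_hom_add:
  fixes M :: "('a, 'k::field) inc_module"
  assumes M: "M \<in> modules S" and N: "N \<in> modules S"
    and f: "f \<in> module_hom S M N" and g: "g \<in> module_hom S M N"
  shows "(\<lambda>x. f x + g x) \<in> module_hom S M N"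
proof (rule module_homI)
  fix x y and c :: 'k assume x: "x \<in> Field S" and y: "y \<in> Field S" and c: "c \<in> inc_hom S x y"
  note cs = module_hom_carrier[OF f x] module_hom_carrier[OF f y]
    module_hom_carrier[OF g x] module_hom_carrier[OF g y]
    module_act_carrier[OF M x y c] module_act_carrier[OF N x y c]
  show "(f y + g y) * act M y x c = act N y x c * (f x + g x)"
    unfolding add_mult_distrib_mat[OF cs(2,4,5)] mult_add_distrib_mat[OF cs(6,1,3)]
      module_hom_natural[OF f x y c] module_hom_natural[OF g x y c] ..
qed (blast intro: add_carrier_mat minus_carrier_mat module_hom_carrier[OF f] module_hom_carrier[OF g])

lemma module_hom_diff:
  fixes M :: "('a, 'k::field) inc_module"
  assumes M: "M \<in> modules S" and N: "N \<in> modules S"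
    and f: "f \<in> module_hom S M N" and g: "g \<in> module_hom S M N"
  shows "(\<lambda>x. f x - g x) \<in> module_hom S M N"
proof (rule module_homI)
  fix x y and c :: 'k assume x: "x \<in> Field S" and y: "y \<in> Field S" and c: "c \<in> inc_hom S x y"
  note cs = module_hom_carrier[OF f x] module_hom_carrier[OF f y]
    module_hom_carrier[OF g x] module_hom_carrier[OF g y]
    module_act_carrier[OF M x y c] module_act_carrier[OF N x y c]
  show "(f y - g y) * act M y x c = act N y x c * (f x - g x)"
    unfolding minus_mult_distrib_mat[OF cs(2,4,5)] mult_minus_distrib_mat[OF cs(6,1,3)]
      module_hom_natural[OF f x y c] module_hom_natural[OF g x y c] ..
qed (blast intro: add_carrier_mat minus_carrier_mat module_hom_carrier[OF f] module_hom_carrier[OF g])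

lemma module_hom_id:
  fixes M :: "('a, 'k::field) inc_module"
  assumes M: "M \<in> modules S"
  shows "(\<lambda>x. 1\<^sub>m (vdim M x)) \<in> module_hom S M M"
proof (rule module_homI)
  fix x y and c :: 'k assume "x \<in> Field S" "y \<in> Field S" "c \<in> inc_hom S x y"
  from module_act_carrier[OF M this]
  show "1\<^sub>m (vdim M y) * act M y x c = act M y x c * 1\<^sub>m (vdim M x)"
    by simp
qed simp

lemma module_isoI:
  assumes "f \<in> module_hom S M N" "g \<in> module_hom S N M"
    and "\<And>x. x \<in> Field S \<Longrightarrow> g x * f x = 1\<^sub>m (vdim M x)"
    and "\<And>x. x \<in> Field S \<Longrightarrow> f x * g x = 1\<^sub>m (vdim N x)"
  shows "module_iso S M N"
  using assms unfolding module_iso_def by blast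

lemma module_isoE:
  assumes "module_iso S M N"
  obtains f g where "f \<in> module_hom S M N" "g \<in> module_hom S N M"
    "\<And>x. x \<in> Field S \<Longrightarrow> g x * f x = 1\<^sub>m (vdim M x)"
    "\<And>x. x \<in> Field S \<Longrightarrow> f x * g x = 1\<^sub>m (vdim N x)"
  using assms unfolding module_iso_def by blast

lemma module_iso_refl: "M \<in> modules S \<Longrightarrow> module_iso S M M"
  by (rule module_isoI[OF module_hom_id module_hom_id]) auto

lemma module_iso_sym: "module_iso S M N \<Longrightarrow> module_iso S N M"
  unfolding module_iso_def by blast

lemma mult_inverse_mats:
  fixes f g f' g' :: "'a::semiring_1 mat"
  assumes f: "f \<in> carrier_mat m n" and g: "g \<in> carrier_mat n m"
    and f': "f' \<in> carrier_mat k m" and g': "g' \<in> carrier_mat m k"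
    and gf: "g * f = 1\<^sub>m n" and gf': "g' * f' = 1\<^sub>m m"
  shows "(g * g') * (f' * f) = 1\<^sub>m n"
proof -
  have "(g * g') * (f' * f) = g * (g' * (f' * f))"
    by (rule assoc_mult_mat[OF g g' mult_carrier_mat[OF f' f]])
  also have "g' * (f' * f) = f"
    unfolding assoc_mult_mat[OF g' f' f, symmetric] gf' by (rule left_mult_one_mat[OF f])
  finally show ?thesis unfolding gf .
qed

lemma module_iso_trans:
  assumes M: "M \<in> modules S" and N: "N \<in> modules S" and K: "K \<in> modules S"
    and MN: "module_iso S M N" and NK: "module_iso S N K"
  shows "module_iso S M K"
proof -
  obtain f g where f: "f \<in> module_hom S M N" and g: "g \<in> module_hom S N M"
    and gf: "\<And>x. x \<in> Field S \<Longrightarrow> g x * f x = 1\<^sub>m (vdim M x)"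
    and fg: "\<And>x. x \<in> Field S \<Longrightarrow> f x * g x = 1\<^sub>m (vdim N x)"
    using MN by (rule module_isoE) (blast intro: that)
  obtain f' g' where f': "f' \<in> module_hom S N K" and g': "g' \<in> module_hom S K N"
    and gf': "\<And>x. x \<in> Field S \<Longrightarrow> g' x * f' x = 1\<^sub>m (vdim N x)"
    and fg': "\<And>x. x \<in> Field S \<Longrightarrow> f' x * g' x = 1\<^sub>m (vdim K x)"
    using NK by (rule module_isoE) (blast intro: that)
  show ?thesis
    by (rule module_isoI[OF module_hom_comp[OF M N K f f'] module_hom_comp[OF K N M g' g]];
        rule mult_inverse_mats)
      (auto intro: module_hom_carrier[OF f] module_hom_carrier[OF f'] module_hom_carrier[OF g]
        module_hom_carrier[OF g'] gf gf' fg fg')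
qed

lemma module_iso_vdim:
  assumes "module_iso S M N" "x \<in> Field S"
  shows "vdim M x = vdim N x"
  using assms(1)
proof (rule module_isoE)
  fix f g assume "f \<in> module_hom S M N" "g \<in> module_hom S N M"
    "\<And>x. x \<in> Field S \<Longrightarrow> g x * f x = 1\<^sub>m (vdim M x)"
    "\<And>x. x \<in> Field S \<Longrightarrow> f x * g x = 1\<^sub>m (vdim N x)"
  then show ?thesis
    using inverse_mats_dim_eq[of "f x" "vdim N x" "vdim M x" "g x"] module_hom_carrier assms(2)
    by metis
qed


section \<open>Direct sums and biproducts\<close>

lemma append_cols_carrier:
  "A \<in> carrier_mat m n1 \<Longrightarrow> B \<in> carrier_mat m n2 \<Longrightarrow> append_cols A B \<in> carrier_mat m (n1 + n2)"
  unfolding append_cols_def by auto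

text \<open>Seen as a block matrix with three empty blocks, any matrix falls under
  \<open>mult_four_block_mat\<close>; the mixed products below are obtained from this.\<close>

lemma four_block_mat_empty:
  "A \<in> carrier_mat m n \<Longrightarrow> four_block_mat A (0\<^sub>m m 0) (0\<^sub>m 0 n) (0\<^sub>m 0 0) = A"
  by (rule eq_matI) auto

lemma append_rows_mult:
  fixes A B C :: "'a::semiring_0 mat"
  assumes A: "A \<in> carrier_mat m1 n" and B: "B \<in> carrier_mat m2 n" and C: "C \<in> carrier_mat n k"
  shows "(A @\<^sub>r B) * C = A * C @\<^sub>r B * C"
proof -
  have "(A @\<^sub>r B) * C =
      four_block_mat A (0\<^sub>m m1 0) B (0\<^sub>m m2 0) * four_block_mat C (0\<^sub>m n 0) (0\<^sub>m 0 k) (0\<^sub>m 0 0)"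
    unfolding four_block_mat_empty[OF C] append_rows_def using A B by simp
  also have "\<dots> = four_block_mat (A * C) (0\<^sub>m m1 0) (B * C) (0\<^sub>m m2 0)"
    by (subst mult_four_block_mat[OF A _ B _ C]) (use A B C in auto)
  finally show ?thesis
    unfolding append_rows_def using A B by simp
qed

lemma mult_append_cols:
  fixes A B C :: "'a::semiring_0 mat"
  assumes A: "A \<in> carrier_mat n k1" and B: "B \<in> carrier_mat n k2" and C: "C \<in> carrier_mat m n"
  shows "C * append_cols A B = append_cols (C * A) (C * B)"
proof -
  have "C * append_cols A B =
      four_block_mat C (0\<^sub>m m 0) (0\<^sub>m 0 n) (0\<^sub>m 0 0) * four_block_mat A B (0\<^sub>m 0 k1) (0\<^sub>m 0 k2)"
    unfolding four_block_mat_empty[OF C] append_cols_def using A B by simp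
  also have "\<dots> = four_block_mat (C * A) (C * B) (0\<^sub>m 0 k1) (0\<^sub>m 0 k2)"
    by (subst mult_four_block_mat[OF C _ _ _ A B]) (use A B C in auto)
  finally show ?thesis
    unfolding append_cols_def using A B by simp
qed

lemma append_cols_mult_append_rows:
  fixes A B C D :: "'a::semiring_0 mat"
  assumes A: "A \<in> carrier_mat m n1" and B: "B \<in> carrier_mat m n2"
    and C: "C \<in> carrier_mat n1 k" and D: "D \<in> carrier_mat n2 k"
  shows "append_cols A B * (C @\<^sub>r D) = A * C + B * D"
proof -
  have "append_cols A B * (C @\<^sub>r D) = four_block_mat A B (0\<^sub>m 0 n1) (0\<^sub>m 0 n2) *
      four_block_mat C (0\<^sub>m n1 0) D (0\<^sub>m n2 0)"
    unfolding append_cols_def append_rows_def using A B C D by simp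
  also have "\<dots> = four_block_mat (A * C + B * D) (0\<^sub>m m 0) (0\<^sub>m 0 k) (0\<^sub>m 0 0)"
    by (subst mult_four_block_mat[OF A B _ _ C _ D]) (use A B C D in auto)
  also have "\<dots> = A * C + B * D"
    by (rule four_block_mat_empty) (use A B C D in auto)
  finally show ?thesis .
qed

lemma append_rows_mult_append_cols:
  fixes A B C D :: "'a::semiring_0 mat"
  assumes A: "A \<in> carrier_mat m1 n" and B: "B \<in> carrier_mat m2 n"
    and C: "C \<in> carrier_mat n k1" and D: "D \<in> carrier_mat n k2"
  shows "(A @\<^sub>r B) * append_cols C D = four_block_mat (A * C) (A * D) (B * C) (B * D)"
proof -
  have "(A @\<^sub>r B) * append_cols C D = four_block_mat A (0\<^sub>m m1 0) B (0\<^sub>m m2 0) *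
      four_block_mat C D (0\<^sub>m 0 k1) (0\<^sub>m 0 k2)"
    unfolding append_cols_def append_rows_def using A B C D by simp
  also have "\<dots> = four_block_mat (A * C) (A * D) (B * C) (B * D)"
    by (subst mult_four_block_mat[OF A _ B _ C D]) (use A B C D in auto)
  finally show ?thesis .
qed

lemma four_block_mult_append_rows:
  fixes A B C D X Y :: "'a::semiring_0 mat"
  assumes A: "A \<in> carrier_mat m1 n1" and B: "B \<in> carrier_mat m1 n2"
    and C: "C \<in> carrier_mat m2 n1" and D: "D \<in> carrier_mat m2 n2"
    and X: "X \<in> carrier_mat n1 k" and Y: "Y \<in> carrier_mat n2 k"
  shows "four_block_mat A B C D * (X @\<^sub>r Y) = (A * X + B * Y) @\<^sub>r (C * X + D * Y)"
proof -
  have "four_block_mat A B C D * (X @\<^sub>r Y) =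
      four_block_mat A B C D * four_block_mat X (0\<^sub>m n1 0) Y (0\<^sub>m n2 0)"
    unfolding append_rows_def using X Y by simp
  also have "\<dots> = four_block_mat (A * X + B * Y) (0\<^sub>m m1 0) (C * X + D * Y) (0\<^sub>m m2 0)"
    by (subst mult_four_block_mat[OF A B C D X _ Y]) (use A B C D in auto)
  finally show ?thesis
    unfolding append_rows_def using A B C D X Y by simp
qed

lemma append_cols_mult_four_block:
  fixes A B C D X Y :: "'a::semiring_0 mat"
  assumes X: "X \<in> carrier_mat k m1" and Y: "Y \<in> carrier_mat k m2"
    and A: "A \<in> carrier_mat m1 n1" and B: "B \<in> carrier_mat m1 n2"
    and C: "C \<in> carrier_mat m2 n1" and D: "D \<in> carrier_mat m2 n2"
  shows "append_cols X Y * four_block_mat A B C D = append_cols (X * A + Y * C) (X * B + Y * D)"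
proof -
  have "append_cols X Y * four_block_mat A B C D =
      four_block_mat X Y (0\<^sub>m 0 m1) (0\<^sub>m 0 m2) * four_block_mat A B C D"
    unfolding append_cols_def using X Y by simp
  also have "\<dots> = four_block_mat (X * A + Y * C) (X * B + Y * D) (0\<^sub>m 0 n1) (0\<^sub>m 0 n2)"
    by (subst mult_four_block_mat[OF X Y _ _ A B C D]) (use A B C D in auto)
  finally show ?thesis
    unfolding append_cols_def using A B C D X Y by simp
qed

section \<open>Direct sums of modules up to isomorphism\<close>

text \<open>Modules that agree on \<open>Field S\<close> may differ as records away from it.
  Identity matrices turn such agreement into an isomorphism.\<close>

lemma module_iso_if_eq:
  fixes M N :: "('a, 'k::field) inc_module"
  assumes M: "M \<in> modules S" and N: "N \<in> modules S"
    and dim: "\<And>x. x \<in> Field S \<Longrightarrow> vdim M x = vdim N x"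
    and act: "\<And>x y c. x \<in> Field S \<Longrightarrow> y \<in> Field S \<Longrightarrow> c \<in> inc_hom S x y \<Longrightarrow> act M y x c = act N y x c"
  shows "module_iso S M N"
proof (rule module_isoI)
  show "(\<lambda>x. 1\<^sub>m (vdim M x)) \<in> module_hom S M N" "(\<lambda>x. 1\<^sub>m (vdim M x)) \<in> module_hom S N M"
    by (rule module_homI; use act dim left_mult_one_mat[OF module_act_carrier[OF N]]
        right_mult_one_mat[OF module_act_carrier[OF N]] in simp)+
qed (use dim in auto)

lemma zero_module_modules: "zero_module \<in> modules S"
  unfolding modules_def zero_module_def by auto

lemma vdim_direct_sum: "vdim (direct_sum A B) x = vdim A x + vdim B x"
  unfolding direct_sum_def by simp

lemma act_direct_sum: "act (direct_sum A B) y x c = four_block_mat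
    (act A y x c) (0\<^sub>m (vdim A y) (vdim B x)) (0\<^sub>m (vdim B y) (vdim A x)) (act B y x c)"
  unfolding direct_sum_def by simp

lemma modulesI:
  fixes M :: "('a, 'k::field) inc_module"
  assumes "\<And>x y c. x \<in> Field S \<Longrightarrow> y \<in> Field S \<Longrightarrow> c \<in> inc_hom S x y \<Longrightarrow>
      act M y x c \<in> carrier_mat (vdim M y) (vdim M x)"
    and "\<And>x y c c'. x \<in> Field S \<Longrightarrow> y \<in> Field S \<Longrightarrow> c \<in> inc_hom S x y \<Longrightarrow> c' \<in> inc_hom S x y \<Longrightarrow>
      act M y x (c + c') = act M y x c + act M y x c'"
    and "\<And>x y c a. x \<in> Field S \<Longrightarrow> y \<in> Field S \<Longrightarrow> c \<in> inc_hom S x y \<Longrightarrow>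
      act M y x (a * c) = a \<cdot>\<^sub>m act M y x c"
    and "\<And>x. x \<in> Field S \<Longrightarrow> act M x x 1 = 1\<^sub>m (vdim M x)"
    and "\<And>x y z c d. x \<in> Field S \<Longrightarrow> y \<in> Field S \<Longrightarrow> z \<in> Field S \<Longrightarrow>
      c \<in> inc_hom S x y \<Longrightarrow> d \<in> inc_hom S y z \<Longrightarrow> act M z x (d * c) = act M z y d * act M y x c"
  shows "M \<in> modules S"
  using assms unfolding modules_def by simp

lemma direct_sum_modules:
  fixes A B :: "('a, 'k::field) inc_module"
  assumes A: "A \<in> modules S" and B: "B \<in> modules S"
  shows "direct_sum A B \<in> modules S"
proof (rule modulesI; unfold vdim_direct_sum act_direct_sum)
  fix x y and c :: 'k assume xyc: "x \<in> Field S" "y \<in> Field S" "c \<in> inc_hom S x y"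
  note Ac = module_act_carrier[OF A xyc] and Bc = module_act_carrier[OF B xyc]
  show "four_block_mat (act A y x c) (0\<^sub>m (vdim A y) (vdim B x)) (0\<^sub>m (vdim B y) (vdim A x))
      (act B y x c) \<in> carrier_mat (vdim A y + vdim B y) (vdim A x + vdim B x)"
    by (rule four_block_carrier_mat[OF Ac Bc])
  show "four_block_mat (act A y x (a * c)) (0\<^sub>m (vdim A y) (vdim B x)) (0\<^sub>m (vdim B y) (vdim A x))
      (act B y x (a * c)) = a \<cdot>\<^sub>m four_block_mat (act A y x c) (0\<^sub>m (vdim A y) (vdim B x))
        (0\<^sub>m (vdim B y) (vdim A x)) (act B y x c)" for a
    unfolding smult_four_block_mat[OF Ac zero_carrier_mat zero_carrier_mat Bc]
      module_act_smult[OF A xyc] module_act_smult[OF B xyc] by simp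
  fix c' :: 'k assume c': "c' \<in> inc_hom S x y"
  show "four_block_mat (act A y x (c + c')) (0\<^sub>m (vdim A y) (vdim B x)) (0\<^sub>m (vdim B y) (vdim A x))
      (act B y x (c + c')) = four_block_mat (act A y x c) (0\<^sub>m (vdim A y) (vdim B x))
        (0\<^sub>m (vdim B y) (vdim A x)) (act B y x c) +
        four_block_mat (act A y x c') (0\<^sub>m (vdim A y) (vdim B x))
        (0\<^sub>m (vdim B y) (vdim A x)) (act B y x c')"
    unfolding add_four_block_mat[OF Ac zero_carrier_mat zero_carrier_mat Bc
        module_act_carrier[OF A xyc(1,2) c'] zero_carrier_mat zero_carrier_mat
        module_act_carrier[OF B xyc(1,2) c']]
      module_act_add[OF A xyc c'] module_act_add[OF B xyc c'] by simp
next
  fix x assume x: "x \<in> Field S"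
  show "four_block_mat (act A x x 1) (0\<^sub>m (vdim A x) (vdim B x)) (0\<^sub>m (vdim B x) (vdim A x))
      (act B x x 1) = 1\<^sub>m (vdim A x + vdim B x)"
    unfolding module_act_one[OF A x] module_act_one[OF B x] by simp
next
  fix x y z and c d :: 'k
  assume x: "x \<in> Field S" and y: "y \<in> Field S" and z: "z \<in> Field S"
    and c: "c \<in> inc_hom S x y" and d: "d \<in> inc_hom S y z"
  note Ac = module_act_carrier[OF A x y c] module_act_carrier[OF A y z d]
    and Bc = module_act_carrier[OF B x y c] module_act_carrier[OF B y z d]
  show "four_block_mat (act A z x (d * c)) (0\<^sub>m (vdim A z) (vdim B x)) (0\<^sub>m (vdim B z) (vdim A x))
      (act B z x (d * c)) = four_block_mat (act A z y d) (0\<^sub>m (vdim A z) (vdim B y))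
        (0\<^sub>m (vdim B z) (vdim A y)) (act B z y d) *
        four_block_mat (act A y x c) (0\<^sub>m (vdim A y) (vdim B x))
        (0\<^sub>m (vdim B y) (vdim A x)) (act B y x c)"
    unfolding mult_four_block_mat[OF Ac(2) zero_carrier_mat zero_carrier_mat Bc(2)
        Ac(1) zero_carrier_mat zero_carrier_mat Bc(1)]
      module_act_comp[OF A x y c z d] module_act_comp[OF B x y c z d]
    using Ac Bc by (auto intro!: cong_four_block_mat)
qed

lemma direct_sum_list_modules:
  "(\<And>X. X \<in> set Xs \<Longrightarrow> X \<in> modules S) \<Longrightarrow> direct_sum_list Xs \<in> modules S"
  unfolding direct_sum_list_def
  by (induction Xs) (auto simp: zero_module_modules direct_sum_modules)

lemma direct_sum_assoc:
  fixes A B C :: "('a, 'k::field) inc_module"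
  assumes A: "A \<in> modules S" and B: "B \<in> modules S" and C: "C \<in> modules S"
  shows "module_iso S (direct_sum (direct_sum A B) C) (direct_sum A (direct_sum B C))"
proof (rule module_iso_if_eq)
  fix x y and c :: 'k assume xyc: "x \<in> Field S" "y \<in> Field S" "c \<in> inc_hom S x y"
  note d = carrier_matD[OF module_act_carrier[OF A xyc]] carrier_matD[OF module_act_carrier[OF B xyc]]
    carrier_matD[OF module_act_carrier[OF C xyc]]
  show "act (direct_sum (direct_sum A B) C) y x c = act (direct_sum A (direct_sum B C)) y x c"
    using assoc_four_block_mat[of "act A y x c" "act B y x c" "act C y x c"]
    by (simp add: act_direct_sum vdim_direct_sum d)
qed (use A B C in \<open>auto intro!: direct_sum_modules simp: vdim_direct_sum\<close>)

lemma direct_sum_zero_right: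
  fixes A B :: "('a, 'k::field) inc_module"
  assumes A: "A \<in> modules S" and B: "B \<in> modules S" and zero: "is_zero S B"
  shows "module_iso S (direct_sum A B) A"
proof (rule module_iso_if_eq)
  have vB: "vdim B x = 0" if "x \<in> Field S" for x
    using zero that unfolding is_zero_def by blast
  show "vdim (direct_sum A B) x = vdim A x" if "x \<in> Field S" for x
    using vB[OF that] by (simp add: vdim_direct_sum)
  fix x y and c :: 'k assume xyc: "x \<in> Field S" "y \<in> Field S" "c \<in> inc_hom S x y"
  have "act B y x c = 0\<^sub>m 0 0"
    using module_act_carrier[OF B xyc] vB xyc by (intro eq_matI) auto
  then show "act (direct_sum A B) y x c = act A y x c"
    using four_block_mat_empty[OF module_act_carrier[OF A xyc]] vB xyc
    by (simp add: act_direct_sum)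
qed (use A B in \<open>auto intro!: direct_sum_modules\<close>)

lemma direct_sum_cong:
  fixes A B :: "('a, 'k::field) inc_module"
  assumes mods: "A \<in> modules S" "A' \<in> modules S" "B \<in> modules S" "B' \<in> modules S"
    and isoA: "module_iso S A A'" and isoB: "module_iso S B B'"
  shows "module_iso S (direct_sum A B) (direct_sum A' B')"
proof -
  obtain f f' where f: "f \<in> module_hom S A A'" "f' \<in> module_hom S A' A"
    "\<And>x. x \<in> Field S \<Longrightarrow> f' x * f x = 1\<^sub>m (vdim A x)" "\<And>x. x \<in> Field S \<Longrightarrow> f x * f' x = 1\<^sub>m (vdim A' x)"
    using isoA by (rule module_isoE) (blast intro: that)
  obtain g g' where g: "g \<in> module_hom S B B'" "g' \<in> module_hom S B' B"
    "\<And>x. x \<in> Field S \<Longrightarrow> g' x * g x = 1\<^sub>m (vdim B x)" "\<And>x. x \<in> Field S \<Longrightarrow> g x * g' x = 1\<^sub>m (vdim B' x)"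
    using isoB by (rule module_isoE) (blast intro: that)
  \<comment> \<open>The four modules are arguments because they supply the sizes of the zero blocks;
    with the roles exchanged the same expression gives the inverse.\<close>
  define diag where "diag = (\<lambda>(X :: ('a, 'k) inc_module) (X' :: ('a, 'k) inc_module) (Y :: ('a, 'k) inc_module)
    (Y' :: ('a, 'k) inc_module) f g x. four_block_mat (f x)
    (0\<^sub>m (vdim X' x) (vdim Y x)) (0\<^sub>m (vdim Y' x) (vdim X x)) (g x :: 'k mat))"
  have hom: "diag X X' Y Y' f g \<in> module_hom S (direct_sum X Y) (direct_sum X' Y')"
    if m: "X \<in> modules S" "X' \<in> modules S" "Y \<in> modules S" "Y' \<in> modules S"
      and f: "f \<in> module_hom S X X'" and g: "g \<in> module_hom S Y Y'"
    for X X' Y Y' :: "('a, 'k) inc_module" and f g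
  proof (rule module_homI)
    fix x assume x: "x \<in> Field S"
    show "diag X X' Y Y' f g x \<in> carrier_mat (vdim (direct_sum X' Y') x) (vdim (direct_sum X Y) x)"
      unfolding diag_def vdim_direct_sum
      by (rule four_block_carrier_mat[OF module_hom_carrier[OF f x] module_hom_carrier[OF g x]])
  next
    fix x y and c :: 'k assume xyc: "x \<in> Field S" "y \<in> Field S" "c \<in> inc_hom S x y"
    note fg = module_hom_carrier[OF f] module_hom_carrier[OF g]
    note acts = m[THEN module_act_carrier, OF xyc]
    show "diag X X' Y Y' f g y * act (direct_sum X Y) y x c =
        act (direct_sum X' Y') y x c * diag X X' Y Y' f g x"
      unfolding diag_def act_direct_sum
        mult_four_block_mat[OF fg(1)[OF xyc(2)] zero_carrier_mat zero_carrier_mat fg(2)[OF xyc(2)]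
          acts(1) zero_carrier_mat zero_carrier_mat acts(3)]
        mult_four_block_mat[OF acts(2) zero_carrier_mat zero_carrier_mat acts(4)
          fg(1)[OF xyc(1)] zero_carrier_mat zero_carrier_mat fg(2)[OF xyc(1)]]
        module_hom_natural[OF f xyc] module_hom_natural[OF g xyc]
      using fg[OF xyc(1)] fg[OF xyc(2)] acts by (auto intro!: cong_four_block_mat)
  qed
  have inv: "diag X' X Y' Y f' g' x * diag X X' Y Y' f g x = 1\<^sub>m (vdim (direct_sum X Y) x)"
    if f: "f \<in> module_hom S X X'" and g: "g \<in> module_hom S Y Y'"
      and f': "f' \<in> module_hom S X' X" and g': "g' \<in> module_hom S Y' Y" and x: "x \<in> Field S"
      and ff: "f' x * f x = 1\<^sub>m (vdim X x)" and gg: "g' x * g x = 1\<^sub>m (vdim Y x)"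
    for X X' Y Y' :: "('a, 'k) inc_module" and f g f' g' x
  proof -
    note c = module_hom_carrier[OF f x] module_hom_carrier[OF g x]
      module_hom_carrier[OF f' x] module_hom_carrier[OF g' x]
    show ?thesis
      unfolding diag_def vdim_direct_sum
        mult_four_block_mat[OF c(3) zero_carrier_mat zero_carrier_mat c(4)
          c(1) zero_carrier_mat zero_carrier_mat c(2)] ff gg
      using c by (simp add: four_block_one_mat)
  qed
  show ?thesis
    by (rule module_isoI[OF hom[OF mods f(1) g(1)] hom[OF mods(2,1,4,3) f(2) g(2)]];
        rule inv) (use f g in auto)
qed

section \<open>Biproduct decompositions\<close>

text \<open>Inclusions and projections describe a decomposition by equations at each point. Unlike
  the block form of \<open>direct_sum\<close>, these can be moved along isomorphisms and assembled
  over lists of points without a choice of coordinates in \<open>N\<close>.\<close>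

definition biproduct ::
  "'a rel \<Rightarrow> ('a, 'k::field) inc_module \<Rightarrow> ('a, 'k) inc_module \<Rightarrow> ('a, 'k) inc_module \<Rightarrow>
    ('a \<Rightarrow> 'k mat) \<Rightarrow> ('a \<Rightarrow> 'k mat) \<Rightarrow> ('a \<Rightarrow> 'k mat) \<Rightarrow> ('a \<Rightarrow> 'k mat) \<Rightarrow> bool" where
  "biproduct S N A B i p j q \<longleftrightarrow>
     i \<in> module_hom S A N \<and> p \<in> module_hom S N A \<and> j \<in> module_hom S B N \<and> q \<in> module_hom S N B \<and>
     (\<forall>x\<in>Field S. p x * i x = 1\<^sub>m (vdim A x) \<and> q x * j x = 1\<^sub>m (vdim B x) \<and>
       p x * j x = 0\<^sub>m (vdim A x) (vdim B x) \<and> q x * i x = 0\<^sub>m (vdim B x) (vdim A x) \<and>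
       i x * p x + j x * q x = 1\<^sub>m (vdim N x))"

lemma biproductD:
  assumes "biproduct S N A B i p j q"
  shows "i \<in> module_hom S A N" "p \<in> module_hom S N A" "j \<in> module_hom S B N" "q \<in> module_hom S N B"
    and "x \<in> Field S \<Longrightarrow> p x * i x = 1\<^sub>m (vdim A x)"
    and "x \<in> Field S \<Longrightarrow> q x * j x = 1\<^sub>m (vdim B x)"
    and "x \<in> Field S \<Longrightarrow> p x * j x = 0\<^sub>m (vdim A x) (vdim B x)"
    and "x \<in> Field S \<Longrightarrow> q x * i x = 0\<^sub>m (vdim B x) (vdim A x)"
    and "x \<in> Field S \<Longrightarrow> i x * p x + j x * q x = 1\<^sub>m (vdim N x)"
proof -
  show "i \<in> module_hom S A N" "p \<in> module_hom S N A" "j \<in> module_hom S B N" "q \<in> module_hom S N B"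
    using assms[unfolded biproduct_def] by simp_all
  have b: "\<forall>x\<in>Field S. p x * i x = 1\<^sub>m (vdim A x) \<and> q x * j x = 1\<^sub>m (vdim B x) \<and>
      p x * j x = 0\<^sub>m (vdim A x) (vdim B x) \<and> q x * i x = 0\<^sub>m (vdim B x) (vdim A x) \<and>
      i x * p x + j x * q x = 1\<^sub>m (vdim N x)"
    using assms[unfolded biproduct_def] by (elim conjE)
  show "p x * i x = 1\<^sub>m (vdim A x)" "q x * j x = 1\<^sub>m (vdim B x)"
    "p x * j x = 0\<^sub>m (vdim A x) (vdim B x)" "q x * i x = 0\<^sub>m (vdim B x) (vdim A x)"
    "i x * p x + j x * q x = 1\<^sub>m (vdim N x)" if "x \<in> Field S"
    using bspec[OF b that] by - (elim conjE, assumption)+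
qed

lemma biproduct_carrier:
  assumes "biproduct S N A B i p j q" "x \<in> Field S"
  shows "i x \<in> carrier_mat (vdim N x) (vdim A x)" "p x \<in> carrier_mat (vdim A x) (vdim N x)"
    "j x \<in> carrier_mat (vdim N x) (vdim B x)" "q x \<in> carrier_mat (vdim B x) (vdim N x)"
  using biproductD(1-4)[OF assms(1), THEN module_hom_carrier, OF assms(2)] by simp_all

lemma biproduct_swap:
  assumes "biproduct S N A B i p j q"
  shows "biproduct S N B A j q i p"
proof -
  have "j x * q x + i x * p x = 1\<^sub>m (vdim N x)" if x: "x \<in> Field S" for x
    unfolding biproductD(9)[OF assms x, symmetric]
    by (rule comm_add_mat[OF mult_carrier_mat[OF biproduct_carrier(3,4)[OF assms x]]
          mult_carrier_mat[OF biproduct_carrier(1,2)[OF assms x]]])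
  then show ?thesis
    unfolding biproduct_def by (intro conjI ballI biproductD[OF assms])
qed

lemma biproduct_direct_sum:
  fixes A B :: "('a, 'k::field) inc_module"
  assumes A: "A \<in> modules S" and B: "B \<in> modules S"
  shows "\<exists>i p j q. biproduct S (direct_sum A B) A B i p j q"
proof (intro exI)
  let ?a = "vdim A" and ?b = "vdim B"
  let ?i = "\<lambda>x. 1\<^sub>m (?a x) @\<^sub>r 0\<^sub>m (?b x) (?a x) :: 'k mat"
  let ?j = "\<lambda>x. 0\<^sub>m (?a x) (?b x) @\<^sub>r 1\<^sub>m (?b x) :: 'k mat"
  let ?p = "\<lambda>x. append_cols (1\<^sub>m (?a x)) (0\<^sub>m (?a x) (?b x)) :: 'k mat"
  let ?q = "\<lambda>x. append_cols (0\<^sub>m (?b x) (?a x)) (1\<^sub>m (?b x)) :: 'k mat"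
  note one = one_carrier_mat and zero = zero_carrier_mat
  have i: "?i \<in> module_hom S A (direct_sum A B)"
  proof (rule module_homI; unfold vdim_direct_sum act_direct_sum)
    fix x y and c :: 'k assume xyc: "x \<in> Field S" "y \<in> Field S" "c \<in> inc_hom S x y"
    note Ac = module_act_carrier[OF A xyc] and Bc = module_act_carrier[OF B xyc]
    show "?i y * act A y x c =
        four_block_mat (act A y x c) (0\<^sub>m (?a y) (?b x)) (0\<^sub>m (?b y) (?a x)) (act B y x c) * ?i x"
      unfolding append_rows_mult[OF one zero Ac] four_block_mult_append_rows[OF Ac zero zero Bc one zero]
      using Ac Bc by simp
  qed (rule carrier_append_rows[OF one zero])
  have j: "?j \<in> module_hom S B (direct_sum A B)"
  proof (rule module_homI; unfold vdim_direct_sum act_direct_sum)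
    fix x y and c :: 'k assume xyc: "x \<in> Field S" "y \<in> Field S" "c \<in> inc_hom S x y"
    note Ac = module_act_carrier[OF A xyc] and Bc = module_act_carrier[OF B xyc]
    show "?j y * act B y x c =
        four_block_mat (act A y x c) (0\<^sub>m (?a y) (?b x)) (0\<^sub>m (?b y) (?a x)) (act B y x c) * ?j x"
      unfolding append_rows_mult[OF zero one Bc] four_block_mult_append_rows[OF Ac zero zero Bc zero one]
      using Ac Bc by simp
  qed (rule carrier_append_rows[OF zero one])
  have p: "?p \<in> module_hom S (direct_sum A B) A"
  proof (rule module_homI; unfold vdim_direct_sum act_direct_sum)
    fix x y and c :: 'k assume xyc: "x \<in> Field S" "y \<in> Field S" "c \<in> inc_hom S x y"
    note Ac = module_act_carrier[OF A xyc] and Bc = module_act_carrier[OF B xyc]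
    show "?p y *
        four_block_mat (act A y x c) (0\<^sub>m (?a y) (?b x)) (0\<^sub>m (?b y) (?a x)) (act B y x c) = act A y x c * ?p x"
      unfolding mult_append_cols[OF one zero Ac] append_cols_mult_four_block[OF one zero Ac zero zero Bc]
      using Ac Bc by simp
  qed (rule append_cols_carrier[OF one zero])
  have q: "?q \<in> module_hom S (direct_sum A B) B"
  proof (rule module_homI; unfold vdim_direct_sum act_direct_sum)
    fix x y and c :: 'k assume xyc: "x \<in> Field S" "y \<in> Field S" "c \<in> inc_hom S x y"
    note Ac = module_act_carrier[OF A xyc] and Bc = module_act_carrier[OF B xyc]
    show "?q y *
        four_block_mat (act A y x c) (0\<^sub>m (?a y) (?b x)) (0\<^sub>m (?b y) (?a x)) (act B y x c) = act B y x c * ?q x"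
      unfolding mult_append_cols[OF zero one Bc] append_cols_mult_four_block[OF zero one Ac zero zero Bc]
      using Ac Bc by simp
  qed (rule append_cols_carrier[OF zero one])
  have ip: "?i x * ?p x = four_block_mat (1\<^sub>m (?a x)) (0\<^sub>m (?a x) (?b x))
      (0\<^sub>m (?b x) (?a x)) (0\<^sub>m (?b x) (?b x))" for x
    unfolding append_rows_mult_append_cols[OF one zero one zero] by simp
  have jq: "?j x * ?q x = four_block_mat (0\<^sub>m (?a x) (?a x)) (0\<^sub>m (?a x) (?b x))
      (0\<^sub>m (?b x) (?a x)) (1\<^sub>m (?b x))" for x
    unfolding append_rows_mult_append_cols[OF zero one zero one] by simp
  have "?i x * ?p x + ?j x * ?q x = 1\<^sub>m (?a x + ?b x)" for x
    unfolding ip jq add_four_block_mat[OF one zero zero zero zero zero zero one] by simp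
  moreover have "?p x * ?i x = 1\<^sub>m (?a x)" for x
    unfolding append_cols_mult_append_rows[OF one zero one zero] by simp
  moreover have "?q x * ?j x = 1\<^sub>m (?b x)" for x
    unfolding append_cols_mult_append_rows[OF zero one zero one] by simp
  moreover have "?p x * ?j x = 0\<^sub>m (?a x) (?b x)" for x
    unfolding append_cols_mult_append_rows[OF one zero zero one] by simp
  moreover have "?q x * ?i x = 0\<^sub>m (?b x) (?a x)" for x
    unfolding append_cols_mult_append_rows[OF zero one one zero] by simp
  ultimately show "biproduct S (direct_sum A B) A B ?i ?p ?j ?q"
    unfolding biproduct_def vdim_direct_sum by (intro conjI ballI i p j q)
qed


section \<open>Cancellation of constant modules\<close>

text \<open>The comparison map \<open>i * p' + j * q'\<close> takes \<open>i'\<close> to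
  \<open>i\<close> and \<open>j'\<close> to \<open>j\<close>, so its composite with the comparison
  map in the other direction is \<open>i * p + j * q\<close>.\<close>

lemma biproduct_mats_unique:
  fixes i p j q i' p' j' q' :: "'a::field mat"
  assumes i: "i \<in> carrier_mat n a" and p: "p \<in> carrier_mat a n"
    and j: "j \<in> carrier_mat n b" and q: "q \<in> carrier_mat b n"
    and i': "i' \<in> carrier_mat n' a" and p': "p' \<in> carrier_mat a n'"
    and j': "j' \<in> carrier_mat n' b" and q': "q' \<in> carrier_mat b n'"
    and one: "i * p + j * q = 1\<^sub>m n"
    and pi': "p' * i' = 1\<^sub>m a" and qj': "q' * j' = 1\<^sub>m b"
    and pj': "p' * j' = 0\<^sub>m a b" and qi': "q' * i' = 0\<^sub>m b a"
  shows "(i * p' + j * q') * (i' * p + j' * q) = 1\<^sub>m n"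
proof -
  note d = carrier_matD[OF i] carrier_matD[OF p] carrier_matD[OF j] carrier_matD[OF q]
    carrier_matD[OF i'] carrier_matD[OF p'] carrier_matD[OF j'] carrier_matD[OF q']
    index_mult_mat(2,3) index_add_mat(2,3)
  have "(i * p' + j * q') * i' = i * (p' * i') + j * (q' * i')"
    by (simp only: add_mult_distrib_mat_dim assoc_mult_mat_dim d)
  then have 1: "(i * p' + j * q') * i' = i"
    unfolding pi' qi' using i j by simp
  have "(i * p' + j * q') * j' = i * (p' * j') + j * (q' * j')"
    by (simp only: add_mult_distrib_mat_dim assoc_mult_mat_dim d)
  then have 2: "(i * p' + j * q') * j' = j"
    unfolding pj' qj' using i j by simp
  have "(i * p' + j * q') * (i' * p + j' * q) =
      (i * p' + j * q') * i' * p + (i * p' + j * q') * j' * q"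
    by (simp only: mult_add_distrib_mat_dim assoc_mult_mat_dim d)
  then show ?thesis
    unfolding 1 2 one .
qed

lemma biproduct_unique:
  assumes mods: "N \<in> modules S" "N' \<in> modules S" "A \<in> modules S" "B \<in> modules S"
    and b: "biproduct S N A B i p j q" and b': "biproduct S N' A B i' p' j' q'"
  shows "module_iso S N N'"
proof (rule module_isoI)
  show "(\<lambda>x. i' x * p x + j' x * q x) \<in> module_hom S N N'"
    using mods biproductD(1-4)[OF b] biproductD(1-4)[OF b']
    by (intro module_hom_add module_hom_comp[of _ _ A] module_hom_comp[of _ _ B])
  show "(\<lambda>x. i x * p' x + j x * q' x) \<in> module_hom S N' N"
    using mods biproductD(1-4)[OF b] biproductD(1-4)[OF b']
    by (intro module_hom_add module_hom_comp[of _ _ A] module_hom_comp[of _ _ B])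
  fix x assume x: "x \<in> Field S"
  show "(i x * p' x + j x * q' x) * (i' x * p x + j' x * q x) = 1\<^sub>m (vdim N x)"
    by (rule biproduct_mats_unique[OF biproduct_carrier[OF b x] biproduct_carrier[OF b' x]
          biproductD(9)[OF b x] biproductD(5-8)[OF b' x]])
  show "(i' x * p x + j' x * q x) * (i x * p' x + j x * q' x) = 1\<^sub>m (vdim N' x)"
    by (rule biproduct_mats_unique[OF biproduct_carrier[OF b' x] biproduct_carrier[OF b x]
          biproductD(9)[OF b' x] biproductD(5-8)[OF b x]])
qed

lemma biproduct_transport:
  assumes mods: "N \<in> modules S" "N' \<in> modules S" "A \<in> modules S" "B \<in> modules S"
    and b: "biproduct S N A B i p j q"
    and f: "f \<in> module_hom S N' N" and g: "g \<in> module_hom S N N'"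
    and gf: "\<And>x. x \<in> Field S \<Longrightarrow> g x * f x = 1\<^sub>m (vdim N' x)"
    and fg: "\<And>x. x \<in> Field S \<Longrightarrow> f x * g x = 1\<^sub>m (vdim N x)"
  shows "biproduct S N' A B (\<lambda>x. g x * i x) (\<lambda>x. p x * f x) (\<lambda>x. g x * j x) (\<lambda>x. q x * f x)"
  unfolding biproduct_def
proof (intro conjI ballI)
  show "(\<lambda>x. g x * i x) \<in> module_hom S A N'" "(\<lambda>x. p x * f x) \<in> module_hom S N' A"
    "(\<lambda>x. g x * j x) \<in> module_hom S B N'" "(\<lambda>x. q x * f x) \<in> module_hom S N' B"
    using mods biproductD(1-4)[OF b] f g by (auto intro: module_hom_comp[of _ _ N])
  fix x assume x: "x \<in> Field S"
  note c = biproduct_carrier[OF b x] module_hom_carrier[OF f x] module_hom_carrier[OF g x]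
  \<comment> \<open>In every composite of a transported projection with a transported inclusion, the
    isomorphism and its inverse meet in the middle and cancel.\<close>
  have mid: "(u * f x) * (g x * v) = u * v"
    if u: "u \<in> carrier_mat r (vdim N x)" and v: "v \<in> carrier_mat (vdim N x) s" for u v r s
  proof -
    have "(u * f x) * (g x * v) = u * (f x * g x * v)"
      by (simp only: assoc_mult_mat_dim carrier_matD[OF u] carrier_matD[OF v]
          c[THEN carrier_matD(1)] c[THEN carrier_matD(2)] index_mult_mat(2,3))
    then show ?thesis
      unfolding fg[OF x] left_mult_one_mat[OF v] .
  qed
  show "(p x * f x) * (g x * i x) = 1\<^sub>m (vdim A x)"
    unfolding mid[OF c(2,1)] by (rule biproductD(5)[OF b x])
  show "(q x * f x) * (g x * j x) = 1\<^sub>m (vdim B x)"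
    unfolding mid[OF c(4,3)] by (rule biproductD(6)[OF b x])
  show "(p x * f x) * (g x * j x) = 0\<^sub>m (vdim A x) (vdim B x)"
    unfolding mid[OF c(2,3)] by (rule biproductD(7)[OF b x])
  show "(q x * f x) * (g x * i x) = 0\<^sub>m (vdim B x) (vdim A x)"
    unfolding mid[OF c(4,1)] by (rule biproductD(8)[OF b x])
  have "(g x * i x) * (p x * f x) + (g x * j x) * (q x * f x) = g x * (i x * p x + j x * q x) * f x"
    by (simp only: mult_add_distrib_mat_dim add_mult_distrib_mat_dim assoc_mult_mat_dim
        c[THEN carrier_matD(1)] c[THEN carrier_matD(2)] index_mult_mat(2,3) index_add_mat(2,3))
  then show "(g x * i x) * (p x * f x) + (g x * j x) * (q x * f x) = 1\<^sub>m (vdim N' x)"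
    unfolding biproductD(9)[OF b x] right_mult_one_mat[OF c(6)] gf[OF x] .
qed

text \<open>Passage between isomorphisms with the block sum and equational decompositions: one
  direction transports the standard biproduct, the other is uniqueness of biproducts.\<close>

lemma module_iso_direct_sum_iff_biproduct:
  assumes mods: "N \<in> modules S" "A \<in> modules S" "B \<in> modules S"
  shows "module_iso S N (direct_sum A B) \<longleftrightarrow> (\<exists>i p j q. biproduct S N A B i p j q)"
proof
  obtain i p j q where b: "biproduct S (direct_sum A B) A B i p j q"
    using biproduct_direct_sum[OF mods(2,3)] by blast
  note AB = direct_sum_modules[OF mods(2,3)]
  show "\<exists>i p j q. biproduct S N A B i p j q" if "module_iso S N (direct_sum A B)"
    using that
  proof (rule module_isoE)
    fix f g assume "f \<in> module_hom S N (direct_sum A B)" "g \<in> module_hom S (direct_sum A B) N"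
      "\<And>x. x \<in> Field S \<Longrightarrow> g x * f x = 1\<^sub>m (vdim N x)"
      "\<And>x. x \<in> Field S \<Longrightarrow> f x * g x = 1\<^sub>m (vdim (direct_sum A B) x)"
    from biproduct_transport[OF AB mods b this] show ?thesis by blast
  qed
  show "module_iso S N (direct_sum A B)" if "\<exists>i p j q. biproduct S N A B i p j q"
    using biproduct_unique[OF mods(1) AB mods(2,3) _ b] that by blast
qed

lemma direct_sum_commute:
  assumes "A \<in> modules S" "B \<in> modules S"
  shows "module_iso S (direct_sum A B) (direct_sum B A)"
  using biproduct_direct_sum[OF assms] biproduct_swap
  unfolding module_iso_direct_sum_iff_biproduct[OF direct_sum_modules[OF assms] assms(2,1)]
  by blast

section \<open>Constant modules and their endomorphisms\<close>

text \<open>The common form of the two restrictions of the interval module, over \<open>Q I\<close>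
  and over \<open>Z\<close>. Only values at points and scalars that belong to the incidence category
  are prescribed.\<close>

definition constant_module :: "'a rel \<Rightarrow> ('a, 'k::field) inc_module \<Rightarrow> bool" where
  "constant_module S L \<longleftrightarrow> (\<forall>x\<in>Field S. vdim L x = 1) \<and>
     (\<forall>x\<in>Field S. \<forall>y\<in>Field S. \<forall>c\<in>inc_hom S x y. act L y x c = c \<cdot>\<^sub>m 1\<^sub>m 1)"

lemma constant_module_vdim: "constant_module S L \<Longrightarrow> x \<in> Field S \<Longrightarrow> vdim L x = 1"
  unfolding constant_module_def by blast

lemma constant_module_act:
  "constant_module S L \<Longrightarrow> x \<in> Field S \<Longrightarrow> y \<in> Field S \<Longrightarrow> c \<in> inc_hom S x y \<Longrightarrow>
    act L y x c = c \<cdot>\<^sub>m 1\<^sub>m 1"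
  unfolding constant_module_def by blast

lemma mat_1_1_eq: "A \<in> carrier_mat 1 1 \<Longrightarrow> A = A $$ (0, 0) \<cdot>\<^sub>m (1\<^sub>m 1 :: 'a::field mat)"
  by (rule eq_matI) auto

text \<open>Together with \<open>constant_module_endo\<close> this determines the endomorphisms of a
  constant module: they are the scalar functions that are constant along comparabilities. Such a
  function may be chosen separately on each connected component.\<close>

lemma constant_module_scalar_hom:
  fixes L :: "('a, 'k::field) inc_module"
  assumes L: "constant_module S L" and t: "\<And>x y. (x, y) \<in> S \<Longrightarrow> t x = t y"
  shows "(\<lambda>x. t x \<cdot>\<^sub>m 1\<^sub>m 1) \<in> module_hom S L L"
proof (rule module_homI)
  fix x y and c :: 'k assume xyc: "x \<in> Field S" "y \<in> Field S" "c \<in> inc_hom S x y"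
  have "t y * c = c * t x"
    using t[of x y] xyc(3) by (auto simp: inc_hom_def split: if_splits)
  then show "(t y \<cdot>\<^sub>m 1\<^sub>m 1) * act L y x c = act L y x c * (t x \<cdot>\<^sub>m 1\<^sub>m 1)"
    unfolding constant_module_act[OF L xyc] by (intro eq_matI) (auto simp: scalar_prod_def)
qed (simp add: constant_module_vdim[OF L])

lemma constant_module_endo:
  fixes L :: "('a, 'k::field) inc_module"
  assumes L: "constant_module S L" and f: "f \<in> module_hom S L L" and xy: "(x, y) \<in> S"
  shows "f x = f y"
proof -
  have F: "x \<in> Field S" "y \<in> Field S"
    using xy by (auto simp: Field_def)
  have c: "(1::'k) \<in> inc_hom S x y"
    using xy by (simp add: inc_hom_def)
  have "f x \<in> carrier_mat 1 1" "f y \<in> carrier_mat 1 1"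
    using module_hom_carrier[OF f] constant_module_vdim[OF L] F by metis+
  moreover have "act L y x 1 = 1\<^sub>m 1"
    unfolding constant_module_act[OF L F c] by (intro eq_matI) auto
  ultimately show ?thesis
    using module_hom_natural[OF f F c] by simp
qed

text \<open>
  Evans cancellation for a module whose endomorphism ring has stable range one: a shear makes the
  component \<open>L \<rightarrow> L\<close> of the given isomorphism invertible, and then \<open>A\<close> and \<open>B\<close> are both
  complements of the same copy of \<open>L\<close>.
\<close>

lemma constant_module_cancel_left:
  fixes L A B :: "('a, 'k::field) inc_module"
  assumes L: "constant_module S L"
    and mods: "L \<in> modules S" "A \<in> modules S" "B \<in> modules S"
    and iso: "module_iso S (direct_sum L A) (direct_sum L B)"
  shows "module_iso S A B"
proof -
  define N where "N = direct_sum L A"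
  have N: "N \<in> modules S"
    unfolding N_def by (rule direct_sum_modules[OF mods(1,2)])
  obtain i p iA pA where a: "biproduct S N L A i p iA pA"
    using biproduct_direct_sum[OF mods(1,2)] unfolding N_def by blast
  obtain j q jB qB where b: "biproduct S N L B j q jB qB"
    using iso module_iso_direct_sum_iff_biproduct[OF N mods(1,3)] unfolding N_def by blast
  note ah = biproductD(1-4)[OF a] and bh = biproductD(1-4)[OF b]
  note comp = module_hom_comp
  define u where "u x = q x * i x" for x
  have u: "u \<in> module_hom S L L"
    unfolding u_def by (rule comp[OF mods(1) N mods(1) ah(1) bh(2)])
  \<comment> \<open>Stable range one in a product of fields. The identity of \<open>L\<close> is
    \<open>p * j * u + p * jB * qB * i\<close>, so where \<open>u\<close> vanishes the second term
    is 1. Adding it exactly at those points gives a unit, and \<open>t\<close> is constant along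
    comparabilities because \<open>u\<close> is.\<close>
  define t where "t x = (if u x $$ (0, 0) = 0 then 1 else 0 :: 'k)" for x
  define T where "T x = t x \<cdot>\<^sub>m (1\<^sub>m 1 :: 'k mat)" for x
  have T: "T \<in> module_hom S L L"
    unfolding T_def
    by (rule constant_module_scalar_hom[OF L]) (simp add: t_def constant_module_endo[OF L u])
  \<comment> \<open>The off-diagonal entry of the shear of the sum of \<open>L\<close> and
    \<open>B\<close>. It turns \<open>q\<close> into \<open>q'\<close> and \<open>jB\<close> into
    \<open>jB'\<close>, while \<open>j\<close> and \<open>qB\<close> stay, so the result is again a
    biproduct.\<close>
  define s where "s x = T x * (p x * jB x)" for x
  have s: "s \<in> module_hom S B L"
    unfolding s_def using mods N ah bh T by (intro comp[of B _ L] comp[of B _ N])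
  define q' where "q' x = q x + s x * qB x" for x
  have q': "q' \<in> module_hom S N L"
    unfolding q'_def using mods N bh s by (intro module_hom_add comp[of N _ B])
  define jB' where "jB' x = jB x - j x * s x" for x
  have jB': "jB' \<in> module_hom S B N"
    unfolding jB'_def using mods N bh s by (intro module_hom_diff comp[of B _ L])
  define v where "v x = q' x * i x" for x
  have v: "v \<in> module_hom S L L"
    unfolding v_def by (rule comp[OF mods(1) N mods(1) ah(1) q'])
  \<comment> \<open>Naturality of \<open>w\<close> needs only that \<open>v\<close> is constant
    along comparabilities, as \<open>inverse\<close> is total; the entry of \<open>v\<close> is
    shown to be nonzero below.\<close>
  define w where "w x = inverse (v x $$ (0, 0)) \<cdot>\<^sub>m (1\<^sub>m 1 :: 'k mat)" for x
  have w: "w \<in> module_hom S L L"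
    unfolding w_def
    by (rule constant_module_scalar_hom[OF L]) (simp add: constant_module_endo[OF L v])
  define e where "e x = 1\<^sub>m (vdim N x) - i x * w x * q' x" for x
  have e: "e \<in> module_hom S N N"
    unfolding e_def
    by (rule module_hom_diff[OF N N module_hom_id[OF N] comp[OF N mods(1) N q' comp[OF mods(1) mods(1) N w ah(1)]]])
  have F: "(\<lambda>x. pA x * jB' x) \<in> module_hom S B A"
    by (rule comp[OF mods(3) N mods(2) jB' ah(4)])
  have G: "(\<lambda>x. qB x * e x * iA x) \<in> module_hom S A B"
    by (rule comp[OF mods(2) N mods(3) ah(3) comp[OF N N mods(3) e bh(4)]])
  have "(pA x * jB' x) * (qB x * e x * iA x) = 1\<^sub>m (vdim A x) \<and>
    (qB x * e x * iA x) * (pA x * jB' x) = 1\<^sub>m (vdim B x)" if x: "x \<in> Field S" for x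
  proof -
    have l: "vdim L x = 1"
      by (rule constant_module_vdim[OF L x])
    note ac = biproduct_carrier[OF a x, unfolded l] and bc = biproduct_carrier[OF b x, unfolded l]
    note hc = module_hom_carrier[OF _ x]
    note sc = hc[OF s, unfolded l] and Tc = hc[OF T, unfolded l] and uc = hc[OF u, unfolded l]
      and q'c = hc[OF q', unfolded l] and jB'c = hc[OF jB'] and wc = hc[OF w, unfolded l]
      and vc = hc[OF v, unfolded l]
    note ai = biproductD(5-9)[OF a x, unfolded l] and bi = biproductD(5-9)[OF b x, unfolded l]
    note d = ac[THEN carrier_matD(1)] ac[THEN carrier_matD(2)] bc[THEN carrier_matD(1)]
      bc[THEN carrier_matD(2)] carrier_matD[OF sc] carrier_matD[OF Tc]
      index_mult_mat(2,3) index_add_mat(2,3)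
    have q'j: "q' x * j x = 1\<^sub>m 1"
    proof -
      have "q' x * j x = q x * j x + s x * (qB x * j x)"
        unfolding q'_def by (simp only: add_mult_distrib_mat_dim assoc_mult_mat_dim d)
      then show ?thesis
        unfolding bi using sc by simp
    qed
    have q'jB: "q' x * jB x = s x"
    proof -
      have "q' x * jB x = q x * jB x + s x * (qB x * jB x)"
        unfolding q'_def by (simp only: add_mult_distrib_mat_dim assoc_mult_mat_dim d)
      then show ?thesis
        unfolding bi using sc by simp
    qed
    have js: "j x * s x \<in> carrier_mat (vdim N x) (vdim B x)"
      by (rule mult_carrier_mat[OF bc(1) sc])
    have "q' x * jB' x = q' x * jB x - q' x * j x * s x"
      unfolding jB'_def mult_minus_distrib_mat[OF q'c bc(3) js] assoc_mult_mat[OF q'c bc(1) sc] ..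
    then have q'jB': "q' x * jB' x = 0\<^sub>m 1 (vdim B x)"
      unfolding q'j q'jB using sc by simp
    have "qB x * jB' x = qB x * jB x - qB x * j x * s x"
      unfolding jB'_def mult_minus_distrib_mat[OF bc(4) bc(3) js] assoc_mult_mat[OF bc(4) bc(1) sc] ..
    then have qBjB': "qB x * jB' x = 1\<^sub>m (vdim B x)"
      unfolding bi using sc by (auto intro!: eq_matI)
    have add_diff: "(X + Z) + (Y - Z) = X + Y"
      if "X \<in> carrier_mat m n" "Y \<in> carrier_mat m n" "Z \<in> carrier_mat m n" for X Y Z :: "'k mat" and m n
      using that by (intro eq_matI) auto
    have "j x * q' x = j x * q x + j x * s x * qB x"
      unfolding q'_def by (simp only: mult_add_distrib_mat_dim assoc_mult_mat_dim d)
    moreover have "jB' x * qB x = jB x * qB x - j x * s x * qB x"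
      unfolding jB'_def by (rule minus_mult_distrib_mat[OF bc(3) js bc(4)])
    ultimately have "j x * q' x + jB' x * qB x =
        (j x * q x + j x * s x * qB x) + (jB x * qB x - j x * s x * qB x)"
      by simp
    also have "\<dots> = j x * q x + jB x * qB x"
      by (rule add_diff[OF mult_carrier_mat[OF bc(1,2)] mult_carrier_mat[OF bc(3,4)]
            mult_carrier_mat[OF js bc(4)]])
    finally have one: "j x * q' x + jB' x * qB x = 1\<^sub>m (vdim N x)"
      unfolding bi .
    have "v x = u x + T x * (p x * (jB x * (qB x * i x)))"
      unfolding v_def q'_def u_def s_def
      by (simp only: add_mult_distrib_mat_dim assoc_mult_mat_dim d)
    moreover have "p x * (j x * u x) + p x * (jB x * (qB x * i x)) = p x * (j x * q x + jB x * qB x) * i x"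
      unfolding u_def
      by (simp only: add_mult_distrib_mat_dim mult_add_distrib_mat_dim assoc_mult_mat_dim d)
    then have "p x * (j x * u x) + p x * (jB x * (qB x * i x)) = 1\<^sub>m 1"
      unfolding bi right_mult_one_mat[OF ac(2)] ai .
    moreover have uz: "u x = u x $$ (0, 0) \<cdot>\<^sub>m 1\<^sub>m 1"
      by (rule mat_1_1_eq[OF uc])
    have pjBqBi: "p x * (jB x * (qB x * i x)) \<in> carrier_mat 1 1"
      by (rule mult_carrier_mat[OF ac(2) mult_carrier_mat[OF bc(3) mult_carrier_mat[OF bc(4) ac(1)]]])
    \<comment> \<open>Where \<open>u\<close> is 0, \<open>v\<close> is the complementary term, which
      equals 1 there; elsewhere the shear is switched off and \<open>v\<close> is
      \<open>u\<close>.\<close>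
    ultimately have v0: "v x $$ (0, 0) \<noteq> 0"
    proof (cases "u x $$ (0, 0) = 0")
      case True
      then have u0: "u x = 0\<^sub>m 1 1"
        using uz by (intro eq_matI) (use uc in auto)
      have T1: "T x = 1\<^sub>m 1"
        unfolding T_def t_def using True by (intro eq_matI) auto
      assume v: "v x = u x + T x * (p x * (jB x * (qB x * i x)))"
        and one: "p x * (j x * u x) + p x * (jB x * (qB x * i x)) = 1\<^sub>m 1"
      have "p x * (j x * u x) = 0\<^sub>m 1 1"
        unfolding u0 right_mult_zero_mat[OF bc(1)] right_mult_zero_mat[OF ac(2)] ..
      then have "p x * (jB x * (qB x * i x)) = 1\<^sub>m 1"
        using one left_add_zero_mat[OF pjBqBi] by simp
      then have "v x = 1\<^sub>m 1"
        unfolding v u0 T1 by simp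
      then show ?thesis by simp
    next
      case False
      then have "T x = 0\<^sub>m 1 1"
        unfolding T_def t_def by (intro eq_matI) auto
      moreover assume "v x = u x + T x * (p x * (jB x * (qB x * i x)))"
      ultimately have "v x = u x"
        using uc left_mult_zero_mat[OF pjBqBi] by simp
      then show ?thesis using False by simp
    qed
    have vw: "v x * w x = 1\<^sub>m 1" "w x * v x = 1\<^sub>m 1"
      using v0 vc wc unfolding w_def
      by (auto intro!: eq_matI simp: scalar_prod_def)
    show ?thesis
      unfolding e_def
      using cancel_complement_mats[OF ac bc(1) q'c jB'c bc(4) wc ai(5,4,2) one q'jB' qBjB'
          vw[unfolded v_def]] by blast
  qed
  then have "module_iso S B A"
    by (intro module_isoI[OF F G]) blast+
  then show ?thesis
    by (rule module_iso_sym)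
qed


section \<open>Multiplicities of constant modules\<close>

text \<open>Transitivity of \<open>module_iso\<close> requires all modules involved to satisfy the
  functor laws. Bundling membership with isomorphism gives a relation that can be chained with
  \<open>also\<close>.\<close>

definition isomorphic_modules ::
  "'a rel \<Rightarrow> ('a, 'k::field) inc_module \<Rightarrow> ('a, 'k) inc_module \<Rightarrow> bool" where
  "isomorphic_modules S M N \<longleftrightarrow> M \<in> modules S \<and> N \<in> modules S \<and> module_iso S M N"

lemma isomorphic_modulesI:
  "M \<in> modules S \<Longrightarrow> N \<in> modules S \<Longrightarrow> module_iso S M N \<Longrightarrow> isomorphic_modules S M N"
  unfolding isomorphic_modules_def by simp

lemma isomorphic_modulesD:
  assumes "isomorphic_modules S M N"
  shows "M \<in> modules S" "N \<in> modules S" "module_iso S M N"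
  using assms unfolding isomorphic_modules_def by simp_all

lemma isomorphic_modules_refl: "M \<in> modules S \<Longrightarrow> isomorphic_modules S M M"
  by (simp add: isomorphic_modules_def module_iso_refl)

lemma isomorphic_modules_sym: "isomorphic_modules S M N \<Longrightarrow> isomorphic_modules S N M"
  by (simp add: isomorphic_modules_def module_iso_sym)

lemma isomorphic_modules_trans [trans]:
  "isomorphic_modules S M N \<Longrightarrow> isomorphic_modules S N K \<Longrightarrow> isomorphic_modules S M K"
  unfolding isomorphic_modules_def using module_iso_trans by metis

lemma isomorphic_modules_direct_sum:
  "isomorphic_modules S A A' \<Longrightarrow> isomorphic_modules S B B' \<Longrightarrow>
    isomorphic_modules S (direct_sum A B) (direct_sum A' B')"
  by (simp add: isomorphic_modules_def direct_sum_cong direct_sum_modules)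

lemma isomorphic_modules_commute:
  "A \<in> modules S \<Longrightarrow> B \<in> modules S \<Longrightarrow>
    isomorphic_modules S (direct_sum A B) (direct_sum B A)"
  by (simp add: isomorphic_modules_def direct_sum_commute direct_sum_modules)

lemma isomorphic_modules_assoc:
  "A \<in> modules S \<Longrightarrow> B \<in> modules S \<Longrightarrow> C \<in> modules S \<Longrightarrow>
    isomorphic_modules S (direct_sum (direct_sum A B) C) (direct_sum A (direct_sum B C))"
  by (simp add: isomorphic_modules_def direct_sum_assoc direct_sum_modules)

lemma isomorphic_modules_left_commute:
  assumes A: "A \<in> modules S" and B: "B \<in> modules S" and C: "C \<in> modules S"
  shows "isomorphic_modules S (direct_sum A (direct_sum B C)) (direct_sum B (direct_sum A C))"
proof -
  have "isomorphic_modules S (direct_sum A (direct_sum B C)) (direct_sum (direct_sum A B) C)"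
    by (rule isomorphic_modules_sym[OF isomorphic_modules_assoc[OF A B C]])
  also have "isomorphic_modules S \<dots> (direct_sum (direct_sum B A) C)"
    by (rule isomorphic_modules_direct_sum[OF isomorphic_modules_commute[OF A B]
          isomorphic_modules_refl[OF C]])
  also have "isomorphic_modules S \<dots> (direct_sum B (direct_sum A C))"
    by (rule isomorphic_modules_assoc[OF B A C])
  finally show ?thesis .
qed

lemma is_zero_zero_module: "is_zero S zero_module"
  unfolding is_zero_def zero_module_def by simp

lemma isomorphic_modules_zero_right:
  "A \<in> modules S \<Longrightarrow> B \<in> modules S \<Longrightarrow> is_zero S B \<Longrightarrow> isomorphic_modules S (direct_sum A B) A"
  by (simp add: isomorphic_modules_def direct_sum_zero_right direct_sum_modules)

lemma isomorphic_modules_zero_left: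
  "A \<in> modules S \<Longrightarrow> B \<in> modules S \<Longrightarrow> is_zero S A \<Longrightarrow> isomorphic_modules S (direct_sum A B) B"
  using isomorphic_modules_trans[OF isomorphic_modules_commute isomorphic_modules_zero_right] .

lemma direct_sum_list_Nil: "direct_sum_list [] = zero_module"
  and direct_sum_list_Cons: "direct_sum_list (X # Xs) = direct_sum X (direct_sum_list Xs)"
  by (simp_all add: direct_sum_list_def)

lemma direct_sum_list_append:
  assumes "set Xs \<subseteq> modules S" "set Ys \<subseteq> modules S"
  shows "isomorphic_modules S (direct_sum_list (Xs @ Ys))
    (direct_sum (direct_sum_list Xs) (direct_sum_list Ys))"
  using assms(1)
proof (induction Xs)
  case Nil
  have "direct_sum_list Ys \<in> modules S"
    by (rule direct_sum_list_modules) (use assms(2) in blast)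
  then show ?case
    using isomorphic_modules_sym[OF isomorphic_modules_zero_left[OF zero_module_modules _ is_zero_zero_module]]
    by (simp add: direct_sum_list_Nil)
next
  case (Cons X Xs)
  have mods: "X \<in> modules S" "direct_sum_list Xs \<in> modules S" "direct_sum_list Ys \<in> modules S"
    using Cons.prems assms(2) by (auto intro!: direct_sum_list_modules)
  have "isomorphic_modules S (direct_sum_list ((X # Xs) @ Ys))
      (direct_sum X (direct_sum (direct_sum_list Xs) (direct_sum_list Ys)))"
    using Cons mods by (simp add: direct_sum_list_Cons isomorphic_modules_direct_sum
        isomorphic_modules_refl)
  also have "isomorphic_modules S \<dots>
      (direct_sum (direct_sum_list (X # Xs)) (direct_sum_list Ys))"
    unfolding direct_sum_list_Cons by (rule isomorphic_modules_sym[OF isomorphic_modules_assoc[OF mods]])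
  finally show ?case .
qed

section \<open>The exponent of a constant summand\<close>

abbreviation copies ::
  "nat \<Rightarrow> ('a, 'k::field) inc_module \<Rightarrow> ('a, 'k) inc_module \<Rightarrow> ('a, 'k) inc_module" where
  "copies n L A \<equiv> direct_sum (direct_sum_list (replicate n L)) A"

lemma direct_sum_list_replicate_modules:
  "L \<in> modules S \<Longrightarrow> direct_sum_list (replicate n L) \<in> modules S"
  by (rule direct_sum_list_modules) (simp split: if_splits)

lemma copies_modules: "L \<in> modules S \<Longrightarrow> A \<in> modules S \<Longrightarrow> copies n L A \<in> modules S"
  by (simp add: direct_sum_modules direct_sum_list_replicate_modules)

lemma copies_0: "A \<in> modules S \<Longrightarrow> isomorphic_modules S (copies 0 L A) A"
  by (simp add: direct_sum_list_Nil isomorphic_modules_zero_left zero_module_modules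
      is_zero_zero_module)

lemma copies_Suc:
  "L \<in> modules S \<Longrightarrow> A \<in> modules S \<Longrightarrow>
    isomorphic_modules S (copies (Suc n) L A) (direct_sum L (copies n L A))"
  by (simp add: direct_sum_list_Cons isomorphic_modules_assoc direct_sum_list_replicate_modules)

lemma is_summandI:
  "isomorphic_modules S N (direct_sum L N') \<Longrightarrow> N' \<in> modules S \<Longrightarrow> is_summand S L N"
  unfolding is_summand_def isomorphic_modules_def by blast

lemma is_summandE:
  assumes "is_summand S L N" "N \<in> modules S" "L \<in> modules S"
  obtains N' where "N' \<in> modules S" "isomorphic_modules S N (direct_sum L N')"
  using assms direct_sum_modules unfolding is_summand_def isomorphic_modules_def by metis

text \<open>Cancelling \<open>n\<close> copies of \<open>L\<close> on both sides leaves
  \<open>A\<close> on the left and at least one copy of \<open>L\<close> on the right.\<close>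

lemma copies_less_imp_is_summand:
  assumes L: "constant_module S L" "L \<in> modules S" and A: "A \<in> modules S" and B: "B \<in> modules S"
    and "isomorphic_modules S (copies n L A) (copies m L B)" "n < m"
  shows "is_summand S L A"
  using assms(5,6)
proof (induction n arbitrary: m)
  case 0
  then obtain m' where m: "m = Suc m'" by (cases m) auto
  have "isomorphic_modules S A (copies 0 L A)"
    by (rule isomorphic_modules_sym[OF copies_0[OF A]])
  also have "isomorphic_modules S \<dots> (copies m L B)"
    by (rule 0(1))
  also have "isomorphic_modules S \<dots> (direct_sum L (copies m' L B))"
    unfolding m by (rule copies_Suc[OF L(2) B])
  finally show ?case
    by (rule is_summandI[OF _ copies_modules[OF L(2) B]])
next
  case (Suc n)
  then obtain m' where m: "m = Suc m'" by (cases m) auto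
  have "isomorphic_modules S (direct_sum L (copies n L A)) (copies (Suc n) L A)"
    by (rule isomorphic_modules_sym[OF copies_Suc[OF L(2) A]])
  also have "isomorphic_modules S \<dots> (copies m L B)"
    by (rule Suc.prems(1))
  also have "isomorphic_modules S \<dots> (direct_sum L (copies m' L B))"
    unfolding m by (rule copies_Suc[OF L(2) B])
  finally have "module_iso S (copies n L A) (copies m' L B)"
    by (intro constant_module_cancel_left[OF L copies_modules[OF L(2) A] copies_modules[OF L(2) B]])
      (rule isomorphic_modulesD)
  then show ?case
    by (intro Suc.IH[of m'] isomorphic_modulesI copies_modules A B L) (use Suc.prems m in auto)
qed

text \<open>If the exponents differed, the side with the smaller one would have \<open>L\<close> as
  a summand of its remainder. This gives the definite descriptions \<open>dbar\<close> and
  \<open>multiplicity\<close> their values.\<close>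

lemma copies_unique:
  assumes L: "constant_module S L" "L \<in> modules S" and A: "A \<in> modules S" and B: "B \<in> modules S"
    and iso: "isomorphic_modules S (copies n L A) (copies m L B)"
    and "\<not> is_summand S L A" "\<not> is_summand S L B"
  shows "n = m"
  using copies_less_imp_is_summand[OF L A B iso]
    copies_less_imp_is_summand[OF L B A isomorphic_modules_sym[OF iso]] assms(6,7)
  by (metis nat_neq_iff)

text \<open>The given decomposition shows that the definite description is satisfied, and
  \<open>copies_unique\<close> that no other number satisfies it.\<close>

lemma dbar_eqI:
  assumes L: "constant_module S L" "L \<in> modules S" and C: "C \<in> modules S"
    and iso: "isomorphic_modules S N (copies m L C)" and nC: "\<not> is_summand S L C"
  shows "dbar S N L = m"
  unfolding dbar_def
proof (rule the_equality)
  show "\<exists>N'\<in>modules S. module_iso S N (copies m L N') \<and> \<not> is_summand S L N'"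
    using C isomorphic_modulesD(3)[OF iso] nC by blast
next
  fix n assume "\<exists>N'\<in>modules S. module_iso S N (copies n L N') \<and> \<not> is_summand S L N'"
  then obtain N' where N': "N' \<in> modules S" "module_iso S N (copies n L N')" "\<not> is_summand S L N'"
    by blast
  have "isomorphic_modules S (copies n L N') N"
    by (intro isomorphic_modulesI copies_modules L(2) N'(1) module_iso_sym[OF N'(2)]
        isomorphic_modulesD(1)[OF iso])
  from isomorphic_modules_trans[OF this iso] show "n = m"
    by (rule copies_unique[OF L N'(1) C _ N'(3) nC])
qed

section \<open>Retracts, and locality over a connected poset\<close>

text \<open>For a rank factorization \<open>e = X * Y\<close> the claim is \<open>Y * X = 1\<close>.
  From \<open>U * e * V = 1\<close> the square matrices \<open>U * X\<close> and
  \<open>Y * V\<close> are mutually inverse, which allows the outer factors of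
  \<open>X * (Y * X) * Y = X * Y\<close> to be cancelled.\<close>

lemma idempotent_mat_split:
  fixes e :: "'a::field mat"
  assumes e: "e \<in> carrier_mat n n" and ee: "e * e = e"
  shows "\<exists>r. \<exists>h\<in>carrier_mat n r. \<exists>k\<in>carrier_mat r n. h * k = e \<and> k * h = 1\<^sub>m r"
proof -
  define r where "r = mat_rank e"
  obtain X Y U V where X: "X \<in> carrier_mat n r" and Y: "Y \<in> carrier_mat r n"
    and U: "U \<in> carrier_mat r n" and V: "V \<in> carrier_mat n r"
    and XY: "e = X * Y" and UV: "U * e * V = 1\<^sub>m r"
    by (rule mat_rank_factorization[OF e r_def]) (rule that)
  note d = carrier_matD[OF X] carrier_matD[OF Y] carrier_matD[OF U] carrier_matD[OF V]
    index_mult_mat(2,3)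
  define P where "P = U * X"
  define R where "R = Y * V"
  have P: "P \<in> carrier_mat r r" and R: "R \<in> carrier_mat r r" and YX: "Y * X \<in> carrier_mat r r"
    unfolding P_def R_def using X Y U V by auto
  have PR: "P * R = 1\<^sub>m r"
    unfolding P_def R_def UV[symmetric] XY by (simp only: assoc_mult_mat_dim d)
  have RP: "R * P = 1\<^sub>m r"
    by (rule mat_mult_left_right_inverse[OF P R PR])
  have "P * (Y * X) * R = U * (e * e) * V"
    unfolding P_def R_def XY by (simp only: assoc_mult_mat_dim d)
  then have "P * (Y * X) * R = 1\<^sub>m r"
    unfolding ee UV .
  then have "R * (P * (Y * X) * R) * P = 1\<^sub>m r"
    using R RP by simp
  moreover have "R * (P * (Y * X) * R) * P = (R * P) * (Y * X) * (R * P)"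
    by (simp only: assoc_mult_mat_dim d carrier_matD[OF P] carrier_matD[OF R])
  ultimately have "Y * X = 1\<^sub>m r"
    unfolding RP left_mult_one_mat[OF YX] right_mult_one_mat[OF YX] by simp
  then show ?thesis
    using X Y XY by blast
qed

text \<open>Idempotents split: the complement of \<open>L\<close> is the image of the idempotent
  \<open>1 - f * g\<close>, realized on coordinate spaces by splitting its matrix at each
  point.\<close>

lemma is_summand_if_retract:
  fixes L X :: "('a, 'k::field) inc_module"
  assumes L: "L \<in> modules S" and X: "X \<in> modules S"
    and f: "f \<in> module_hom S L X" and g: "g \<in> module_hom S X L"
    and gf: "\<And>x. x \<in> Field S \<Longrightarrow> g x * f x = 1\<^sub>m (vdim L x)"
  shows "is_summand S L X"
proof -
  define e where "e x = 1\<^sub>m (vdim X x) - f x * g x" for x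
  have eh: "e \<in> module_hom S X X"
    unfolding e_def
    by (rule module_hom_diff[OF X X module_hom_id[OF X] module_hom_comp[OF X L X g f]])
  note fc = module_hom_carrier[OF f] and gc = module_hom_carrier[OF g]
    and ec = module_hom_carrier[OF eh]
  have ge: "g x * e x = 0\<^sub>m (vdim L x) (vdim X x)" if x: "x \<in> Field S" for x
  proof -
    note fg = mult_carrier_mat[OF fc[OF x] gc[OF x]]
    have "g x * e x = g x * 1\<^sub>m (vdim X x) - g x * f x * g x"
      unfolding e_def mult_minus_distrib_mat[OF gc[OF x] one_carrier_mat fg]
        assoc_mult_mat[OF gc[OF x] fc[OF x] gc[OF x]] ..
    then show ?thesis
      unfolding gf[OF x] left_mult_one_mat[OF gc[OF x]] right_mult_one_mat[OF gc[OF x]]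
      using minus_r_inv_mat[OF gc[OF x]] by simp
  qed
  have ef: "e x * f x = 0\<^sub>m (vdim X x) (vdim L x)" if x: "x \<in> Field S" for x
  proof -
    note fg = mult_carrier_mat[OF fc[OF x] gc[OF x]]
    have "e x * f x = 1\<^sub>m (vdim X x) * f x - f x * (g x * f x)"
      unfolding e_def minus_mult_distrib_mat[OF one_carrier_mat fg fc[OF x]]
        assoc_mult_mat[OF fc[OF x] gc[OF x] fc[OF x]] ..
    then show ?thesis
      unfolding gf[OF x] left_mult_one_mat[OF fc[OF x]] right_mult_one_mat[OF fc[OF x]]
      using minus_r_inv_mat[OF fc[OF x]] by simp
  qed
  have ee: "e x * e x = e x" if x: "x \<in> Field S" for x
  proof -
    note fg = mult_carrier_mat[OF fc[OF x] gc[OF x]]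
    have "e x * e x = (1\<^sub>m (vdim X x) - f x * g x) * e x"
      by (simp only: e_def)
    also have "\<dots> = 1\<^sub>m (vdim X x) * e x - f x * (g x * e x)"
      unfolding minus_mult_distrib_mat[OF one_carrier_mat fg ec[OF x]]
        assoc_mult_mat[OF fc[OF x] gc[OF x] ec[OF x]] ..
    also have "\<dots> = e x"
      unfolding ge[OF x] left_mult_one_mat[OF ec[OF x]] right_mult_zero_mat[OF fc[OF x]]
      using ec[OF x] by (intro eq_matI) auto
    finally show ?thesis .
  qed
  have "\<forall>x\<in>Field S. \<exists>r h k. h \<in> carrier_mat (vdim X x) r \<and> k \<in> carrier_mat r (vdim X x) \<and>
      h * k = e x \<and> k * h = 1\<^sub>m r"
    using idempotent_mat_split[OF ec ee] by blast
  then obtain r h k where hkr: "\<forall>x\<in>Field S. h x \<in> carrier_mat (vdim X x) (r x) \<and>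
      k x \<in> carrier_mat (r x) (vdim X x) \<and> h x * k x = e x \<and> k x * h x = 1\<^sub>m (r x)"
    by metis
  have hc: "h x \<in> carrier_mat (vdim X x) (r x)" and kc: "k x \<in> carrier_mat (r x) (vdim X x)"
    and hk: "h x * k x = e x" and kh: "k x * h x = 1\<^sub>m (r x)" if "x \<in> Field S" for x
    using bspec[OF hkr that] by simp_all
  have ehx: "e x * h x = h x" if x: "x \<in> Field S" for x
    unfolding hk[OF x, symmetric] assoc_mult_mat[OF hc[OF x] kc[OF x] hc[OF x]] kh[OF x]
    by (rule right_mult_one_mat[OF hc[OF x]])
  have ke: "k x * e x = k x" if x: "x \<in> Field S" for x
    unfolding hk[OF x, symmetric] assoc_mult_mat[OF kc[OF x] hc[OF x] kc[OF x], symmetric] kh[OF x]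
    by (rule left_mult_one_mat[OF kc[OF x]])
  \<comment> \<open>The splittings \<open>h\<close>, \<open>k\<close> are chosen independently at
    the points, so the action on the image of \<open>e\<close> must be conjugated into these
    coordinates. Naturality of \<open>e\<close> then makes \<open>h\<close> and \<open>k\<close>
    homomorphisms.\<close>
  define B :: "('a, 'k) inc_module" where
    "B = \<lparr>vdim = r, act = (\<lambda>y x c. k y * act X y x c * h x)\<rparr>"
  have vB: "vdim B = r" and aB: "act B y x c = k y * act X y x c * h x" for x y c
    by (simp_all add: B_def)
  have h_nat: "h y * (k y * act X y x c * h x) = act X y x c * h x"
    if xyc: "x \<in> Field S" "y \<in> Field S" "c \<in> inc_hom S x y" for x y and c :: 'k
  proof -
    note Xc = module_act_carrier[OF X xyc]
    have "h y * (k y * act X y x c * h x) = (h y * k y) * act X y x c * h x"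
      by (simp only: assoc_mult_mat_dim index_mult_mat(2,3) carrier_matD[OF hc[OF xyc(1)]]
          carrier_matD[OF hc[OF xyc(2)]] carrier_matD[OF kc[OF xyc(2)]] carrier_matD[OF Xc])
    also have "\<dots> = act X y x c * (e x * h x)"
      unfolding hk[OF xyc(2)] module_hom_natural[OF eh xyc]
      by (rule assoc_mult_mat[OF Xc ec[OF xyc(1)] hc[OF xyc(1)]])
    finally show ?thesis
      unfolding ehx[OF xyc(1)] .
  qed
  have B: "B \<in> modules S"
  proof (rule modulesI; unfold vB aB)
    fix x y and c :: 'k assume xyc: "x \<in> Field S" "y \<in> Field S" "c \<in> inc_hom S x y"
    note Xc = module_act_carrier[OF X xyc] and ky = kc[OF xyc(2)] and hx = hc[OF xyc(1)]
    show "k y * act X y x c * h x \<in> carrier_mat (r y) (r x)"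
      by (rule mult_carrier_mat[OF mult_carrier_mat[OF ky Xc] hx])
    show "k y * act X y x (a * c) * h x = a \<cdot>\<^sub>m (k y * act X y x c * h x)" for a
      unfolding module_act_smult[OF X xyc] mult_smult_distrib[OF ky Xc]
      by (rule mult_smult_assoc_mat[OF mult_carrier_mat[OF ky Xc] hx])
    fix c' :: 'k assume c': "c' \<in> inc_hom S x y"
    note Xc' = module_act_carrier[OF X xyc(1,2) c']
    show "k y * act X y x (c + c') * h x = k y * act X y x c * h x + k y * act X y x c' * h x"
      unfolding module_act_add[OF X xyc c'] mult_add_distrib_mat[OF ky Xc Xc']
      by (rule add_mult_distrib_mat[OF mult_carrier_mat[OF ky Xc] mult_carrier_mat[OF ky Xc'] hx])
  next
    fix x assume x: "x \<in> Field S"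
    show "k x * act X x x 1 * h x = 1\<^sub>m (r x)"
      unfolding module_act_one[OF X x] right_mult_one_mat[OF kc[OF x]] by (rule kh[OF x])
  next
    fix x y z and c d :: 'k
    assume x: "x \<in> Field S" and y: "y \<in> Field S" and z: "z \<in> Field S"
      and c: "c \<in> inc_hom S x y" and d: "d \<in> inc_hom S y z"
    note dims = carrier_matD[OF module_act_carrier[OF X x y c]]
      carrier_matD[OF module_act_carrier[OF X y z d]] carrier_matD[OF kc[OF y]]
      carrier_matD[OF kc[OF z]] carrier_matD[OF hc[OF x]] carrier_matD[OF hc[OF y]]
      index_mult_mat(2,3)
    have "k z * act X z y d * h y * (k y * act X y x c * h x) =
        k z * act X z y d * (h y * (k y * act X y x c * h x))"
      by (simp only: assoc_mult_mat_dim dims)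
    also have "\<dots> = k z * (act X z y d * act X y x c) * h x"
      unfolding h_nat[OF x y c] by (simp only: assoc_mult_mat_dim dims)
    finally show "k z * act X z x (d * c) * h x =
        k z * act X z y d * h y * (k y * act X y x c * h x)"
      unfolding module_act_comp[OF X x y c z d] by simp
  qed
  have hh: "h \<in> module_hom S B X"
    by (rule module_homI; unfold vB aB) (auto intro: hc h_nat)
  have kh': "k \<in> module_hom S X B"
  proof (rule module_homI; unfold vB aB)
    fix x y and c :: 'k assume xyc: "x \<in> Field S" "y \<in> Field S" "c \<in> inc_hom S x y"
    note Xc = module_act_carrier[OF X xyc] and ky = kc[OF xyc(2)] and hx = hc[OF xyc(1)]
      and kx = kc[OF xyc(1)]
    have "k y * act X y x c * h x * k x = k y * (act X y x c * (h x * k x))"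
      by (simp only: assoc_mult_mat_dim index_mult_mat(2,3) carrier_matD[OF Xc]
          carrier_matD[OF ky] carrier_matD[OF hx] carrier_matD[OF kx])
    also have "\<dots> = k y * e y * act X y x c"
      unfolding hk[OF xyc(1)] module_hom_natural[OF eh xyc, symmetric]
      by (rule assoc_mult_mat[OF ky ec[OF xyc(2)] Xc, symmetric])
    finally show "k y * act X y x c = k y * act X y x c * h x * k x"
      unfolding ke[OF xyc(2)] by simp
  qed (rule kc)
  have add_diff: "A + (1\<^sub>m n - A) = 1\<^sub>m n" if "A \<in> carrier_mat n n" for A :: "'k mat" and n
    using that by (intro eq_matI) auto
  have "biproduct S X L B f g h k"
    unfolding biproduct_def vB
  proof (intro conjI ballI f g hh kh' gf kh)
    fix x assume x: "x \<in> Field S"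
    have "g x * (e x * h x) = 0\<^sub>m (vdim L x) (r x)"
      unfolding assoc_mult_mat[OF gc[OF x] ec[OF x] hc[OF x], symmetric] ge[OF x]
      by (rule left_mult_zero_mat[OF hc[OF x]])
    then show "g x * h x = 0\<^sub>m (vdim L x) (r x)"
      unfolding ehx[OF x] .
    have "k x * e x * f x = 0\<^sub>m (r x) (vdim L x)"
      unfolding assoc_mult_mat[OF kc[OF x] ec[OF x] fc[OF x]] ef[OF x]
      by (rule right_mult_zero_mat[OF kc[OF x]])
    then show "k x * f x = 0\<^sub>m (r x) (vdim L x)"
      unfolding ke[OF x] .
    show "f x * g x + h x * k x = 1\<^sub>m (vdim X x)"
      unfolding hk[OF x] e_def by (rule add_diff[OF mult_carrier_mat[OF fc[OF x] gc[OF x]]])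
  qed
  then have "module_iso S X (direct_sum L B)"
    using module_iso_direct_sum_iff_biproduct[OF X L B] by metis
  then show ?thesis
    using B unfolding is_summand_def by metis
qed

text \<open>Naturality gives equality along each comparability, read in either direction, and hence
  along every path.\<close>

lemma constant_module_endo_connected:
  fixes L :: "('a, 'k::field) inc_module"
  assumes L: "constant_module S L" and S: "connected_poset S" and f: "f \<in> module_hom S L L"
    and "x \<in> Field S" "y \<in> Field S"
  shows "f x = f y"
proof -
  have "(x, y) \<in> (S \<union> S\<inverse>)\<^sup>*"
    using S assms(4,5) unfolding connected_poset_def by blast
  then show ?thesis
    by (induction rule: rtrancl_induct) (auto dest: constant_module_endo[OF L f])
qed

text \<open>By connectedness an endomorphism of \<open>L\<close> is a single scalar, so one that is
  nonzero at \<open>z\<close> is invertible everywhere. Rescaling \<open>g\<close> turns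
  \<open>f\<close> into a section.\<close>

lemma is_summand_if_nonzero_composite:
  fixes L X :: "('a, 'k::field) inc_module"
  assumes L: "constant_module S L" and S: "connected_poset S"
    and Lm: "L \<in> modules S" and X: "X \<in> modules S"
    and f: "f \<in> module_hom S L X" and g: "g \<in> module_hom S X L"
    and z: "z \<in> Field S" "(g z * f z) $$ (0, 0) \<noteq> 0"
  shows "is_summand S L X"
proof -
  define u where "u x = g x * f x" for x
  have u: "u \<in> module_hom S L L"
    unfolding u_def by (rule module_hom_comp[OF Lm X Lm f g])
  define a where "a = u z $$ (0, 0)"
  have a: "a \<noteq> 0"
    using z(2) by (simp add: a_def u_def)
  have ux: "u x = a \<cdot>\<^sub>m 1\<^sub>m 1" if x: "x \<in> Field S" for x
    using mat_1_1_eq[of "u x"] module_hom_carrier[OF u x]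
      constant_module_endo_connected[OF L S u x z(1)]
    by (simp add: constant_module_vdim[OF L x] a_def)
  define w where "w x = inverse a \<cdot>\<^sub>m (1\<^sub>m 1 :: 'k mat)" for x :: 'a
  have w: "w \<in> module_hom S L L"
    unfolding w_def by (rule constant_module_scalar_hom[OF L]) simp
  show ?thesis
  proof (rule is_summand_if_retract[OF Lm X f module_hom_comp[OF X Lm Lm g w]])
    fix x assume x: "x \<in> Field S"
    have "w x * g x * f x = w x * u x"
      unfolding u_def
      by (rule assoc_mult_mat[OF module_hom_carrier[OF w x] module_hom_carrier[OF g x]
            module_hom_carrier[OF f x]])
    also have "\<dots> = 1\<^sub>m 1"
      unfolding ux[OF x] w_def using a by (intro eq_matI) (auto simp: scalar_prod_def)
    finally show "w x * g x * f x = 1\<^sub>m (vdim L x)"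
      by (simp add: constant_module_vdim[OF L x])
  qed
qed

text \<open>Locality of the endomorphism ring: the identity of \<open>L\<close> is the sum of its
  composites through \<open>X\<close> and through \<open>Y\<close>, and these two scalars cannot
  both vanish.\<close>

lemma is_summand_direct_sumD:
  fixes L X Y :: "('a, 'k::field) inc_module"
  assumes L: "constant_module S L" and S: "connected_poset S"
    and Lm: "L \<in> modules S" and X: "X \<in> modules S" and Y: "Y \<in> modules S"
    and sum: "is_summand S L (direct_sum X Y)"
  shows "is_summand S L X \<or> is_summand S L Y"
proof -
  define N where "N = direct_sum X Y"
  have N: "N \<in> modules S"
    unfolding N_def by (rule direct_sum_modules[OF X Y])
  obtain i p j q where b: "biproduct S N X Y i p j q"
    using biproduct_direct_sum[OF X Y] unfolding N_def by metis
  obtain C where C: "C \<in> modules S" "isomorphic_modules S N (direct_sum L C)"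
    by (rule is_summandE[OF sum[folded N_def] N Lm])
  then obtain f g f' g' where c: "biproduct S N L C f g f' g'"
    using module_iso_direct_sum_iff_biproduct[OF N Lm C(1)] isomorphic_modulesD(3) by metis
  note bh = biproductD(1-4)[OF b] and ch = biproductD(1-4)[OF c]
  obtain z where z: "z \<in> Field S"
    using S unfolding connected_poset_def by blast
  note bc = biproduct_carrier[OF b z] and cc = biproduct_carrier[OF c z]
  have gi: "(\<lambda>x. g x * i x) \<in> module_hom S X L" and pf: "(\<lambda>x. p x * f x) \<in> module_hom S L X"
    and gj: "(\<lambda>x. g x * j x) \<in> module_hom S Y L" and qf: "(\<lambda>x. q x * f x) \<in> module_hom S L Y"
    using bh ch by (auto intro!: module_hom_comp[OF _ N] X Y Lm)
  have "(g z * i z) * (p z * f z) + (g z * j z) * (q z * f z) =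
      g z * (i z * p z + j z * q z) * f z"
    by (simp only: mult_add_distrib_mat_dim add_mult_distrib_mat_dim assoc_mult_mat_dim
        index_mult_mat(2,3) index_add_mat(2,3) bc[THEN carrier_matD(1)] bc[THEN carrier_matD(2)]
        cc[THEN carrier_matD(1)] cc[THEN carrier_matD(2)])
  also have "\<dots> = 1\<^sub>m 1"
    unfolding biproductD(9)[OF b z] right_mult_one_mat[OF cc(2)] biproductD(5)[OF c z]
      constant_module_vdim[OF L z] ..
  finally have "((g z * i z) * (p z * f z) + (g z * j z) * (q z * f z)) $$ (0, 0) = 1"
    by simp
  moreover have "(g z * j z) * (q z * f z) \<in> carrier_mat 1 1"
    using mult_carrier_mat[OF module_hom_carrier[OF gj z] module_hom_carrier[OF qf z]]
    by (simp only: constant_module_vdim[OF L z])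
  ultimately have "((g z * i z) * (p z * f z)) $$ (0, 0) + ((g z * j z) * (q z * f z)) $$ (0, 0) = 1"
    by (metis carrier_matD index_add_mat(1) less_numeral_extra(1))
  then have "((g z * i z) * (p z * f z)) $$ (0, 0) \<noteq> 0 \<or> ((g z * j z) * (q z * f z)) $$ (0, 0) \<noteq> 0"
    by (metis add_0 zero_neq_one)
  then show ?thesis
    using is_summand_if_nonzero_composite[OF L S Lm X pf gi z]
      is_summand_if_nonzero_composite[OF L S Lm Y qf gj z] by metis
qed

lemma not_is_summand_is_zero:
  assumes L: "constant_module S L" and Lm: "L \<in> modules S" and S: "connected_poset S"
    and Z: "Z \<in> modules S" "is_zero S Z"
  shows "\<not> is_summand S L Z"
proof
  assume "is_summand S L Z"
  then obtain C where "isomorphic_modules S Z (direct_sum L C)"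
    using is_summandE[OF _ Z(1) Lm] by metis
  moreover obtain z where z: "z \<in> Field S"
    using S unfolding connected_poset_def by blast
  ultimately have "vdim Z z = vdim L z + vdim C z"
    using module_iso_vdim[OF isomorphic_modulesD(3)] vdim_direct_sum by metis
  then show False
    using Z(2) z constant_module_vdim[OF L z] unfolding is_zero_def by auto
qed

lemma is_summand_direct_sum_listD:
  fixes L :: "('a, 'k::field) inc_module"
  assumes L: "constant_module S L" and S: "connected_poset S" and Lm: "L \<in> modules S"
    and "set Xs \<subseteq> modules S" "is_summand S L (direct_sum_list Xs)"
  shows "\<exists>X\<in>set Xs. is_summand S L X"
  using assms(4,5)
proof (induction Xs)
  case Nil
  then show ?case
    using not_is_summand_is_zero[OF L Lm S zero_module_modules is_zero_zero_module]
    by (simp add: direct_sum_list_Nil)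
next
  case (Cons X Xs)
  have "direct_sum_list Xs \<in> modules S" "X \<in> modules S"
    using Cons.prems(1) by (auto intro: direct_sum_list_modules)
  then have "is_summand S L X \<or> is_summand S L (direct_sum_list Xs)"
    using is_summand_direct_sumD[OF L S Lm, of X "direct_sum_list Xs"] Cons.prems(2)
    by (simp add: direct_sum_list_Cons)
  then show ?case
    using Cons by auto
qed

text \<open>A connected poset has a point, so \<open>L\<close> is nonzero and its complement in the
  indecomposable \<open>X\<close> must vanish.\<close>

lemma indecomposable_is_summandD:
  assumes L: "constant_module S L" and Lm: "L \<in> modules S" and S: "connected_poset S"
    and X: "indecomposable S X" and sum: "is_summand S L X"
  shows "module_iso S X L"
proof -
  have Xm: "X \<in> modules S"
    using X unfolding indecomposable_def by blast
  obtain C where C: "C \<in> modules S" "isomorphic_modules S X (direct_sum L C)"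
    by (rule is_summandE[OF sum Xm Lm])
  obtain z where z: "z \<in> Field S"
    using S unfolding connected_poset_def by blast
  have "\<not> is_zero S L"
    using z constant_module_vdim[OF L z] unfolding is_zero_def by (metis one_neq_zero)
  then have "is_zero S C"
    using X C Lm isomorphic_modulesD(3)[OF C(2)] unfolding indecomposable_def by blast
  from isomorphic_modules_trans[OF C(2) isomorphic_modules_zero_right[OF Lm C(1) this]]
  show ?thesis
    by (rule isomorphic_modulesD)
qed

section \<open>Indecomposable decompositions and multiplicities\<close>

text \<open>Induction on the total dimension, which drops in each proper splitting. Indecomposable
  modules are nonzero, so a zero module is the sum of the empty list.\<close>

lemma indecomposable_decomposition_exists:
  fixes N :: "('a, 'k::field) inc_module"
  assumes "finite (Field S)" "N \<in> modules S"
  shows "\<exists>Ns. (\<forall>X\<in>set Ns. indecomposable S X) \<and> isomorphic_modules S N (direct_sum_list Ns)"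
  using assms(2)
proof (induction "\<Sum>x\<in>Field S. vdim N x" arbitrary: N rule: less_induct)
  case less
  consider "is_zero S N" | "indecomposable S N" |
    A B where "A \<in> modules S" "B \<in> modules S" "module_iso S N (direct_sum A B)"
      "\<not> is_zero S A" "\<not> is_zero S B"
    using less.prems unfolding indecomposable_def by blast
  then show ?case
  proof cases
    case 1
    have "isomorphic_modules S N zero_module"
      using isomorphic_modules_zero_right[OF less.prems zero_module_modules is_zero_zero_module]
        isomorphic_modules_zero_left[OF less.prems zero_module_modules 1]
        isomorphic_modules_sym isomorphic_modules_trans by metis
    then show ?thesis
      by (intro exI[of _ "[]"]) (simp add: direct_sum_list_Nil)
  next
    case 2
    then show ?thesis
      using isomorphic_modules_sym[OF isomorphic_modules_zero_right[OF less.prems zero_module_modules is_zero_zero_module]]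
      by (intro exI[of _ "[N]"]) (simp add: direct_sum_list_Nil direct_sum_list_Cons)
  next
    case 3
    have vN: "vdim N x = vdim A x + vdim B x" if "x \<in> Field S" for x
      using module_iso_vdim[OF 3(3) that] by (simp add: vdim_direct_sum)
    have "(\<Sum>x\<in>Field S. vdim N x) = (\<Sum>x\<in>Field S. vdim A x) + (\<Sum>x\<in>Field S. vdim B x)"
      by (simp add: vN sum.distrib)
    moreover have "(\<Sum>x\<in>Field S. vdim X x) > 0" if "\<not> is_zero S X" for X :: "('a, 'k) inc_module"
      using that assms(1) unfolding is_zero_def by (metis sum_eq_0_iff gr0I)
    ultimately have lt: "(\<Sum>x\<in>Field S. vdim A x) < (\<Sum>x\<in>Field S. vdim N x)"
      "(\<Sum>x\<in>Field S. vdim B x) < (\<Sum>x\<in>Field S. vdim N x)"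
      using 3(4,5) by auto
    obtain As Bs where As: "\<forall>X\<in>set As. indecomposable S X" "isomorphic_modules S A (direct_sum_list As)"
      and Bs: "\<forall>X\<in>set Bs. indecomposable S X" "isomorphic_modules S B (direct_sum_list Bs)"
      using less.hyps[OF lt(1) 3(1)] less.hyps[OF lt(2) 3(2)] by metis
    have mods: "set As \<subseteq> modules S" "set Bs \<subseteq> modules S"
      using As(1) Bs(1) unfolding indecomposable_def by auto
    have "isomorphic_modules S N (direct_sum A B)"
      by (rule isomorphic_modulesI[OF less.prems direct_sum_modules[OF 3(1,2)] 3(3)])
    also have "isomorphic_modules S \<dots> (direct_sum (direct_sum_list As) (direct_sum_list Bs))"
      by (rule isomorphic_modules_direct_sum[OF As(2) Bs(2)])
    also have "isomorphic_modules S \<dots> (direct_sum_list (As @ Bs))"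
      by (rule isomorphic_modules_sym[OF direct_sum_list_append[OF mods]])
    finally show ?thesis
      using As(1) Bs(1) by (intro exI[of _ "As @ Bs"]) auto
  qed
qed

lemma direct_sum_list_partition:
  assumes Lm: "L \<in> modules S" and "set Xs \<subseteq> modules S"
  shows "isomorphic_modules S (direct_sum_list Xs)
    (copies (length (filter (\<lambda>X. module_iso S X L) Xs)) L
      (direct_sum_list (filter (\<lambda>X. \<not> module_iso S X L) Xs)))"
  using assms(2)
proof (induction Xs)
  case Nil
  show ?case
    using isomorphic_modules_sym[OF copies_0[OF zero_module_modules]]
    by (simp add: direct_sum_list_Nil)
next
  case (Cons X Xs)
  let ?n = "length (filter (\<lambda>X. module_iso S X L) Xs)"
  let ?R = "direct_sum_list (filter (\<lambda>X. \<not> module_iso S X L) Xs)"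
  have X: "X \<in> modules S" and R: "?R \<in> modules S"
    using Cons.prems by (auto intro!: direct_sum_list_modules)
  have IH: "isomorphic_modules S (direct_sum_list Xs) (copies ?n L ?R)"
    using Cons by simp
  show ?case
  proof (cases "module_iso S X L")
    case True
    have "isomorphic_modules S (direct_sum_list (X # Xs)) (direct_sum L (copies ?n L ?R))"
      unfolding direct_sum_list_Cons
      by (rule isomorphic_modules_direct_sum[OF isomorphic_modulesI[OF X Lm True] IH])
    also have "isomorphic_modules S \<dots> (copies (Suc ?n) L ?R)"
      by (rule isomorphic_modules_sym[OF copies_Suc[OF Lm R]])
    finally show ?thesis
      using True by simp
  next
    case False
    have "isomorphic_modules S (direct_sum_list (X # Xs)) (direct_sum X (copies ?n L ?R))"
      unfolding direct_sum_list_Cons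
      by (rule isomorphic_modules_direct_sum[OF isomorphic_modules_refl[OF X] IH])
    also have "isomorphic_modules S \<dots> (copies ?n L (direct_sum X ?R))"
      by (rule isomorphic_modules_left_commute[OF X direct_sum_list_replicate_modules[OF Lm] R])
    finally show ?thesis
      using False by (simp add: direct_sum_list_Cons)
  qed
qed

text \<open>Collect the members isomorphic to \<open>L\<close>. A summand \<open>L\<close> of the
  rest would, by locality, be a summand of one member, which would then be isomorphic to
  \<open>L\<close>. So every indecomposable decomposition has the form required by
  \<open>copies_unique\<close>, and all give the same count.\<close>

lemma multiplicity_decomposition:
  fixes L N :: "('a, 'k::field) inc_module"
  assumes fin: "finite (Field S)" and S: "connected_poset S"
    and L: "constant_module S L" and Lm: "L \<in> modules S" and N: "N \<in> modules S"
  obtains C where "C \<in> modules S" "isomorphic_modules S N (copies (multiplicity S N L) L C)"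
    "\<not> is_summand S L C"
proof -
  let ?n = "\<lambda>Ns. length (filter (\<lambda>X. module_iso S X L) Ns)"
  let ?C = "\<lambda>Ns. direct_sum_list (filter (\<lambda>X. \<not> module_iso S X L) Ns)"
  have dec: "?C Ns \<in> modules S \<and> isomorphic_modules S N (copies (?n Ns) L (?C Ns)) \<and>
      \<not> is_summand S L (?C Ns)"
    if Ns: "\<forall>X\<in>set Ns. indecomposable S X" "module_iso S N (direct_sum_list Ns)" for Ns
  proof (intro conjI)
    have mods: "set Ns \<subseteq> modules S"
      using Ns(1) unfolding indecomposable_def by blast
    then show "?C Ns \<in> modules S"
      by (intro direct_sum_list_modules) auto
    have "isomorphic_modules S N (direct_sum_list Ns)"
      using mods by (intro isomorphic_modulesI[OF N _ Ns(2)] direct_sum_list_modules) auto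
    from isomorphic_modules_trans[OF this direct_sum_list_partition[OF Lm mods]]
    show "isomorphic_modules S N (copies (?n Ns) L (?C Ns))" .
    show "\<not> is_summand S L (?C Ns)"
    proof
      assume "is_summand S L (?C Ns)"
      then obtain X where "X \<in> set Ns" "\<not> module_iso S X L" "is_summand S L X"
        using is_summand_direct_sum_listD[OF L S Lm, of "filter (\<lambda>X. \<not> module_iso S X L) Ns"] mods
        by auto
      then show False
        using indecomposable_is_summandD[OF L Lm S] Ns(1) by metis
    qed
  qed
  obtain Ns where Ns: "\<forall>X\<in>set Ns. indecomposable S X" "module_iso S N (direct_sum_list Ns)"
    using indecomposable_decomposition_exists[OF fin N] isomorphic_modulesD(3) by metis
  have "multiplicity S N L = ?n Ns"
    unfolding multiplicity_def
  proof (rule the_equality)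
    show "\<exists>Ns'. (\<forall>X\<in>set Ns'. indecomposable S X) \<and> module_iso S N (direct_sum_list Ns') \<and>
        ?n Ns = ?n Ns'"
      using Ns by metis
    fix m assume "\<exists>Ns'. (\<forall>X\<in>set Ns'. indecomposable S X) \<and> module_iso S N (direct_sum_list Ns') \<and>
        m = ?n Ns'"
    then obtain Ns' where Ns': "\<forall>X\<in>set Ns'. indecomposable S X"
      "module_iso S N (direct_sum_list Ns')" "m = ?n Ns'"
      by metis
    note d = dec[OF Ns] and d' = dec[OF Ns'(1,2)]
    show "m = ?n Ns"
      unfolding Ns'(3)
      by (rule copies_unique[OF L Lm d'[THEN conjunct1] d[THEN conjunct1]
            isomorphic_modules_trans[OF isomorphic_modules_sym[OF d'[THEN conjunct2, THEN conjunct1]]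
              d[THEN conjunct2, THEN conjunct1]]
            d'[THEN conjunct2, THEN conjunct2] d[THEN conjunct2, THEN conjunct2]])
  qed
  then show thesis
    using dec[OF Ns] that[of "?C Ns"] by simp
qed

text \<open>Compare with one copy of \<open>L\<close> plus the zero module. Indecomposability of
  \<open>L\<close> need not be quoted, as the count is an exponent of \<open>L\<close>.\<close>

lemma multiplicity_self:
  fixes L :: "('a, 'k::field) inc_module"
  assumes fin: "finite (Field S)" and S: "connected_poset S"
    and L: "constant_module S L" and Lm: "L \<in> modules S"
  shows "multiplicity S L L = 1"
proof -
  obtain C where C: "C \<in> modules S" "isomorphic_modules S L (copies (multiplicity S L L) L C)"
    "\<not> is_summand S L C"
    by (rule multiplicity_decomposition[OF fin S L Lm Lm])
  note z = zero_module_modules[of S]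
  have "isomorphic_modules S (copies 1 L zero_module) (direct_sum L (copies 0 L zero_module))"
    unfolding One_nat_def by (rule copies_Suc[OF Lm z])
  also have "isomorphic_modules S \<dots> (direct_sum L zero_module)"
    by (rule isomorphic_modules_direct_sum[OF isomorphic_modules_refl[OF Lm] copies_0[OF z]])
  also have "isomorphic_modules S \<dots> L"
    by (rule isomorphic_modules_zero_right[OF Lm z is_zero_zero_module])
  also have "isomorphic_modules S \<dots> (copies (multiplicity S L L) L C)"
    by (rule C(2))
  finally show ?thesis
    using copies_unique[OF L Lm z C(1) _ not_is_summand_is_zero[OF L Lm S z is_zero_zero_module] C(3)]
    by metis
qed


section \<open>Modules evaluated at morphisms of the additive hull\<close>

text \<open>For a homomorphism \<open>f\<close> this is the component at the object
  \<open>xs\<close> of its extension to the additive hull. Repeated points in \<open>xs\<close> give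
  repeated blocks.\<close>

primrec block_diag :: "('a \<Rightarrow> 'k::zero mat) \<Rightarrow> 'a list \<Rightarrow> 'k mat" where
  "block_diag f [] = 0\<^sub>m 0 0"
| "block_diag f (x # xs) = four_block_mat (f x) (0\<^sub>m (dim_row (f x)) (dim_col (block_diag f xs)))
    (0\<^sub>m (dim_row (block_diag f xs)) (dim_col (f x))) (block_diag f xs)"

lemma block_diag_carrier:
  "(\<And>x. x \<in> set xs \<Longrightarrow> f x \<in> carrier_mat (m x) (n x)) \<Longrightarrow>
    block_diag f xs \<in> carrier_mat (\<Sum>x\<leftarrow>xs. m x) (\<Sum>x\<leftarrow>xs. n x)"
  by (induction xs) auto

lemma block_diag_Cons:
  assumes "\<And>y. y \<in> set (x # xs) \<Longrightarrow> f y \<in> carrier_mat (m y) (n y)"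
  shows "block_diag f (x # xs) = four_block_mat (f x) (0\<^sub>m (m x) (\<Sum>x\<leftarrow>xs. n x))
    (0\<^sub>m (\<Sum>x\<leftarrow>xs. m x) (n x)) (block_diag f xs)"
proof -
  have "f x \<in> carrier_mat (m x) (n x)" "block_diag f xs \<in> carrier_mat (\<Sum>x\<leftarrow>xs. m x) (\<Sum>x\<leftarrow>xs. n x)"
    using assms block_diag_carrier[of xs f m n] by auto
  then show ?thesis by simp
qed

lemma block_diag_cong:
  "(\<And>x. x \<in> set xs \<Longrightarrow> f x = g x) \<Longrightarrow> block_diag f xs = block_diag g xs"
  by (induction xs) auto

lemma block_diag_append:
  "block_diag f (xs @ ys) = four_block_mat (block_diag f xs)
    (0\<^sub>m (dim_row (block_diag f xs)) (dim_col (block_diag f ys)))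
    (0\<^sub>m (dim_row (block_diag f ys)) (dim_col (block_diag f xs))) (block_diag f ys)"
proof (induction xs)
  case Nil
  show ?case by (rule eq_matI) auto
next
  case (Cons x xs)
  show ?case
    using assoc_four_block_mat[of "f x" "block_diag f xs" "block_diag f ys"]
    by (simp add: Cons)
qed

lemma block_diag_mult:
  fixes f g :: "'a \<Rightarrow> 'k::semiring_0 mat"
  assumes "\<And>x. x \<in> set xs \<Longrightarrow> f x \<in> carrier_mat (m x) (n x)"
    and "\<And>x. x \<in> set xs \<Longrightarrow> g x \<in> carrier_mat (n x) (k x)"
  shows "block_diag f xs * block_diag g xs = block_diag (\<lambda>x. f x * g x) xs"
  using assms
proof (induction xs)
  case Nil
  show ?case by (rule eq_matI) auto
next
  case (Cons x xs)
  have fx: "f x \<in> carrier_mat (m x) (n x)" and gx: "g x \<in> carrier_mat (n x) (k x)"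
    using Cons.prems by auto
  have F: "block_diag f xs \<in> carrier_mat (\<Sum>x\<leftarrow>xs. m x) (\<Sum>x\<leftarrow>xs. n x)"
    and G: "block_diag g xs \<in> carrier_mat (\<Sum>x\<leftarrow>xs. n x) (\<Sum>x\<leftarrow>xs. k x)"
    using Cons.prems by (auto intro!: block_diag_carrier)
  have FG: "block_diag (\<lambda>x. f x * g x) (x # xs) = four_block_mat (f x * g x)
      (0\<^sub>m (m x) (\<Sum>x\<leftarrow>xs. k x)) (0\<^sub>m (\<Sum>x\<leftarrow>xs. m x) (k x)) (block_diag (\<lambda>x. f x * g x) xs)"
    by (rule block_diag_Cons, rule mult_carrier_mat) (use Cons.prems in auto)
  have IH: "block_diag f xs * block_diag g xs = block_diag (\<lambda>x. f x * g x) xs"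
    using Cons by simp
  note F' = block_diag_Cons[where m = m and n = n and f = f and x = x and xs = xs, OF Cons.prems(1)]
    and G' = block_diag_Cons[where m = n and n = k and f = g and x = x and xs = xs, OF Cons.prems(2)]
  show ?case
    using mult_four_block_mat[OF fx zero_carrier_mat zero_carrier_mat F gx zero_carrier_mat zero_carrier_mat G]
      fx gx F G
    unfolding F' G' FG IH[symmetric] by simp
qed

lemma block_diag_add:
  fixes f g :: "'a \<Rightarrow> 'k::monoid_add mat"
  assumes "\<And>x. x \<in> set xs \<Longrightarrow> f x \<in> carrier_mat (m x) (n x)"
    and "\<And>x. x \<in> set xs \<Longrightarrow> g x \<in> carrier_mat (m x) (n x)"
  shows "block_diag f xs + block_diag g xs = block_diag (\<lambda>x. f x + g x) xs"
  using assms
proof (induction xs)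
  case Nil
  show ?case by (rule eq_matI) auto
next
  case (Cons x xs)
  have fx: "f x \<in> carrier_mat (m x) (n x)" and gx: "g x \<in> carrier_mat (m x) (n x)"
    using Cons.prems by auto
  have F: "block_diag f xs \<in> carrier_mat (\<Sum>x\<leftarrow>xs. m x) (\<Sum>x\<leftarrow>xs. n x)"
    and G: "block_diag g xs \<in> carrier_mat (\<Sum>x\<leftarrow>xs. m x) (\<Sum>x\<leftarrow>xs. n x)"
    using Cons.prems by (auto intro!: block_diag_carrier)
  have FG: "block_diag (\<lambda>x. f x + g x) (x # xs) = four_block_mat (f x + g x)
      (0\<^sub>m (m x) (\<Sum>x\<leftarrow>xs. n x)) (0\<^sub>m (\<Sum>x\<leftarrow>xs. m x) (n x)) (block_diag (\<lambda>x. f x + g x) xs)"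
    by (rule block_diag_Cons, rule add_carrier_mat) (use Cons.prems in auto)
  have IH: "block_diag f xs + block_diag g xs = block_diag (\<lambda>x. f x + g x) xs"
    using Cons by simp
  note F' = block_diag_Cons[where m = m and n = n and f = f and x = x and xs = xs, OF Cons.prems(1)]
    and G' = block_diag_Cons[where m = m and n = n and f = g and x = x and xs = xs, OF Cons.prems(2)]
  show ?case
    using add_four_block_mat[OF fx zero_carrier_mat zero_carrier_mat F gx zero_carrier_mat zero_carrier_mat G]
      fx gx F G
    unfolding F' G' FG IH[symmetric] by simp
qed

lemma block_diag_one: "block_diag (\<lambda>x. 1\<^sub>m (n x)) xs = 1\<^sub>m (\<Sum>x\<leftarrow>xs. n x)"
proof (induction xs)
  case (Cons x xs)
  then show ?case
    by (simp add: four_block_one_mat)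
qed (auto intro: eq_matI)

lemma block_diag_zero: "block_diag (\<lambda>x. 0\<^sub>m (m x) (n x)) xs = 0\<^sub>m (\<Sum>x\<leftarrow>xs. m x) (\<Sum>x\<leftarrow>xs. n x)"
  by (induction xs) simp_all

lemma block_diag_biproduct:
  fixes N A B :: "('a, 'k::field) inc_module"
  assumes b: "biproduct S N A B i p j q" and xs: "set xs \<subseteq> Field S"
  shows "block_diag p xs * block_diag i xs = 1\<^sub>m (\<Sum>x\<leftarrow>xs. vdim A x)"
    and "block_diag q xs * block_diag j xs = 1\<^sub>m (\<Sum>x\<leftarrow>xs. vdim B x)"
    and "block_diag p xs * block_diag j xs = 0\<^sub>m (\<Sum>x\<leftarrow>xs. vdim A x) (\<Sum>x\<leftarrow>xs. vdim B x)"
    and "block_diag q xs * block_diag i xs = 0\<^sub>m (\<Sum>x\<leftarrow>xs. vdim B x) (\<Sum>x\<leftarrow>xs. vdim A x)"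
    and "block_diag i xs * block_diag p xs + block_diag j xs * block_diag q xs =
      1\<^sub>m (\<Sum>x\<leftarrow>xs. vdim N x)"
proof -
  have F: "x \<in> Field S" if "x \<in> set xs" for x
    using xs that by blast
  note c = biproduct_carrier[OF b F] and d = biproductD(5-9)[OF b F]
  have pi: "block_diag p xs * block_diag i xs = block_diag (\<lambda>x. p x * i x) xs"
    and qj: "block_diag q xs * block_diag j xs = block_diag (\<lambda>x. q x * j x) xs"
    and pj: "block_diag p xs * block_diag j xs = block_diag (\<lambda>x. p x * j x) xs"
    and qi: "block_diag q xs * block_diag i xs = block_diag (\<lambda>x. q x * i x) xs"
    and ip: "block_diag i xs * block_diag p xs = block_diag (\<lambda>x. i x * p x) xs"
    and jq: "block_diag j xs * block_diag q xs = block_diag (\<lambda>x. j x * q x) xs"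
    by (rule block_diag_mult; erule c)+
  show "block_diag p xs * block_diag i xs = 1\<^sub>m (\<Sum>x\<leftarrow>xs. vdim A x)"
    unfolding pi by (rule trans[OF block_diag_cong block_diag_one]) (erule d(1))
  show "block_diag q xs * block_diag j xs = 1\<^sub>m (\<Sum>x\<leftarrow>xs. vdim B x)"
    unfolding qj by (rule trans[OF block_diag_cong block_diag_one]) (erule d(2))
  show "block_diag p xs * block_diag j xs = 0\<^sub>m (\<Sum>x\<leftarrow>xs. vdim A x) (\<Sum>x\<leftarrow>xs. vdim B x)"
    unfolding pj by (rule trans[OF block_diag_cong block_diag_zero]) (erule d(3))
  show "block_diag q xs * block_diag i xs = 0\<^sub>m (\<Sum>x\<leftarrow>xs. vdim B x) (\<Sum>x\<leftarrow>xs. vdim A x)"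
    unfolding qi by (rule trans[OF block_diag_cong block_diag_zero]) (erule d(4))
  have "block_diag (\<lambda>x. i x * p x) xs + block_diag (\<lambda>x. j x * q x) xs =
      block_diag (\<lambda>x. i x * p x + j x * q x) xs"
    by (rule block_diag_add[where m = "vdim N" and n = "vdim N"])
      (auto intro!: mult_carrier_mat c)
  then show "block_diag i xs * block_diag p xs + block_diag j xs * block_diag q xs =
      1\<^sub>m (\<Sum>x\<leftarrow>xs. vdim N x)"
    unfolding ip jq by (elim ssubst, intro trans[OF block_diag_cong block_diag_one]) (erule d(5))
qed

section \<open>Naturality of evaluation at morphisms of the additive hull\<close>

lemma foldr_append_cols_carrier:
  assumes "\<And>i. i < length xs \<Longrightarrow> R i \<in> carrier_mat m (n (xs ! i))"
  shows "foldr append_cols (map R [0..<length xs]) (0\<^sub>m m 0) \<in> carrier_mat m (\<Sum>x\<leftarrow>xs. n x)"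
  using assms
proof (induction xs arbitrary: R)
  case (Cons x xs)
  have "foldr append_cols (map (\<lambda>i. R (Suc i)) [0..<length xs]) (0\<^sub>m m 0) \<in> carrier_mat m (\<Sum>x\<leftarrow>xs. n x)"
    by (rule Cons.IH) (use Cons.prems[of "Suc _"] in simp)
  then show ?case
    using append_cols_carrier[OF Cons.prems[of 0]] by (simp del: upt_Suc add: map_upt_Suc)
qed simp

lemma foldr_append_rows_carrier:
  assumes "\<And>j. j < length ys \<Longrightarrow> R j \<in> carrier_mat (m (ys ! j)) n"
  shows "foldr append_rows (map R [0..<length ys]) (0\<^sub>m 0 n) \<in> carrier_mat (\<Sum>y\<leftarrow>ys. m y) n"
  using assms
proof (induction ys arbitrary: R)
  case (Cons y ys)
  have "foldr append_rows (map (\<lambda>j. R (Suc j)) [0..<length ys]) (0\<^sub>m 0 n) \<in> carrier_mat (\<Sum>y\<leftarrow>ys. m y) n"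
    by (rule Cons.IH) (use Cons.prems[of "Suc _"] in simp)
  then show ?case
    using carrier_append_rows[OF Cons.prems[of 0]] by (simp del: upt_Suc add: map_upt_Suc)
qed simp

text \<open>One block row of the naturality square. The blocks are functions of the position, so
  dropping the head of \<open>xs\<close> shifts them; they are therefore arbitrary in the
  induction.\<close>

lemma foldr_append_cols_natural:
  fixes f :: "'a \<Rightarrow> 'k::semiring_1 mat"
  assumes F: "F \<in> carrier_mat m' m"
    and "\<And>x. x \<in> set xs \<Longrightarrow> f x \<in> carrier_mat (n' x) (n x)"
    and "\<And>i. i < length xs \<Longrightarrow> R i \<in> carrier_mat m (n (xs ! i))"
    and "\<And>i. i < length xs \<Longrightarrow> R' i \<in> carrier_mat m' (n' (xs ! i))"
    and "\<And>i. i < length xs \<Longrightarrow> R' i * f (xs ! i) = F * R i"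
  shows "foldr append_cols (map R' [0..<length xs]) (0\<^sub>m m' 0) * block_diag f xs =
    F * foldr append_cols (map R [0..<length xs]) (0\<^sub>m m 0)"
  using assms(2-)
proof (induction xs arbitrary: R R')
  case Nil
  show ?case using F by (intro eq_matI) auto
next
  case (Cons x xs)
  define T where "T = foldr append_cols (map (\<lambda>i. R (Suc i)) [0..<length xs]) (0\<^sub>m m 0)"
  define T' where "T' = foldr append_cols (map (\<lambda>i. R' (Suc i)) [0..<length xs]) (0\<^sub>m m' 0)"
  have T: "T \<in> carrier_mat m (\<Sum>x\<leftarrow>xs. n x)"
    unfolding T_def by (rule foldr_append_cols_carrier) (use Cons.prems(2)[of "Suc _"] in simp)
  have T': "T' \<in> carrier_mat m' (\<Sum>x\<leftarrow>xs. n' x)"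
    unfolding T'_def by (rule foldr_append_cols_carrier) (use Cons.prems(3)[of "Suc _"] in simp)
  have fx: "f x \<in> carrier_mat (n' x) (n x)" and R: "R 0 \<in> carrier_mat m (n x)"
    and R': "R' 0 \<in> carrier_mat m' (n' x)" and RR: "R' 0 * f x = F * R 0"
    using Cons.prems(1) Cons.prems(2-4)[of 0] by auto
  have D: "block_diag f xs \<in> carrier_mat (\<Sum>x\<leftarrow>xs. n' x) (\<Sum>x\<leftarrow>xs. n x)"
    using Cons.prems(1) by (auto intro!: block_diag_carrier)
  have IH: "T' * block_diag f xs = F * T"
    unfolding T_def T'_def
    by (rule Cons.IH) (use Cons.prems(1) Cons.prems(2-4)[of "Suc _"] in auto)
  have "append_cols (R' 0) T' * block_diag f (x # xs) = append_cols (R' 0 * f x) (T' * block_diag f xs)"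
    using append_cols_mult_four_block[OF R' T' fx zero_carrier_mat zero_carrier_mat D] R' T' fx D
    unfolding block_diag_Cons[where m = n' and n = n and f = f and x = x and xs = xs, OF Cons.prems(1)]
    by simp
  also have "\<dots> = F * append_cols (R 0) T"
    unfolding RR IH mult_append_cols[OF R T F] ..
  finally show ?case
    by (simp del: upt_Suc block_diag.simps add: map_upt_Suc T_def T'_def)
qed

lemma foldr_append_rows_natural:
  fixes f :: "'a \<Rightarrow> 'k::semiring_1 mat"
  assumes G: "G \<in> carrier_mat n' n"
    and "\<And>y. y \<in> set ys \<Longrightarrow> f y \<in> carrier_mat (m' y) (m y)"
    and "\<And>j. j < length ys \<Longrightarrow> R j \<in> carrier_mat (m (ys ! j)) n"
    and "\<And>j. j < length ys \<Longrightarrow> R' j \<in> carrier_mat (m' (ys ! j)) n'"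
    and "\<And>j. j < length ys \<Longrightarrow> R' j * G = f (ys ! j) * R j"
  shows "foldr append_rows (map R' [0..<length ys]) (0\<^sub>m 0 n') * G =
    block_diag f ys * foldr append_rows (map R [0..<length ys]) (0\<^sub>m 0 n)"
  using assms(2-)
proof (induction ys arbitrary: R R')
  case Nil
  show ?case using G by (intro eq_matI) auto
next
  case (Cons y ys)
  define T where "T = foldr append_rows (map (\<lambda>j. R (Suc j)) [0..<length ys]) (0\<^sub>m 0 n)"
  define T' where "T' = foldr append_rows (map (\<lambda>j. R' (Suc j)) [0..<length ys]) (0\<^sub>m 0 n')"
  have T: "T \<in> carrier_mat (\<Sum>y\<leftarrow>ys. m y) n"
    unfolding T_def by (rule foldr_append_rows_carrier) (use Cons.prems(2)[of "Suc _"] in simp)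
  have T': "T' \<in> carrier_mat (\<Sum>y\<leftarrow>ys. m' y) n'"
    unfolding T'_def by (rule foldr_append_rows_carrier) (use Cons.prems(3)[of "Suc _"] in simp)
  have fy: "f y \<in> carrier_mat (m' y) (m y)" and R: "R 0 \<in> carrier_mat (m y) n"
    and R': "R' 0 \<in> carrier_mat (m' y) n'" and RR: "R' 0 * G = f y * R 0"
    using Cons.prems(1) Cons.prems(2-4)[of 0] by auto
  have D: "block_diag f ys \<in> carrier_mat (\<Sum>y\<leftarrow>ys. m' y) (\<Sum>y\<leftarrow>ys. m y)"
    using Cons.prems(1) by (auto intro!: block_diag_carrier)
  have IH: "T' * G = block_diag f ys * T"
    unfolding T_def T'_def
    by (rule Cons.IH) (use Cons.prems(1) Cons.prems(2-4)[of "Suc _"] in auto)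
  have "(R' 0 @\<^sub>r T') * G = f y * R 0 @\<^sub>r block_diag f ys * T"
    unfolding append_rows_mult[OF R' T' G] RR IH ..
  also have "\<dots> = block_diag f (y # ys) * (R 0 @\<^sub>r T)"
    using four_block_mult_append_rows[OF fy zero_carrier_mat zero_carrier_mat D R T] R T fy D
    unfolding block_diag_Cons[where m = m' and n = m and f = f and x = y and xs = ys, OF Cons.prems(1)]
    by simp
  finally show ?case
    by (simp del: upt_Suc block_diag.simps add: map_upt_Suc T_def T'_def)
qed

lemma hull_homD:
  assumes "A \<in> hull_hom S xs ys"
  shows "A \<in> carrier_mat (length ys) (length xs)"
    and "i < length xs \<Longrightarrow> j < length ys \<Longrightarrow> A $$ (j, i) \<in> inc_hom S (xs ! i) (ys ! j)"
  using assms unfolding hull_hom_def by auto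

lemma block_row_carrier:
  fixes W :: "('a, 'k::field) inc_module"
  assumes W: "W \<in> modules S" and xs: "set xs \<subseteq> Field S" and ys: "set ys \<subseteq> Field S"
    and A: "A \<in> hull_hom S xs ys" and j: "j < length ys"
  shows "block_row W xs ys A j \<in> carrier_mat (vdim W (ys ! j)) (\<Sum>x\<leftarrow>xs. vdim W x)"
  unfolding block_row_def
proof (rule foldr_append_cols_carrier)
  fix i assume i: "i < length xs"
  show "act W (ys ! j) (xs ! i) (A $$ (j, i)) \<in> carrier_mat (vdim W (ys ! j)) (vdim W (xs ! i))"
    by (rule module_act_carrier[OF W _ _ hull_homD(2)[OF A i j]]) (use i j xs ys nth_mem in blast)+
qed

lemma hull_eval_carrier:
  fixes W :: "('a, 'k::field) inc_module"
  assumes "W \<in> modules S" "set xs \<subseteq> Field S" "set ys \<subseteq> Field S" "A \<in> hull_hom S xs ys"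
  shows "hull_eval W xs ys A \<in> carrier_mat (\<Sum>y\<leftarrow>ys. vdim W y) (\<Sum>x\<leftarrow>xs. vdim W x)"
  unfolding hull_eval_def by (rule foldr_append_rows_carrier) (rule block_row_carrier[OF assms])

text \<open>A natural map of modules extends to the additive hull: the entrywise naturality squares
  are assembled into block rows, and these into the whole matrix.\<close>

lemma hull_eval_natural:
  fixes M N :: "('a, 'k::field) inc_module"
  assumes M: "M \<in> modules S" and N: "N \<in> modules S" and f: "f \<in> module_hom S M N"
    and xs: "set xs \<subseteq> Field S" and ys: "set ys \<subseteq> Field S" and A: "A \<in> hull_hom S xs ys"
  shows "hull_eval N xs ys A * block_diag f xs = block_diag f ys * hull_eval M xs ys A"
proof -
  have fx: "f x \<in> carrier_mat (vdim N x) (vdim M x)" if "x \<in> Field S" for x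
    by (rule module_hom_carrier[OF f that])
  show ?thesis
    unfolding hull_eval_def
  proof (rule foldr_append_rows_natural)
    show "block_diag f xs \<in> carrier_mat (\<Sum>x\<leftarrow>xs. vdim N x) (\<Sum>x\<leftarrow>xs. vdim M x)"
      by (rule block_diag_carrier) (use fx xs in blast)
    fix j assume j: "j < length ys"
    then have yj: "ys ! j \<in> Field S"
      using ys nth_mem by blast
    show "block_row M xs ys A j \<in> carrier_mat (vdim M (ys ! j)) (\<Sum>x\<leftarrow>xs. vdim M x)"
      "block_row N xs ys A j \<in> carrier_mat (vdim N (ys ! j)) (\<Sum>x\<leftarrow>xs. vdim N x)"
      by (rule block_row_carrier[OF M xs ys A j] block_row_carrier[OF N xs ys A j])+
    show "block_row N xs ys A j * block_diag f xs = f (ys ! j) * block_row M xs ys A j"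
      unfolding block_row_def
    proof (rule foldr_append_cols_natural[OF fx[OF yj]])
      fix i assume i: "i < length xs"
      then have xi: "xs ! i \<in> Field S"
        using xs nth_mem by blast
      note c = hull_homD(2)[OF A i j]
      show "act M (ys ! j) (xs ! i) (A $$ (j, i)) \<in> carrier_mat (vdim M (ys ! j)) (vdim M (xs ! i))"
        "act N (ys ! j) (xs ! i) (A $$ (j, i)) \<in> carrier_mat (vdim N (ys ! j)) (vdim N (xs ! i))"
        by (rule module_act_carrier[OF M xi yj c] module_act_carrier[OF N xi yj c])+
      show "act N (ys ! j) (xs ! i) (A $$ (j, i)) * f (xs ! i) =
          f (ys ! j) * act M (ys ! j) (xs ! i) (A $$ (j, i))"
        by (rule module_hom_natural[OF f xi yj c, symmetric])
    qed (use fx xs in blast)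
  qed (use fx ys in blast)
qed

section \<open>Additivity of ranks under biproducts\<close>

text \<open>\<open>TN\<close> and the diagonal matrix of \<open>TA\<close> and \<open>TB\<close>
  arise from each other by multiplication on both sides, so each rank bounds the other. The index
  \<open>X\<close> marks maps at the source, \<open>Y\<close> maps at the target.\<close>

lemma mat_rank_biproduct:
  fixes TN TA TB :: "'k::field mat"
  assumes TN: "TN \<in> carrier_mat rN cN" and TA: "TA \<in> carrier_mat rA cA" and TB: "TB \<in> carrier_mat rB cB"
    and iX: "iX \<in> carrier_mat cN cA" and pX: "pX \<in> carrier_mat cA cN"
    and jX: "jX \<in> carrier_mat cN cB" and qX: "qX \<in> carrier_mat cB cN"
    and iY: "iY \<in> carrier_mat rN rA" and pY: "pY \<in> carrier_mat rA rN"
    and jY: "jY \<in> carrier_mat rN rB" and qY: "qY \<in> carrier_mat rB rN"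
    and X: "iX * pX + jX * qX = 1\<^sub>m cN"
    and Y: "pY * iY = 1\<^sub>m rA" "qY * jY = 1\<^sub>m rB" "pY * jY = 0\<^sub>m rA rB" "qY * iY = 0\<^sub>m rB rA"
    and i: "TN * iX = iY * TA" and j: "TN * jX = jY * TB"
  shows "mat_rank TN = mat_rank TA + mat_rank TB"
proof -
  let ?D = "four_block_mat TA (0\<^sub>m rA cB) (0\<^sub>m rB cA) TB"
  have D: "?D \<in> carrier_mat (rA + rB) (cA + cB)"
    by (rule four_block_carrier_mat[OF TA TB])
  note d = carrier_matD[OF TN] carrier_matD[OF TA] carrier_matD[OF TB] carrier_matD[OF iX]
    carrier_matD[OF pX] carrier_matD[OF jX] carrier_matD[OF qX] carrier_matD[OF iY]
    carrier_matD[OF pY] carrier_matD[OF jY] carrier_matD[OF qY] index_mult_mat(2,3)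
  have iTA: "iY * TA \<in> carrier_mat rN cA" and jTB: "jY * TB \<in> carrier_mat rN cB"
    by (rule mult_carrier_mat[OF iY TA] mult_carrier_mat[OF jY TB])+
  have "pY * (iY * TA) = TA" "qY * (jY * TB) = TB" "pY * (jY * TB) = 0\<^sub>m rA cB"
    "qY * (iY * TA) = 0\<^sub>m rB cA"
    unfolding assoc_mult_mat[OF pY iY TA, symmetric] assoc_mult_mat[OF qY jY TB, symmetric]
      assoc_mult_mat[OF pY jY TB, symmetric] assoc_mult_mat[OF qY iY TA, symmetric] Y
    using TA TB by simp_all
  then have "(pY @\<^sub>r qY) * append_cols (iY * TA) (jY * TB) = ?D"
    unfolding append_rows_mult_append_cols[OF pY qY iTA jTB] by simp
  then have "(pY @\<^sub>r qY) * (TN * append_cols iX jX) = ?D"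
    unfolding mult_append_cols[OF iX jX TN] i j .
  then have 1: "(pY @\<^sub>r qY) * TN * append_cols iX jX = ?D"
    unfolding assoc_mult_mat[OF carrier_append_rows[OF pY qY] TN append_cols_carrier[OF iX jX]] .
  have "append_cols iY jY * ?D = append_cols (iY * TA) (jY * TB)"
    unfolding append_cols_mult_four_block[OF iY jY TA zero_carrier_mat zero_carrier_mat TB]
    using iY jY iTA jTB by simp
  then have "append_cols iY jY * ?D * (pX @\<^sub>r qX) = iY * TA * pX + jY * TB * qX"
    using append_cols_mult_append_rows[OF iTA jTB pX qX] by simp
  also have "\<dots> = TN * (iX * pX + jX * qX)"
    unfolding i[symmetric] j[symmetric]
    by (simp only: mult_add_distrib_mat_dim assoc_mult_mat_dim d)
  also have "\<dots> = TN"
    unfolding X by (rule right_mult_one_mat[OF TN])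
  finally have 2: "append_cols iY jY * ?D * (pX @\<^sub>r qX) = TN" .
  have "mat_rank ?D \<le> mat_rank TN"
    using mat_rank_mult_le[OF TN carrier_append_rows[OF pY qY] append_cols_carrier[OF iX jX]]
    unfolding 1 .
  moreover have "mat_rank TN \<le> mat_rank ?D"
    using mat_rank_mult_le[OF D append_cols_carrier[OF iY jY] carrier_append_rows[OF pX qX]]
    unfolding 2 .
  ultimately show ?thesis
    using mat_rank_four_block_diag[OF TA TB] by simp
qed


section \<open>The rank difference and restrictions\<close>

text \<open>In coordinates the blocks of \<open>A\<close> and \<open>B\<close> alternate along the
  lists. The block diagonal inclusions and projections at \<open>xs\<close> and \<open>ys\<close> do
  the reordering, and \<open>hull_eval_natural\<close> supplies the intertwining equations.\<close>

lemma mat_rank_hull_eval_biproduct: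
  fixes N A B :: "('a, 'k::field) inc_module"
  assumes N: "N \<in> modules S" and A: "A \<in> modules S" and B: "B \<in> modules S"
    and b: "biproduct S N A B i p j q"
    and xs: "set xs \<subseteq> Field S" and ys: "set ys \<subseteq> Field S" and G: "G \<in> hull_hom S xs ys"
  shows "mat_rank (hull_eval N xs ys G) = mat_rank (hull_eval A xs ys G) + mat_rank (hull_eval B xs ys G)"
proof -
  have Fx: "x \<in> Field S" if "x \<in> set xs" for x using xs that by blast
  have Fy: "x \<in> Field S" if "x \<in> set ys" for x using ys that by blast
  note cx = biproduct_carrier[OF b Fx, THEN block_diag_carrier]
    and cy = biproduct_carrier[OF b Fy, THEN block_diag_carrier]
  show ?thesis
    by (rule mat_rank_biproduct[OF hull_eval_carrier[OF N xs ys G] hull_eval_carrier[OF A xs ys G]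
          hull_eval_carrier[OF B xs ys G] cx cy block_diag_biproduct(5)[OF b xs]
          block_diag_biproduct(1-4)[OF b ys] hull_eval_natural[OF A N biproductD(1)[OF b] xs ys G]
          hull_eval_natural[OF B N biproductD(3)[OF b] xs ys G]])
qed

text \<open>The zero block takes its size from the evaluated blocks, exactly as in
  \<open>multiplicity_matrix\<close>, so that unfolding makes the two expressions coincide.\<close>

definition hull_eval_lower ::
  "('a, 'k::field) inc_module \<Rightarrow> 'a list \<Rightarrow> 'a list \<Rightarrow> 'a list \<Rightarrow> 'a list \<Rightarrow>
    'k mat \<Rightarrow> 'k mat \<Rightarrow> 'k mat \<Rightarrow> 'k mat" where
  "hull_eval_lower W xs1 xs2 ys1 ys2 G1 G2 G3 =
    (let W1 = hull_eval W xs1 ys1 G1; W2 = hull_eval W xs2 ys2 G2; W3 = hull_eval W xs1 ys2 G3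
     in four_block_mat W1 (0\<^sub>m (dim_row W1) (dim_col W2)) W3 W2)"

lemma hull_eval_lower_eq:
  fixes W :: "('a, 'k::field) inc_module"
  assumes "W \<in> modules S" "set xs1 \<subseteq> Field S" "set ys1 \<subseteq> Field S" "set xs2 \<subseteq> Field S" "set ys2 \<subseteq> Field S"
    "G1 \<in> hull_hom S xs1 ys1" "G2 \<in> hull_hom S xs2 ys2"
  shows "hull_eval_lower W xs1 xs2 ys1 ys2 G1 G2 G3 =
    four_block_mat (hull_eval W xs1 ys1 G1) (0\<^sub>m (\<Sum>y\<leftarrow>ys1. vdim W y) (\<Sum>x\<leftarrow>xs2. vdim W x))
      (hull_eval W xs1 ys2 G3) (hull_eval W xs2 ys2 G2)"
  unfolding hull_eval_lower_def Let_def
    carrier_matD(1)[OF hull_eval_carrier[OF assms(1-3,6)]]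
    carrier_matD(2)[OF hull_eval_carrier[OF assms(1,4,5,7)]] ..

lemma hull_eval_lower_natural:
  fixes M N :: "('a, 'k::field) inc_module"
  assumes M: "M \<in> modules S" and N: "N \<in> modules S" and f: "f \<in> module_hom S M N"
    and xs1: "set xs1 \<subseteq> Field S" and ys1: "set ys1 \<subseteq> Field S"
    and xs2: "set xs2 \<subseteq> Field S" and ys2: "set ys2 \<subseteq> Field S"
    and G1: "G1 \<in> hull_hom S xs1 ys1" and G2: "G2 \<in> hull_hom S xs2 ys2" and G3: "G3 \<in> hull_hom S xs1 ys2"
  shows "hull_eval_lower N xs1 xs2 ys1 ys2 G1 G2 G3 * block_diag f (xs1 @ xs2) =
    block_diag f (ys1 @ ys2) * hull_eval_lower M xs1 xs2 ys1 ys2 G1 G2 G3"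
proof -
  have bd: "block_diag f us \<in> carrier_mat (\<Sum>x\<leftarrow>us. vdim N x) (\<Sum>x\<leftarrow>us. vdim M x)"
    if "set us \<subseteq> Field S" for us
    by (rule block_diag_carrier, rule module_hom_carrier[OF f]) (use that in blast)
  note b = bd[OF xs1] bd[OF xs2] bd[OF ys1] bd[OF ys2]
  note NC = hull_eval_carrier[OF N xs1 ys1 G1] hull_eval_carrier[OF N xs1 ys2 G3] hull_eval_carrier[OF N xs2 ys2 G2]
  note MC = hull_eval_carrier[OF M xs1 ys1 G1] hull_eval_carrier[OF M xs1 ys2 G3] hull_eval_carrier[OF M xs2 ys2 G2]
  note lower = hull_eval_lower_eq[OF _ xs1 ys1 xs2 ys2 G1 G2]
  have X: "block_diag f (xs1 @ xs2) = four_block_mat (block_diag f xs1)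
      (0\<^sub>m (\<Sum>x\<leftarrow>xs1. vdim N x) (\<Sum>x\<leftarrow>xs2. vdim M x)) (0\<^sub>m (\<Sum>x\<leftarrow>xs2. vdim N x) (\<Sum>x\<leftarrow>xs1. vdim M x))
      (block_diag f xs2)"
    unfolding block_diag_append carrier_matD[OF b(1)] carrier_matD[OF b(2)] ..
  have Y: "block_diag f (ys1 @ ys2) = four_block_mat (block_diag f ys1)
      (0\<^sub>m (\<Sum>x\<leftarrow>ys1. vdim N x) (\<Sum>x\<leftarrow>ys2. vdim M x)) (0\<^sub>m (\<Sum>x\<leftarrow>ys2. vdim N x) (\<Sum>x\<leftarrow>ys1. vdim M x))
      (block_diag f ys2)"
    unfolding block_diag_append carrier_matD[OF b(3)] carrier_matD[OF b(4)] ..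
  note nat = hull_eval_natural[OF M N f xs1 ys1 G1] hull_eval_natural[OF M N f xs1 ys2 G3]
    hull_eval_natural[OF M N f xs2 ys2 G2]
  show ?thesis
    using mult_four_block_mat[OF NC(1) zero_carrier_mat NC(2,3) b(1) zero_carrier_mat zero_carrier_mat b(2)]
      mult_four_block_mat[OF b(3) zero_carrier_mat zero_carrier_mat b(4) MC(1) zero_carrier_mat MC(2,3)]
      NC MC b
    unfolding lower[OF N] lower[OF M] X Y nat by simp
qed

lemma mat_rank_hull_eval_lower_biproduct:
  fixes N A B :: "('a, 'k::field) inc_module"
  assumes N: "N \<in> modules S" and A: "A \<in> modules S" and B: "B \<in> modules S"
    and b: "biproduct S N A B i p j q"
    and xs1: "set xs1 \<subseteq> Field S" and ys1: "set ys1 \<subseteq> Field S"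
    and xs2: "set xs2 \<subseteq> Field S" and ys2: "set ys2 \<subseteq> Field S"
    and G1: "G1 \<in> hull_hom S xs1 ys1" and G2: "G2 \<in> hull_hom S xs2 ys2" and G3: "G3 \<in> hull_hom S xs1 ys2"
  shows "mat_rank (hull_eval_lower N xs1 xs2 ys1 ys2 G1 G2 G3) =
    mat_rank (hull_eval_lower A xs1 xs2 ys1 ys2 G1 G2 G3) +
    mat_rank (hull_eval_lower B xs1 xs2 ys1 ys2 G1 G2 G3)"
proof -
  have xs: "set (xs1 @ xs2) \<subseteq> Field S" and ys: "set (ys1 @ ys2) \<subseteq> Field S"
    using xs1 xs2 ys1 ys2 by auto
  have Fx: "x \<in> Field S" if "x \<in> set (xs1 @ xs2)" for x using xs that by blast
  have Fy: "x \<in> Field S" if "x \<in> set (ys1 @ ys2)" for x using ys that by blast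
  note cx = biproduct_carrier[OF b Fx, THEN block_diag_carrier]
    and cy = biproduct_carrier[OF b Fy, THEN block_diag_carrier]
  have car: "hull_eval_lower W xs1 xs2 ys1 ys2 G1 G2 G3 \<in>
      carrier_mat (\<Sum>y\<leftarrow>ys1 @ ys2. vdim W y) (\<Sum>x\<leftarrow>xs1 @ xs2. vdim W x)"
    if W: "W \<in> modules S" for W :: "('a, 'k) inc_module"
    using four_block_carrier_mat[OF hull_eval_carrier[OF W xs1 ys1 G1] hull_eval_carrier[OF W xs2 ys2 G2]]
    unfolding hull_eval_lower_eq[OF W xs1 ys1 xs2 ys2 G1 G2] by simp
  show ?thesis
    by (rule mat_rank_biproduct[OF car[OF N] car[OF A] car[OF B] cx cy block_diag_biproduct(5)[OF b xs]
          block_diag_biproduct(1-4)[OF b ys]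
          hull_eval_lower_natural[OF A N biproductD(1)[OF b] xs1 ys1 xs2 ys2 G1 G2 G3]
          hull_eval_lower_natural[OF B N biproductD(3)[OF b] xs1 ys1 xs2 ys2 G1 G2 G3]])
qed

text \<open>The rank of the diagonal matrix in \<open>multiplicity_matrix\<close> is already written
  as a sum of two ranks. Integer values make additivity a plain equation, without truncated
  subtraction.\<close>

definition rank_excess ::
  "('a, 'k::field) inc_module \<Rightarrow> 'a list \<Rightarrow> 'a list \<Rightarrow> 'a list \<Rightarrow> 'a list \<Rightarrow>
    'k mat \<Rightarrow> 'k mat \<Rightarrow> 'k mat \<Rightarrow> int" where
  "rank_excess W xs1 xs2 ys1 ys2 G1 G2 G3 =
    int (mat_rank (hull_eval_lower W xs1 xs2 ys1 ys2 G1 G2 G3)) -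
    int (mat_rank (hull_eval W xs1 ys1 G1) + mat_rank (hull_eval W xs2 ys2 G2))"

lemma rank_excess_direct_sum:
  fixes N A B :: "('a, 'k::field) inc_module"
  assumes iso: "isomorphic_modules S N (direct_sum A B)" and A: "A \<in> modules S" and B: "B \<in> modules S"
    and xs1: "set xs1 \<subseteq> Field S" and ys1: "set ys1 \<subseteq> Field S"
    and xs2: "set xs2 \<subseteq> Field S" and ys2: "set ys2 \<subseteq> Field S"
    and G1: "G1 \<in> hull_hom S xs1 ys1" and G2: "G2 \<in> hull_hom S xs2 ys2" and G3: "G3 \<in> hull_hom S xs1 ys2"
  shows "rank_excess N xs1 xs2 ys1 ys2 G1 G2 G3 =
    rank_excess A xs1 xs2 ys1 ys2 G1 G2 G3 + rank_excess B xs1 xs2 ys1 ys2 G1 G2 G3"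
proof -
  note N = isomorphic_modulesD(1)[OF iso]
  obtain i p j q where b: "biproduct S N A B i p j q"
    using module_iso_direct_sum_iff_biproduct[OF N A B] isomorphic_modulesD(3)[OF iso] by metis
  show ?thesis
    unfolding rank_excess_def
    using mat_rank_hull_eval_lower_biproduct[OF N A B b xs1 ys1 xs2 ys2 G1 G2 G3]
      mat_rank_hull_eval_biproduct[OF N A B b xs1 ys1 G1]
      mat_rank_hull_eval_biproduct[OF N A B b xs2 ys2 G2]
    by simp
qed

lemma rank_excess_nonneg:
  fixes W :: "('a, 'k::field) inc_module"
  assumes W: "W \<in> modules S"
    and xs1: "set xs1 \<subseteq> Field S" and ys1: "set ys1 \<subseteq> Field S"
    and xs2: "set xs2 \<subseteq> Field S" and ys2: "set ys2 \<subseteq> Field S"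
    and G1: "G1 \<in> hull_hom S xs1 ys1" and G2: "G2 \<in> hull_hom S xs2 ys2" and G3: "G3 \<in> hull_hom S xs1 ys2"
  shows "0 \<le> rank_excess W xs1 xs2 ys1 ys2 G1 G2 G3"
  using mat_rank_four_block_ge[OF hull_eval_carrier[OF W xs1 ys1 G1] hull_eval_carrier[OF W xs2 ys2 G2]
      hull_eval_carrier[OF W xs1 ys2 G3]]
  unfolding rank_excess_def hull_eval_lower_eq[OF W xs1 ys1 xs2 ys2 G1 G2] by simp

lemma rank_excess_copies:
  fixes N L C :: "('a, 'k::field) inc_module"
  assumes L: "L \<in> modules S" and C: "C \<in> modules S"
    and xs1: "set xs1 \<subseteq> Field S" and ys1: "set ys1 \<subseteq> Field S"
    and xs2: "set xs2 \<subseteq> Field S" and ys2: "set ys2 \<subseteq> Field S"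
    and G1: "G1 \<in> hull_hom S xs1 ys1" and G2: "G2 \<in> hull_hom S xs2 ys2" and G3: "G3 \<in> hull_hom S xs1 ys2"
    and "isomorphic_modules S N (copies n L C)"
  shows "rank_excess N xs1 xs2 ys1 ys2 G1 G2 G3 =
    int n * rank_excess L xs1 xs2 ys1 ys2 G1 G2 G3 + rank_excess C xs1 xs2 ys1 ys2 G1 G2 G3"
proof -
  note add = rank_excess_direct_sum[OF _ _ _ xs1 ys1 xs2 ys2 G1 G2 G3]
  let ?d = "\<lambda>W. rank_excess W xs1 xs2 ys1 ys2 G1 G2 G3"
  \<comment> \<open>The zero module is the direct sum of two copies of itself, so additivity forces
    the value 0.\<close>
  have z: "?d zero_module = 0"
    using add[OF isomorphic_modules_sym[OF isomorphic_modules_zero_left[OF zero_module_modules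
            zero_module_modules is_zero_zero_module]] zero_module_modules zero_module_modules] by simp
  note copies = direct_sum_list_replicate_modules[OF L]
  have "?d (direct_sum_list (replicate n L)) = int n * ?d L"
  proof (induction n)
    case (Suc n)
    have "?d (direct_sum_list (replicate (Suc n) L)) = ?d L + ?d (direct_sum_list (replicate n L))"
      by (rule add[OF _ L copies])
        (use isomorphic_modules_refl[OF copies[of "Suc n"]] in \<open>simp add: direct_sum_list_Cons\<close>)
    then show ?case
      unfolding Suc by (simp add: algebra_simps)
  qed (simp add: direct_sum_list_Nil z)
  then show ?thesis
    using add[OF assms(10) copies C] by simp
qed

section \<open>Restriction along order-preserving maps\<close>

lemma compat_Field: "compat Z S f \<Longrightarrow> x \<in> Field Z \<Longrightarrow> f x \<in> Field S"
  unfolding compat_def Field_def by blast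

lemma compat_inc_hom: "compat Z S f \<Longrightarrow> c \<in> inc_hom Z x y \<Longrightarrow> c \<in> inc_hom S (f x) (f y)"
  unfolding compat_def inc_hom_def by (auto split: if_splits)

lemma restriction_simps:
  "vdim (restriction f M) x = vdim M (f x)"
  "act (restriction f M) y x c = act M (f y) (f x) c"
  unfolding restriction_def by simp_all

lemma restriction_modules:
  fixes M :: "('a, 'k::field) inc_module"
  assumes f: "compat Z S f" and M: "M \<in> modules S"
  shows "restriction f M \<in> modules Z"
  by (rule modulesI; unfold restriction_simps;
      (rule module_act_carrier[OF M] module_act_add[OF M] module_act_smult[OF M]
        module_act_one[OF M] module_act_comp[OF M]);
      (rule compat_Field[OF f] compat_inc_hom[OF f]); assumption)

lemma restriction_isomorphic:
  fixes M N :: "('a, 'k::field) inc_module"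
  assumes f: "compat Z S f" and iso: "isomorphic_modules S M N"
  shows "isomorphic_modules Z (restriction f M) (restriction f N)"
proof (rule isomorphic_modulesI)
  show "restriction f M \<in> modules Z" "restriction f N \<in> modules Z"
    using restriction_modules[OF f] isomorphic_modulesD[OF iso] by auto
  obtain g h where g: "g \<in> module_hom S M N" and h: "h \<in> module_hom S N M"
    and hg: "\<And>x. x \<in> Field S \<Longrightarrow> h x * g x = 1\<^sub>m (vdim M x)"
    and gh: "\<And>x. x \<in> Field S \<Longrightarrow> g x * h x = 1\<^sub>m (vdim N x)"
    using isomorphic_modulesD(3)[OF iso] by (rule module_isoE) (blast intro: that)
  have hom: "(\<lambda>x. g (f x)) \<in> module_hom Z (restriction f M) (restriction f N)"
    if "g \<in> module_hom S M N" for g and M N :: "('a, 'k) inc_module"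
    by (rule module_homI; unfold restriction_simps;
        (rule module_hom_carrier[OF that] module_hom_natural[OF that]);
        (rule compat_Field[OF f] compat_inc_hom[OF f]); assumption)
  show "module_iso Z (restriction f M) (restriction f N)"
    by (rule module_isoI[OF hom[OF g] hom[OF h]]) (simp_all add: restriction_simps hg gh compat_Field[OF f])
qed

lemma restriction_direct_sum:
  "restriction f (direct_sum A B) = direct_sum (restriction f A) (restriction f B)"
  unfolding restriction_def direct_sum_def by simp

lemma restriction_zero_module: "restriction f zero_module = zero_module"
  unfolding restriction_def zero_module_def by simp

lemma restriction_copies: "restriction f (copies n L C) = copies n (restriction f L) (restriction f C)"
proof -
  have "restriction f (direct_sum_list (replicate n L)) = direct_sum_list (replicate n (restriction f L))"
    by (induction n)
      (simp_all add: direct_sum_list_Nil direct_sum_list_Cons restriction_zero_module restriction_direct_sum)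
  then show ?thesis
    by (simp add: restriction_direct_sum)
qed

text \<open>The factorization of \<open>f\<close> holds only on \<open>Field Z\<close>, so the two
  restrictions may differ as records and are merely isomorphic.\<close>

lemma restriction_eq_comp:
  fixes M :: "('a, 'k::field) inc_module"
  assumes "\<And>z. z \<in> Field Z \<Longrightarrow> f z = g (h z)"
    and "restriction f M \<in> modules Z" "restriction h (restriction g M) \<in> modules Z"
  shows "isomorphic_modules Z (restriction f M) (restriction h (restriction g M))"
  by (rule isomorphic_modulesI[OF assms(2,3) module_iso_if_eq[OF assms(2,3)]])
    (simp_all add: restriction_simps assms(1))

text \<open>The functor induced by \<open>h\<close> keeps all scalars, so the same matrix
  \<open>A\<close> is evaluated over either poset. This is how a covered morphism has its ranks
  computed over \<open>Z\<close>.\<close>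

lemma hull_eval_restriction:
  assumes "\<And>z. z \<in> set xs \<union> set ys \<Longrightarrow> f z = g (h z)"
  shows "hull_eval (restriction f M) xs ys A = hull_eval (restriction g M) (map h xs) (map h ys) A"
proof -
  have "block_row (restriction f M) xs ys A j = block_row (restriction g M) (map h xs) (map h ys) A j"
    if j: "j < length ys" for j
  proof -
    have y: "f (ys ! j) = g (h (ys ! j))"
      by (rule assms) (use j in simp)
    have x: "f (xs ! i) = g (h (xs ! i))" if "i < length xs" for i
      by (rule assms) (use that in simp)
    have cells: "map (\<lambda>i. act (restriction f M) (ys ! j) (xs ! i) (A $$ (j, i))) [0..<length xs] =
        map (\<lambda>i. act (restriction g M) (map h ys ! j) (map h xs ! i) (A $$ (j, i))) [0..<length (map h xs)]"
      using j by (auto simp: restriction_simps x y)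
    have "vdim (restriction f M) (ys ! j) = vdim (restriction g M) (map h ys ! j)"
      using j y by (simp add: restriction_simps)
    then show ?thesis
      unfolding block_row_def cells by (rule arg_cong)
  qed
  moreover have "(\<Sum>x\<leftarrow>xs. vdim (restriction f M) x) = (\<Sum>x\<leftarrow>map h xs. vdim (restriction g M) x)"
    using assms by (auto simp: restriction_simps intro!: arg_cong[of _ _ sum_list])
  ultimately show ?thesis
    unfolding hull_eval_def by (auto intro!: arg_cong2[of _ _ _ _ "foldr append_rows"])
qed

section \<open>Interval modules and the blocks of a covered morphism\<close>

text \<open>Replaces the case distinction by one formula for admissible scalars: if \<open>x\<close>
  is not below \<open>y\<close>, then \<open>c\<close> is 0 and the constant matrix is the zero
  matrix.\<close>

lemma interval_module_act:
  fixes c :: "'k::field"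
  assumes "c \<in> inc_hom P x y"
  shows "act (interval_module P I) y x c =
    mat (if y \<in> I then 1 else 0) (if x \<in> I then 1 else 0) (\<lambda>_. c)"
  using assms unfolding interval_module_def inc_hom_def by (intro eq_matI) (auto split: if_splits)

lemma vdim_interval_module: "vdim (interval_module P I) x = (if x \<in> I then 1 else 0)"
  unfolding interval_module_def by simp

lemma interval_module_modules:
  assumes P: "Partial_order P" and I: "convex_in P I"
  shows "(interval_module P I :: ('p, 'k::field) inc_module) \<in> modules P"
proof -
  have refl: "(x, x) \<in> P" if "x \<in> Field P" for x
    using P that unfolding partial_order_on_def preorder_on_def refl_on_def by blast
  have trans: "(x, z) \<in> P" if "(x, y) \<in> P" "(y, z) \<in> P" for x y z
    using P that unfolding partial_order_on_def preorder_on_def by (blast dest: transD)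
  show ?thesis
  proof (rule modulesI)
    fix x assume x: "x \<in> Field P"
    show "act (interval_module P I) x x (1::'k) = 1\<^sub>m (vdim (interval_module P I :: ('p, 'k) inc_module) x)"
      using refl[OF x] by (subst interval_module_act)
        (auto simp: inc_hom_def vdim_interval_module intro!: eq_matI)
  next
    fix x y and c :: 'k assume x: "x \<in> Field P" and y: "y \<in> Field P" and c: "c \<in> inc_hom P x y"
    show "act (interval_module P I) y x c \<in>
        carrier_mat (vdim (interval_module P I :: ('p, 'k) inc_module) y) (vdim (interval_module P I :: ('p, 'k) inc_module) x)"
      unfolding interval_module_act[OF c] vdim_interval_module by simp
    have ac: "a * c \<in> inc_hom P x y" for a
      using c by (auto simp: inc_hom_def split: if_splits)
    show "act (interval_module P I) y x (a * c) = a \<cdot>\<^sub>m act (interval_module P I) y x c" for a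
      unfolding interval_module_act[OF c] interval_module_act[OF ac] by (intro eq_matI) auto
    show "act (interval_module P I) y x (c + c') =
        act (interval_module P I) y x c + act (interval_module P I) y x c'"
      if c': "c' \<in> inc_hom P x y" for c'
    proof -
      have cc: "c + c' \<in> inc_hom P x y"
        using c c' by (auto simp: inc_hom_def split: if_splits)
      show ?thesis
        unfolding interval_module_act[OF c] interval_module_act[OF c'] interval_module_act[OF cc]
        by (intro eq_matI) auto
    qed
  next
    fix x y z and c d :: 'k assume "x \<in> Field P" "y \<in> Field P" "z \<in> Field P"
      and c: "c \<in> inc_hom P x y" and d: "d \<in> inc_hom P y z"
    have dc: "d * c \<in> inc_hom P x z"
      using c d trans by (auto simp: inc_hom_def split: if_splits)
    \<comment> \<open>The point where convexity enters: a composite through \<open>y\<close> outside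
      \<open>I\<close> would be lost on the right-hand side, but then one of the two scalars is
      0.\<close>
    have zero: "d * c = 0" if "x \<in> I" "z \<in> I" "y \<notin> I"
    proof -
      have "(x, y) \<notin> P \<or> (y, z) \<notin> P"
        using I that unfolding convex_in_def by blast
      then show ?thesis
        using c d by (auto simp: inc_hom_def)
    qed
    show "act (interval_module P I) z x (d * c) =
        act (interval_module P I) z y d * act (interval_module P I) y x c"
      unfolding interval_module_act[OF c] interval_module_act[OF d] interval_module_act[OF dc]
      using zero by (intro eq_matI) (auto simp: scalar_prod_def split: if_splits)
  qed
qed

text \<open>Inside \<open>I\<close> every basis morphism acts as the identity, so a map with values
  in \<open>I\<close> sees nothing else. This serves both \<open>\<xi> I\<close> and
  \<zeta>.\<close>

lemma restriction_interval_module_constant: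
  assumes f: "compat S P f" and I: "f ` Field S \<subseteq> I"
  shows "constant_module S (restriction f (interval_module P I) :: ('a, 'k::field) inc_module)"
  unfolding constant_module_def restriction_simps
proof (intro conjI ballI)
  fix x assume "x \<in> Field S"
  then show "vdim (interval_module P I :: ('b, 'k) inc_module) (f x) = 1"
    using I by (auto simp: vdim_interval_module)
next
  fix x y and c :: 'k assume "x \<in> Field S" "y \<in> Field S" and c: "c \<in> inc_hom S x y"
  then have "f x \<in> I" "f y \<in> I"
    using I by auto
  then show "act (interval_module P I) (f y) (f x) c = c \<cdot>\<^sub>m 1\<^sub>m 1"
    unfolding interval_module_act[OF compat_inc_hom[OF f c]] by (intro eq_matI) auto
qed

text \<open>Mapping preserves the length and order of lists, so the lifted lists split at the same
  places. Each nontrivial block then inherits its lifting condition from the entries of the whole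
  matrix.\<close>

lemma covers_four_blockE:
  fixes G1 G2 G3 :: "'k::field mat"
  assumes cov: "covers Z h (xs1 @ xs2, ys1 @ ys2, four_block_mat G1 (0\<^sub>m (length ys1) (length xs2)) G3 G2)"
    and G1: "G1 \<in> carrier_mat (length ys1) (length xs1)" and G2: "G2 \<in> carrier_mat (length ys2) (length xs2)"
    and G3: "G3 \<in> carrier_mat (length ys2) (length xs1)"
  obtains xs1' xs2' ys1' ys2' where
    "xs1 = map h xs1'" "xs2 = map h xs2'" "ys1 = map h ys1'" "ys2 = map h ys2'"
    "set xs1' \<subseteq> Field Z" "set ys1' \<subseteq> Field Z" "set xs2' \<subseteq> Field Z" "set ys2' \<subseteq> Field Z"
    "G1 \<in> hull_hom Z xs1' ys1'" "G2 \<in> hull_hom Z xs2' ys2'" "G3 \<in> hull_hom Z xs1' ys2'"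
proof -
  let ?A = "four_block_mat G1 (0\<^sub>m (length ys1) (length xs2)) G3 G2"
  obtain xs ys where arrow: "(xs, ys, ?A) \<in> hull_arrows Z"
    and maps: "map h xs = xs1 @ xs2" "map h ys = ys1 @ ys2"
    using cov unfolding covers_def hull_map_def by auto
  obtain xs1' xs2' where xs: "xs = xs1' @ xs2'" "map h xs1' = xs1" "map h xs2' = xs2"
    using maps(1) by (auto simp: map_eq_append_conv)
  obtain ys1' ys2' where ys: "ys = ys1' @ ys2'" "map h ys1' = ys1" "map h ys2' = ys2"
    using maps(2) by (auto simp: map_eq_append_conv)
  have Field: "set xs \<subseteq> Field Z" "set ys \<subseteq> Field Z" and A: "?A \<in> hull_hom Z xs ys"
    using arrow unfolding hull_arrows_def by auto
  have l: "length xs1 = length xs1'" "length xs2 = length xs2'"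
    "length ys1 = length ys1'" "length ys2 = length ys2'"
    using xs ys by auto
  have entry: "?A $$ (j, i) \<in> inc_hom Z (xs ! i) (ys ! j)" if "i < length xs" "j < length ys" for i j
    using hull_homD(2)[OF A that] .
  have "G1 \<in> hull_hom Z xs1' ys1'"
    unfolding hull_hom_def
  proof (intro CollectI conjI allI impI)
    fix i j assume "i < length xs1'" "j < length ys1'"
    then show "G1 $$ (j, i) \<in> inc_hom Z (xs1' ! i) (ys1' ! j)"
      using entry[of i j] G1 G2 l by (simp add: xs(1) ys(1) nth_append)
  qed (use G1 l in simp)
  moreover have "G3 \<in> hull_hom Z xs1' ys2'"
    unfolding hull_hom_def
  proof (intro CollectI conjI allI impI)
    fix i j assume "i < length xs1'" "j < length ys2'"
    then show "G3 $$ (j, i) \<in> inc_hom Z (xs1' ! i) (ys2' ! j)"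
      using entry[of i "length ys1' + j"] G1 G2 l by (simp add: xs(1) ys(1) nth_append)
  qed (use G3 l in simp)
  moreover have "G2 \<in> hull_hom Z xs2' ys2'"
    unfolding hull_hom_def
  proof (intro CollectI conjI allI impI)
    fix i j assume "i < length xs2'" "j < length ys2'"
    then show "G2 $$ (j, i) \<in> inc_hom Z (xs2' ! i) (ys2' ! j)"
      using entry[of "length xs1' + i" "length ys1' + j"] G1 G2 l by (simp add: xs(1) ys(1) nth_append)
  qed (use G2 l in simp)
  ultimately show thesis
    using that[of xs1' xs2' ys1' ys2'] xs ys Field by auto
qed

theorem mainTheorem3:
  fixes P :: "'p rel" and Q :: "'p set \<Rightarrow> 'q rel" and \<xi> :: "'p set \<Rightarrow> 'q \<Rightarrow> 'p"
    and I :: "'p set" and Z :: "'z rel" and \<zeta> :: "'z \<Rightarrow> 'p"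
    and M :: "('p, 'k::field) inc_module"
  assumes "Partial_order P" and "finite (Field P)"
    and "compression_system P Q \<xi>"
    and "I \<in> intervals P"
    and "Partial_order Z" and "compat Z P \<zeta>"
    and "essentially_covers TYPE('k) P Q \<xi> I Z \<zeta>"
    and "M \<in> modules P"
  shows "compression_mult P Q \<xi> I M = dbar Z (restriction \<zeta> M) (restriction \<zeta> (interval_module P I))"
proof -
  define V :: "('p, 'k) inc_module" where "V = interval_module P I"
  define L\<^sub>0 where "L\<^sub>0 = restriction (\<xi> I) V"
  define L where "L = restriction \<zeta> V"
  define m where "m = compression_mult P Q \<xi> I M"
  have fin: "finite (Field (Q I))" and conn: "connected_poset (Q I)"
    and \<xi>: "compat (Q I) P (\<xi> I)" and img: "\<xi> I ` Field (Q I) \<subseteq> I"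
    using assms(3,4) unfolding compression_system_def by auto
  have V: "V \<in> modules P"
    unfolding V_def by (rule interval_module_modules[OF assms(1)]) (use assms(4) in \<open>simp add: intervals_def\<close>)
  have L\<^sub>0: "constant_module (Q I) L\<^sub>0" "L\<^sub>0 \<in> modules (Q I)"
    unfolding L\<^sub>0_def V_def
    by (rule restriction_interval_module_constant[OF \<xi> img] restriction_modules[OF \<xi> V[unfolded V_def]])+
  obtain \<zeta>' g where \<zeta>': "compat Z (Q I) \<zeta>'" and comp: "\<And>z. z \<in> Field Z \<Longrightarrow> \<zeta> z = \<xi> I (\<zeta>' z)"
    and g: "multiplicity_matrix P Q \<xi> I (g :: ('q, 'k) hull_arrow)" and cov: "covers Z \<zeta>' g"
    using assms(7) unfolding essentially_covers_def by auto
  have imgZ: "\<zeta> ` Field Z \<subseteq> I"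
    using img compat_Field[OF \<zeta>'] comp by auto
  have L: "constant_module Z L" "L \<in> modules Z"
    unfolding L_def V_def
    by (rule restriction_interval_module_constant[OF assms(6) imgZ]
        restriction_modules[OF assms(6) V[unfolded V_def]])+
  obtain xs1 xs2 ys1 ys2 G1 G2 G3 where G: "G1 \<in> hull_hom (Q I) xs1 ys1"
      "G2 \<in> hull_hom (Q I) xs2 ys2" "G3 \<in> hull_hom (Q I) xs1 ys2"
    and g_eq: "g = (xs1 @ xs2, ys1 @ ys2,
      four_block_mat G1 (0\<^sub>m (length ys1) (length xs2)) G3 G2)"
    and mult: "\<forall>M\<in>modules P.
           let W = restriction (\<xi> I) M;
               W\<^sub>1 = hull_eval W xs1 ys1 G1;
               W\<^sub>2 = hull_eval W xs2 ys2 G2;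
               W\<^sub>3 = hull_eval W xs1 ys2 G3
           in int (compression_mult P Q \<xi> I M) =
              int (mat_rank (four_block_mat W\<^sub>1 (0\<^sub>m (dim_row W\<^sub>1) (dim_col W\<^sub>2)) W\<^sub>3 W\<^sub>2)) -
              int (mat_rank (four_block_mat W\<^sub>1 (0\<^sub>m (dim_row W\<^sub>1) (dim_col W\<^sub>2))
                                            (0\<^sub>m (dim_row W\<^sub>2) (dim_col W\<^sub>1)) W\<^sub>2))"
    using g unfolding multiplicity_matrix_def by (elim conjE exE bexE) (rule that)
  obtain xs1' xs2' ys1' ys2' where
    lists: "xs1 = map \<zeta>' xs1'" "xs2 = map \<zeta>' xs2'" "ys1 = map \<zeta>' ys1'" "ys2 = map \<zeta>' ys2'"
    and F: "set xs1' \<subseteq> Field Z" "set ys1' \<subseteq> Field Z" "set xs2' \<subseteq> Field Z" "set ys2' \<subseteq> Field Z"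
    and G': "G1 \<in> hull_hom Z xs1' ys1'" "G2 \<in> hull_hom Z xs2' ys2'" "G3 \<in> hull_hom Z xs1' ys2'"
    by (rule covers_four_blockE[OF cov[unfolded g_eq] hull_homD(1)[OF G(1)] hull_homD(1)[OF G(2)]
          hull_homD(1)[OF G(3)]]) (rule that)
  let ?d = "\<lambda>W :: ('z, 'k) inc_module. rank_excess W xs1' xs2' ys1' ys2' G1 G2 G3"
  \<comment> \<open>Covering moves the ranks from \<open>Q I\<close> to \<open>Z\<close> without
    changing them. This evaluates \<open>?d\<close> on restrictions of modules over \<open>P\<close>
    only; \<open>C'\<close> below need not be one.\<close>
  have d_mult: "?d (restriction \<zeta> X) = int (compression_mult P Q \<xi> I X)" if X: "X \<in> modules P" for X
  proof -
    have eq: "hull_eval (restriction \<zeta> X) us vs A = hull_eval (restriction (\<xi> I) X) (map \<zeta>' us) (map \<zeta>' vs) A"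
      if "set us \<subseteq> Field Z" "set vs \<subseteq> Field Z" for us vs A
      by (rule hull_eval_restriction) (use comp that in blast)
    note eqs = eq[OF F(1,2)] eq[OF F(3,4)] eq[OF F(1,4)]
    show ?thesis
      using bspec[OF mult X]
      unfolding rank_excess_def hull_eval_lower_def Let_def lists eqs
      by (simp add: mat_rank_four_block_diag[OF carrier_matI[OF refl refl] carrier_matI[OF refl refl]])
  qed
  have dL: "?d L = 1"
    unfolding L_def d_mult[OF V] compression_mult_def V_def[symmetric] L\<^sub>0_def[symmetric]
    by (simp add: multiplicity_self[OF fin conn L\<^sub>0])
  have m_eq: "m = multiplicity (Q I) (restriction (\<xi> I) M) L\<^sub>0"
    unfolding m_def compression_mult_def V_def L\<^sub>0_def ..
  \<comment> \<open>The decomposition is made over \<open>Q I\<close>, which is finite and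
    connected, so that its exponent is the compression multiplicity; it is then restricted to
    \<open>Z\<close>.\<close>
  obtain C where C: "C \<in> modules (Q I)" "\<not> is_summand (Q I) L\<^sub>0 C"
    "isomorphic_modules (Q I) (restriction (\<xi> I) M) (copies m L\<^sub>0 C)"
    by (rule multiplicity_decomposition[OF fin conn L\<^sub>0 restriction_modules[OF \<xi> assms(8)],
          folded m_eq]) (rule that)
  define C' where "C' = restriction \<zeta>' C"
  have C': "C' \<in> modules Z"
    unfolding C'_def by (rule restriction_modules[OF \<zeta>' C(1)])
  have comp_iso: "isomorphic_modules Z (restriction \<zeta> X) (restriction \<zeta>' (restriction (\<xi> I) X))"
    if "X \<in> modules P" for X :: "('p, 'k) inc_module"
    by (rule restriction_eq_comp[OF comp restriction_modules[OF assms(6) that]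
          restriction_modules[OF \<zeta>' restriction_modules[OF \<xi> that]]])
  \<comment> \<open>Restricting \<open>L\<^sub>0\<close> along \<zeta>' gives \<open>L\<close> only
    up to isomorphism, as \<zeta> agrees with the composite just on \<open>Field Z\<close>.\<close>
  have copies_cong: "isomorphic_modules Z (copies n A C') (copies n L C')"
    if "isomorphic_modules Z A L" for n A
  proof (induction n)
    case 0
    show ?case
      using isomorphic_modules_refl[OF copies_modules[OF L(2) C', of 0]] by simp
  next
    case (Suc n)
    note A = isomorphic_modulesD(1)[OF that]
    have "isomorphic_modules Z (copies (Suc n) A C') (direct_sum A (copies n A C'))"
      by (rule copies_Suc[OF A C'])
    also have "isomorphic_modules Z \<dots> (direct_sum L (copies n L C'))"
      by (rule isomorphic_modules_direct_sum[OF that Suc])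
    also have "isomorphic_modules Z \<dots> (copies (Suc n) L C')"
      by (rule isomorphic_modules_sym[OF copies_Suc[OF L(2) C']])
    finally show ?case .
  qed
  have "isomorphic_modules Z (restriction \<zeta> M) (restriction \<zeta>' (restriction (\<xi> I) M))"
    by (rule comp_iso[OF assms(8)])
  also have "isomorphic_modules Z \<dots> (copies m (restriction \<zeta>' L\<^sub>0) C')"
    using restriction_isomorphic[OF \<zeta>' C(3)] unfolding restriction_copies C'_def .
  also have "isomorphic_modules Z \<dots> (copies m L C')"
    by (rule copies_cong) (unfold L_def L\<^sub>0_def, rule isomorphic_modules_sym[OF comp_iso[OF V]])
  finally have dec: "isomorphic_modules Z (restriction \<zeta> M) (copies m L C')" .
  have "?d C' = 0"
    using rank_excess_copies[OF L(2) C' F G' dec] d_mult[OF assms(8)] dL unfolding m_def by simp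
  have "\<not> is_summand Z L C'"
  proof
    assume "is_summand Z L C'"
    then obtain B where B: "B \<in> modules Z" "isomorphic_modules Z C' (direct_sum L B)"
      using is_summandE[OF _ C' L(2)] by metis
    \<comment> \<open>A copy of \<open>L\<close> contributes 1, and nonnegativity on the complement
      \<open>B\<close> keeps this from being compensated.\<close>
    have "?d C' = 1 + ?d B"
      using rank_excess_direct_sum[OF B(2) L(2) B(1) F G'] dL by simp
    then show False
      using rank_excess_nonneg[OF B(1) F G'] \<open>?d C' = 0\<close> by simp
  qed
  then have "dbar Z (restriction \<zeta> M) L = m"
    by (rule dbar_eqI[OF L C' dec])
  then show ?thesis
    unfolding m_def L_def V_def by simp
qed

end
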